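(* Consider the finite-server system under GRAND-F and suppose that there exists $\boldsymbol{x}\in\mathcal{X}^{\diamond}$ such that $x_{\boldsymbol{0}^s}>0$ for all $s\in\mathcal{S}$. Then there exists $\epsilon>0$ such that, uniformly over all fluid sample paths (FSPs) with initial states $\boldsymbol{x}(0)\in\mathcal{X}^{\diamond}\cap\{\|\boldsymbol{x}-\boldsymbol{x}^{*,\Box}\|\le\epsilon\}$, $$\boldsymbol{x}(t)\to\boldsymbol{x}^{*,\Box},\qquad t\to\infty.$$ Moreover, the FSP $\boldsymbol{x}(t)\equiv\boldsymbol{x}^{*,\Box}$ is the unique invariant FSP (i.e. FSP with $\boldsymbol{x}(t)\equiv\boldsymbol{x}(0)$) satisfying the conditions $x_{\boldsymbol{0}^s}(0)>0$ for all $s\in\mathcal{S}$.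
   Context: **Configurations.** There are customer types $i\in\mathcal{I}=\{1,\dots,I\}$ and server types $s\in\mathcal{S}=\{1,\dots,S\}$. For each $s$ there is a finite set $\bar{\mathcal{K}}^s$ of allowed type-$s$ server configurations $\boldsymbol{k}=(k_1,\dots,k_I;s)$ with non-negative integers $k_i$ (a type-$s$ server may simultaneously serve $k_i$ customers of each type $i$). Monotonicity: if $\boldsymbol{k}\in\bar{\mathcal{K}}^s$ and $0\le k_i'\le k_i$ for all $i$, then $(k_1',\dots,k_I';s)\in\bar{\mathcal{K}}^s$. The zero configuration $\boldsymbol{0}^s=(0,\dots,0;s)$ belongs to $\bar{\mathcal{K}}^s$ for each $s$. For each $i$ there is at least one $s$ with $(\boldsymbol{e}_i;s)\in\bar{\mathcal{K}}^s$, where $\boldsymbol{e}_i$ is the $i$-th unit vector. Put $\mathcal{K}^s=\bar{\mathcal{K}}^s\setminus\{\boldsymbol{0}^s\}$, $\bar{\mathcal{K}}=\bigcup_s\bar{\mathcal{K}}^s$, $\mathcal{K}=\bigcup_s\mathcal{K}^s$. For $\boldsymbol{k}\in\bar{\mathcal{K}}$, $\boldsymbol{k}\pm\boldsymbol{e}_i$ denotes $\boldsymbol{k}$ with $k_i$ replaced by $k_i\pm1$ (same server type). $\mathcal{M}$ is the set of pairs $(\boldsymbol{k},i)$ with $\boldsymbol{k}\in\mathcal{K}$, $\boldsymbol{k}-\boldsymbol{e}_i\in\bar{\mathcal{K}}$; each is identified with the edge $(\boldsymbol{k}-\boldsymbol{e}_i,\boldsymbol{k})$. An arrival (departure) along $(\boldsymbol{k},i)$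 is the placement of a type-$i$ customer into a server in configuration $\boldsymbol{k}-\boldsymbol{e}_i$, making it $\boldsymbol{k}$ (respectively, the departure of a type-$i$ customer from a server in configuration $\boldsymbol{k}$, making it $\boldsymbol{k}-\boldsymbol{e}_i$). **Finite-server system and GRAND-F, indexed by $r$.** The scaling parameter $r\ge1$ goes to infinity along a discrete sequence. There are $H_s=h_sr$ servers of type $s$ (integers), $h_s>0$ fixed. Type-$i$ customers arrive as independent Poisson processes of rate $\lambda_ir$, with independent exponential service times of mean $1/\mu_i$ ($\lambda_i,\mu_i>0$ fixed), unaffected by simultaneous service. $\rho_i=\lambda_i/\mu_i$, normalized so that $\sum_i\rho_i=1$. $X^r_{\boldsymbol{k}}(t)$ is the number of servers in configuration $\boldsymbol{k}\in\bar{\mathcal{K}}$; $\sum_{\boldsymbol{k}\in\bar{\mathcal{K}}^s}X^r_{\boldsymbol{k}}(t)=H_s$. The state is $\boldsymbol{X}^r(t)=\{X^r_{\boldsymbol{k}}(t),\boldsymbol{k}\in\mathcal{K}\}$. Under GRAND-F an arriving type-$i$ customer is placed into a server chosen uniformly at random among all $X^r_{(i)}(t)=\sum_{\boldsymbol{k}\in\bar{\mathcal{K}}:\,\boldsymbol{k}+\boldsymbol{e}_i\in\mathcal{K}}X^r_{\boldsymbol{k}}(t)$ servers where it can fit; if $X^r_{(i)}(t)=0$, it is blocked (leaves immediately). **Driving processes.** The processes for all $r$ are constructed from common primitives: independent unit-rate Poisson processes $\Pi_{\boldsymbol{k}i}$, $(\boldsymbol{k},i)\in\mathcal{M}$, and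 $\Pi_i$, $i\in\mathcal{I}$, and independent i.i.d. sequences $\xi_i(1),\xi_i(2),\dots$, uniform on $[0,1]$. The number of departures along $(\boldsymbol{k},i)$ in $[0,t]$ is $D^r_{\boldsymbol{k}i}(t)=\Pi_{\boldsymbol{k}i}\big(\int_0^tX^r_{\boldsymbol{k}}(u)k_i\mu_i\,du\big)$; the number of type-$i$ arrivals in $[0,t]$ is $A^r_i(t)=\Pi_i(\lambda_irt)$. The configurations that can fit an additional type-$i$ customer are listed in an arbitrary fixed order; the $m$-th type-$i$ arrival, if $X^r_{(i)}\ge1$, is assigned to a server in the $j$-th configuration in the list, where the $j$-th configuration corresponds to the $j$-th consecutive subinterval of $[0,1]$ containing $\xi_i(m)$ in the partition into intervals of lengths $X^r_{\boldsymbol{k}}/X^r_{(i)}$. $A^r_{\boldsymbol{k}i}(t)$ is the number of arrivals placed along $(\boldsymbol{k},i)$ in $[0,t]$. Fluid scaling: $x^r_{\boldsymbol{k}}=X^r_{\boldsymbol{k}}/r$, $d^r_{\boldsymbol{k}i}=D^r_{\boldsymbol{k}i}/r$, $a^r_{\boldsymbol{k}i}=A^r_{\boldsymbol{k}i}/r$. **FSP.** A set of locally Lipschitz continuous functions $[\{x_{\boldsymbol{k}}(\cdot)\}_{\boldsymbol{k}\in\mathcal{K}},\{d_{\boldsymbol{k}i}(\cdot)\}_{(\boldsymbol{k},i)\in\mathcal{M}},\{a_{\boldsymbol{k}i}(\cdot)\}_{(\boldsymbol{k},i)\in\mathcal{M}}]$ on $[0,\infty)$ is a fluid sample path if there exist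 realizations of the primitives satisfying, as $r\to\infty$, uniformly on compact sets, $\frac1r\Pi_{\boldsymbol{k}i}(rt)\to t$, $\frac1r\Pi_i(rt)\to t$ and $\frac1r\sum_{m=1}^{\lfloor r\sigma\rfloor}I\{\xi_i(m)\le\zeta\}\to\sigma\zeta$ ($\sigma\ge0$, $0\le\zeta\le1$), and a subsequence of $r$ (with some initial states $\boldsymbol{X}^r(0)$), along which $[\{x^r_{\boldsymbol{k}}\},\{d^r_{\boldsymbol{k}i}\},\{a^r_{\boldsymbol{k}i}\}]$ converges to it uniformly on compact sets. $\boldsymbol{x}(t)=\{x_{\boldsymbol{k}}(t)\}_{\boldsymbol{k}\in\mathcal{K}}$. **Sets and optimal point.** $\mathcal{X}^{\Box}=\{\boldsymbol{x}\in\mathbb{R}_+^{|\mathcal{K}|}:\sum_{\boldsymbol{k}\in\mathcal{K}^s}x_{\boldsymbol{k}}\le h_s\ \forall s\}$. For $\boldsymbol{x}\in\mathcal{X}^{\Box}$ put $x_{\boldsymbol{0}^s}=h_s-\sum_{\boldsymbol{k}\in\mathcal{K}^s}x_{\boldsymbol{k}}$ and $\bar{\boldsymbol{x}}=\{x_{\boldsymbol{k}},\boldsymbol{k}\in\bar{\mathcal{K}}\}$. $\mathcal{X}^{\diamond}=\{\boldsymbol{x}\in\mathcal{X}^{\Box}:\sum_{\boldsymbol{k}\in\mathcal{K}}k_ix_{\boldsymbol{k}}=\rho_i\ \forall i\}$. With $c_{\boldsymbol{k}}=\prod_ik_i!$ and $0\log0=0$, $L^{\Box}(\bar{\boldsymbol{x}})=\sum_{\boldsymbol{k}\in\bar{\mathcal{K}}}x_{\boldsymbol{k}}\log[x_{\boldsymbol{k}}c_{\boldsymbol{k}}/e]$,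 which is strictly convex. $\boldsymbol{x}^{*,\Box}$ is the unique minimizer of $L^{\Box}(\bar{\boldsymbol{x}})$ over $\boldsymbol{x}\in\mathcal{X}^{\diamond}$. $\|\cdot\|$ is the Euclidean norm. *)

theory Defs
  imports "HOL-Analysis.Analysis"
begin

text \<open>Customer types and server types are the elements of two finite types \<open>'i\<close> and \<open>'s\<close>.
  A configuration \<open>(k, s)\<close> is a server type together with the numbers of customers in service.\<close>

type_synonym ('i, 's) config = "('i \<Rightarrow> nat) \<times> 's"

text \<open>The primitive data: \<open>allowed s\<close> is the set of vectors \<open>k\<close> such that a type-\<open>s\<close> server may
  be in configuration \<open>(k, s)\<close>; \<open>frac s\<close> is \<open>h\<^sub>s\<close>, so that there are \<open>frac s * r\<close> servers of type
  \<open>s\<close>; \<open>listing i\<close> is the fixed order in which the configurations that can fit one more type-\<open>i\<close>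
  customer are listed.\<close>

record ('i, 's) grand_system =
  allowed :: "'s \<Rightarrow> ('i \<Rightarrow> nat) set"
  frac :: "'s \<Rightarrow> real"
  lam :: "'i \<Rightarrow> real"
  mu :: "'i \<Rightarrow> real"
  listing :: "'i \<Rightarrow> ('i, 's) config list"

definition zero_cfg :: "'s \<Rightarrow> ('i, 's) config" where
  "zero_cfg s = ((\<lambda>_. 0), s)"

definition add_cust :: "('i, 's) config \<Rightarrow> 'i \<Rightarrow> ('i, 's) config" where
  "add_cust k i = ((fst k)(i := fst k i + 1), snd k)"

definition del_cust :: "('i, 's) config \<Rightarrow> 'i \<Rightarrow> ('i, 's) config" where
  "del_cust k i = ((fst k)(i := fst k i - 1), snd k)"

definition Kbar_of :: "('i, 's) grand_system \<Rightarrow> 's \<Rightarrow> ('i, 's) config set" where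
  "Kbar_of G s = {k. snd k = s \<and> fst k \<in> allowed G s}"

definition K_of :: "('i, 's) grand_system \<Rightarrow> 's \<Rightarrow> ('i, 's) config set" where
  "K_of G s = Kbar_of G s - {zero_cfg s}"

definition Kbar :: "('i, 's) grand_system \<Rightarrow> ('i, 's) config set" where
  "Kbar G = (\<Union>s. Kbar_of G s)"

definition K :: "('i, 's) grand_system \<Rightarrow> ('i, 's) config set" where
  "K G = (\<Union>s. K_of G s)"

text \<open>Since \<open>del_cust\<close> truncates at \<open>0\<close>, the condition \<open>fst k i \<ge> 1\<close> has to be explicit.\<close>

definition edges :: "('i, 's) grand_system \<Rightarrow> (('i, 's) config \<times> 'i) set" where
  "edges G = {(k, i). k \<in> K G \<and> fst k i \<ge> 1 \<and> del_cust k i \<in> Kbar G}"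

definition fitting :: "('i, 's) grand_system \<Rightarrow> 'i \<Rightarrow> ('i, 's) config set" where
  "fitting G i = {k \<in> Kbar G. add_cust k i \<in> K G}"

definition rho :: "('i, 's) grand_system \<Rightarrow> 'i \<Rightarrow> real" where
  "rho G i = lam G i / mu G i"

definition grand_system_ok :: "('i::finite, 's::finite) grand_system \<Rightarrow> bool" where
  "grand_system_ok G \<longleftrightarrow>
     (\<forall>s. finite (allowed G s)) \<and>
     (\<forall>s. \<forall>k\<in>allowed G s. \<forall>k'. (\<forall>i. k' i \<le> k i) \<longrightarrow> k' \<in> allowed G s) \<and>
     (\<forall>s. (\<lambda>_. 0) \<in> allowed G s) \<and>
     (\<forall>i. \<exists>s. (\<lambda>j. if j = i then 1 else 0) \<in> allowed G s) \<and>
     (\<forall>s. frac G s > 0) \<and>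
     (\<forall>i. lam G i > 0 \<and> mu G i > 0) \<and>
     (\<Sum>i\<in>UNIV. rho G i) = 1 \<and>
     (\<forall>i. distinct (listing G i) \<and> set (listing G i) = fitting G i)"

definition scaling_sequence :: "('i, 's) grand_system \<Rightarrow> (nat \<Rightarrow> real) \<Rightarrow> bool" where
  "scaling_sequence G rs \<longleftrightarrow>
     (\<forall>n. rs n \<ge> 1) \<and> filterlim rs at_top sequentially \<and> (\<forall>n s. frac G s * rs n \<in> \<nat>)"

text \<open>A realization of a unit-rate Poisson process is a counting path with unit jumps at times
  \<open>0 < T 0 < T 1 < \<dots>\<close> tending to infinity. Fluid sample paths are defined through individual
  realizations, so the laws of the primitives enter only through the limits in
  \<open>primitives_ok\<close> below, which hold with probability one.\<close>

definition poisson_path :: "(real \<Rightarrow> nat) \<Rightarrow> bool" where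
  "poisson_path N \<longleftrightarrow>
     (\<exists>T::nat \<Rightarrow> real. 0 < T 0 \<and> strict_mono T \<and> filterlim T at_top sequentially \<and>
        (\<forall>t\<ge>0. N t = card {n. T n \<le> t}))"

definition fit_count :: "('i, 's) grand_system \<Rightarrow> (('i, 's) config \<Rightarrow> nat) \<Rightarrow> 'i \<Rightarrow> nat" where
  "fit_count G Y i = (\<Sum>k\<in>fitting G i. Y k)"

text \<open>The configuration whose subinterval of \<open>[0, 1]\<close> contains \<open>u\<close>. The subintervals are taken
  closed on the right (the first nonempty one also contains \<open>0\<close>), and intervals of length \<open>0\<close> are
  never selected.\<close>

definition selected ::
    "('i, 's) grand_system \<Rightarrow> (('i, 's) config \<Rightarrow> nat) \<Rightarrow> 'i \<Rightarrow> real \<Rightarrow> ('i, 's) config" where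
  "selected G Y i u = listing G i ! (LEAST j. j < length (listing G i) \<and>
     0 < Y (listing G i ! j) \<and>
     u \<le> (\<Sum>l\<le>j. real (Y (listing G i ! l)) / real (fit_count G Y i)))"

definition event_time :: "(real \<Rightarrow> nat) \<Rightarrow> real \<Rightarrow> nat \<Rightarrow> real" where
  "event_time N c m = Inf {t. 0 \<le> t \<and> m \<le> N (c * t)}"

definition state_before :: "(real \<Rightarrow> ('i, 's) config \<Rightarrow> nat) \<Rightarrow> real \<Rightarrow> ('i, 's) config \<Rightarrow> nat" where
  "state_before X t = (\<lambda>k. Lim (at_left t) (\<lambda>u. X u k))"

definition placed_arrivals ::
    "('i, 's) grand_system \<Rightarrow> real \<Rightarrow> ('i \<Rightarrow> real \<Rightarrow> nat) \<Rightarrow> ('i \<Rightarrow> nat \<Rightarrow> real) \<Rightarrow>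
     (real \<Rightarrow> ('i, 's) config \<Rightarrow> nat) \<Rightarrow> ('i, 's) config \<Rightarrow> 'i \<Rightarrow> real \<Rightarrow> nat set" where
  "placed_arrivals G r Pa xi X k i t =
     {m. 1 \<le> m \<and> m \<le> Pa i (lam G i * r * t) \<and>
         (let Y = state_before X (event_time (Pa i) (lam G i * r) m)
          in fit_count G Y i \<ge> 1 \<and> selected G Y i (xi i m) = del_cust k i)}"

definition step_path :: "(real \<Rightarrow> nat) \<Rightarrow> bool" where
  "step_path f \<longleftrightarrow>
     (\<forall>t\<ge>0. \<forall>\<^sub>F u in at_right t. f u = f t) \<and>
     (\<forall>t>0. \<exists>y. \<forall>\<^sub>F u in at_left t. f u = y)"

text \<open>\<open>X\<close>, \<open>D\<close>, \<open>A\<close> are the state, departure and arrival processes of the system with parameter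
  \<open>r\<close> driven by the realizations \<open>Pd\<close>, \<open>Pa\<close>, \<open>xi\<close>. The numbers \<open>X t k\<close> are given for
  \<open>k \<in> Kbar G\<close>, including the zero configurations.\<close>

definition grand_f_path ::
    "('i::finite, 's::finite) grand_system \<Rightarrow> real \<Rightarrow>
     (('i, 's) config \<times> 'i \<Rightarrow> real \<Rightarrow> nat) \<Rightarrow> ('i \<Rightarrow> real \<Rightarrow> nat) \<Rightarrow> ('i \<Rightarrow> nat \<Rightarrow> real) \<Rightarrow>
     (real \<Rightarrow> ('i, 's) config \<Rightarrow> nat) \<Rightarrow>
     (real \<Rightarrow> ('i, 's) config \<times> 'i \<Rightarrow> nat) \<Rightarrow>
     (real \<Rightarrow> ('i, 's) config \<times> 'i \<Rightarrow> nat) \<Rightarrow> bool" where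
  "grand_f_path G r Pd Pa xi X D A \<longleftrightarrow>
     (\<forall>k\<in>Kbar G. step_path (\<lambda>t. X t k)) \<and>
     (\<forall>t\<ge>0. \<forall>s. real (\<Sum>k\<in>Kbar_of G s. X t k) = frac G s * r) \<and>
     (\<forall>t\<ge>0. \<forall>(k, i)\<in>edges G.
        D t (k, i) = Pd (k, i) (integral {0..t} (\<lambda>u. real (X u k) * real (fst k i) * mu G i))) \<and>
     (\<forall>t\<ge>0. \<forall>(k, i)\<in>edges G. A t (k, i) = card (placed_arrivals G r Pa xi X k i t)) \<and>
     (\<forall>t\<ge>0. \<forall>k\<in>Kbar G.
        real (X t k) = real (X 0 k)
          + (\<Sum>i | (k, i) \<in> edges G. real (A t (k, i)) - real (D t (k, i)))
          - (\<Sum>i | (add_cust k i, i) \<in> edges G.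
               real (A t (add_cust k i, i)) - real (D t (add_cust k i, i))))"

definition primitives_ok ::
    "('i, 's) grand_system \<Rightarrow> (nat \<Rightarrow> real) \<Rightarrow>
     (('i, 's) config \<times> 'i \<Rightarrow> real \<Rightarrow> nat) \<Rightarrow> ('i \<Rightarrow> real \<Rightarrow> nat) \<Rightarrow> ('i \<Rightarrow> nat \<Rightarrow> real) \<Rightarrow> bool" where
  "primitives_ok G rs Pd Pa xi \<longleftrightarrow>
     (\<forall>e\<in>edges G. poisson_path (Pd e) \<and>
        (\<forall>C. uniform_limit {0..C} (\<lambda>n t. real (Pd e (rs n * t)) / rs n) (\<lambda>t. t) sequentially)) \<and>
     (\<forall>i. poisson_path (Pa i) \<and>
        (\<forall>C. uniform_limit {0..C} (\<lambda>n t. real (Pa i (rs n * t)) / rs n) (\<lambda>t. t) sequentially)) \<and>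
     (\<forall>i. (\<forall>m. xi i m \<in> {0..1}) \<and>
        (\<forall>C. uniform_limit ({0..C} \<times> {0..1})
               (\<lambda>n (\<sigma>, \<zeta>). real (card {m \<in> {1..nat \<lfloor>rs n * \<sigma>\<rfloor>}. xi i m \<le> \<zeta>}) / rs n)
               (\<lambda>(\<sigma>, \<zeta>). \<sigma> * \<zeta>) sequentially))"

definition locally_lipschitz :: "(real \<Rightarrow> real) \<Rightarrow> bool" where
  "locally_lipschitz f \<longleftrightarrow> (\<forall>t\<ge>0. \<exists>\<delta>>0. \<exists>L. L-lipschitz_on ({0..} \<inter> cball t \<delta>) f)"

text \<open>Vectors in \<open>\<real>\<^bsup>|K|\<^esup>\<close> are functions on all configurations of which only the values on
  \<open>K G\<close> are ever used; similarly for families indexed by \<open>edges G\<close>.\<close>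

definition fluid_sample_path ::
    "('i::finite, 's::finite) grand_system \<Rightarrow> (nat \<Rightarrow> real) \<Rightarrow>
     (real \<Rightarrow> ('i, 's) config \<Rightarrow> real) \<Rightarrow>
     (real \<Rightarrow> ('i, 's) config \<times> 'i \<Rightarrow> real) \<Rightarrow>
     (real \<Rightarrow> ('i, 's) config \<times> 'i \<Rightarrow> real) \<Rightarrow> bool" where
  "fluid_sample_path G rs x d a \<longleftrightarrow>
     (\<forall>k\<in>K G. locally_lipschitz (\<lambda>t. x t k)) \<and>
     (\<forall>e\<in>edges G. locally_lipschitz (\<lambda>t. d t e) \<and> locally_lipschitz (\<lambda>t. a t e)) \<and>
     (\<exists>Pd Pa xi. primitives_ok G rs Pd Pa xi \<and>
       (\<exists>\<nu>::nat \<Rightarrow> nat. strict_mono \<nu> \<and>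
         (\<exists>X D A. (\<forall>n. grand_f_path G (rs (\<nu> n)) Pd Pa xi (X n) (D n) (A n)) \<and>
           (\<forall>C.
             (\<forall>k\<in>K G. uniform_limit {0..C}
                (\<lambda>n t. real (X n t k) / rs (\<nu> n)) (\<lambda>t. x t k) sequentially) \<and>
             (\<forall>e\<in>edges G. uniform_limit {0..C}
                (\<lambda>n t. real (D n t e) / rs (\<nu> n)) (\<lambda>t. d t e) sequentially) \<and>
             (\<forall>e\<in>edges G. uniform_limit {0..C}
                (\<lambda>n t. real (A n t e) / rs (\<nu> n)) (\<lambda>t. a t e) sequentially)))))"

definition bar :: "('i, 's) grand_system \<Rightarrow> (('i, 's) config \<Rightarrow> real) \<Rightarrow> ('i, 's) config \<Rightarrow> real" where
  "bar G x k = (if k = zero_cfg (snd k)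
                then frac G (snd k) - (\<Sum>k'\<in>K_of G (snd k). x k') else x k)"

definition X_box :: "('i, 's) grand_system \<Rightarrow> (('i, 's) config \<Rightarrow> real) set" where
  "X_box G = {x. (\<forall>k\<in>K G. 0 \<le> x k) \<and> (\<forall>s. (\<Sum>k\<in>K_of G s. x k) \<le> frac G s)}"

definition X_diamond :: "('i, 's) grand_system \<Rightarrow> (('i, 's) config \<Rightarrow> real) set" where
  "X_diamond G = {x \<in> X_box G. \<forall>i. (\<Sum>k\<in>K G. real (fst k i) * x k) = rho G i}"

definition c_fact :: "('i::finite, 's) config \<Rightarrow> real" where
  "c_fact k = (\<Prod>i\<in>UNIV. fact (fst k i))"

definition L_box :: "('i::finite, 's) grand_system \<Rightarrow> (('i, 's) config \<Rightarrow> real) \<Rightarrow> real" where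
  "L_box G x = (\<Sum>k\<in>Kbar G. bar G x k * ln (bar G x k * c_fact k / exp 1))"

text \<open>The minimizer is unique only as a vector on \<open>K G\<close>; the values of \<open>x_opt G\<close> elsewhere are
  arbitrary. The convention \<open>0 log 0 = 0\<close> in \<open>L_box\<close> is automatic.\<close>

definition x_opt :: "('i::finite, 's) grand_system \<Rightarrow> ('i, 's) config \<Rightarrow> real" where
  "x_opt G = arg_min_on (L_box G) (X_diamond G)"

definition distK :: "('i, 's) grand_system \<Rightarrow> (('i, 's) config \<Rightarrow> real) \<Rightarrow>
    (('i, 's) config \<Rightarrow> real) \<Rightarrow> real" where
  "distK G x y = L2_set (\<lambda>k. x k - y k) (K G)"

definition invariant_path ::
    "('i, 's) grand_system \<Rightarrow> (real \<Rightarrow> ('i, 's) config \<Rightarrow> real) \<Rightarrow> bool" where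
  "invariant_path G x \<longleftrightarrow> (\<forall>t\<ge>0. \<forall>k\<in>K G. x t k = x 0 k)"

definition idle_positive :: "('i, 's) grand_system \<Rightarrow> (('i, 's) config \<Rightarrow> real) \<Rightarrow> bool" where
  "idle_positive G x \<longleftrightarrow> (\<forall>s. bar G x (zero_cfg s) > 0)"

end

theory Submission
  imports Defs "HOL-Library.Discrete_Functions"
begin

text \<open>In the fluid limit a type-\<open>i\<close> customer is placed along the edge \<open>(k, i)\<close> at rate
  \<open>a\<^sub>k\<^sub>i = \<lambda>\<^sub>i x\<^bsub>k - e\<^sub>i\<^esub> / x\<^bsub>(i)\<^esub>\<close> and leaves along it at rate \<open>d\<^sub>k\<^sub>i = \<mu>\<^sub>i k\<^sub>i x\<^sub>k\<close>, as long as there is room for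
  type \<open>i\<close> (\<open>fluid_sample_path_equations\<close>). On \<open>X_diamond\<close> the total rates of type-\<open>i\<close> arrivals and departures
  agree, and since \<open>c\<^sub>k = k\<^sub>i c\<^bsub>k - e\<^sub>i\<^esub>\<close> the gradient of \<open>L_box\<close> changes along the edge by \<open>ln (d\<^sub>k\<^sub>i / a\<^sub>k\<^sub>i)\<close> plus a
  constant depending on \<open>i\<close> only. Hence \<open>L_box\<close> decreases at the rate
  \<open>\<Sum> (a\<^sub>k\<^sub>i - d\<^sub>k\<^sub>i) (ln a\<^sub>k\<^sub>i - ln d\<^sub>k\<^sub>i) \<ge> 0\<close> (\<open>grad_drift\<close>). The rate vanishes only if arrivals and departures
  balance along every edge. Then the gradient is affine in \<open>k\<close>, so it annihilates all directions that
  conserve servers and customers, and by strict convexity the point is the minimizer (\<open>balanced_eq_ystar\<close>).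

  The hypothesis provides a feasible point with idle servers of every type. From it a feasible point with
  all coordinates positive is obtained, and the infinite slope of \<open>u ln u\<close> at \<open>0\<close> forces the minimizer to have
  positive coordinates as well (\<open>ystar_positive\<close>). Near it the equations are therefore smooth, and compactness
  turns the Lyapunov function into uniform local stability (\<open>fluid_stability\<close>). At an invariant point with
  idle servers of every type all configurations are in use, because an unused one would have an inflow and no
  outflow; so the dissipation vanishes and the point is the minimizer (\<open>invariant_solution_unique\<close>).

  The fluid equations come from laws of large numbers for the paths of the finite systems. The one for
  placed arrivals (\<open>arrivals_law\<close>) cuts time into short blocks. Within a block the partition of \<open>[0, 1]\<close> that
  assigns the arrivals hardly moves, so the assigned arrivals are counted by the marks in two nearly equal
  fixed intervals.

  That the constant function is a fluid sample path requires realizations of the primitives and of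
  all the finite systems that they drive. The marks run through finer and finer grids. The jump times of the
  Poisson paths are the positive integers, perturbed by distinct powers of a number that is transcendental over
  the countable field generated by the rates; this excludes simultaneous events, so the finite systems can be
  built event by event (\<open>path_exists\<close>). Started near the minimizer, their scaled paths stay near it on
  compact time intervals by Gronwall's inequality (\<open>deviation_limit\<close>).\<close>

section \<open>Configurations, edges and flows\<close>

locale grand_model =
  fixes G :: "('i::finite, 's::finite) grand_system"
  assumes ok: "grand_system_ok G"
begin

lemma frac_pos: "frac G s > 0" and lam_pos: "lam G i > 0" and mu_pos: "mu G i > 0"
  and rho_pos: "rho G i > 0"
  using ok unfolding grand_system_ok_def rho_def by auto

lemma Kbar_iff: "k \<in> Kbar G \<longleftrightarrow> fst k \<in> allowed G (snd k)"
  by (auto simp: Kbar_def Kbar_of_def)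

lemma Kbar_of_iff: "k \<in> Kbar_of G s \<longleftrightarrow> k \<in> Kbar G \<and> snd k = s"
  by (auto simp: Kbar_def Kbar_of_def)

lemma K_iff: "k \<in> K G \<longleftrightarrow> k \<in> Kbar G \<and> k \<noteq> zero_cfg (snd k)"
  by (auto simp: K_def K_of_def Kbar_def Kbar_of_def zero_cfg_def)

lemma K_of_iff: "k \<in> K_of G s \<longleftrightarrow> k \<in> K G \<and> snd k = s"
  by (auto simp: K_def K_of_def Kbar_def Kbar_of_def zero_cfg_def)

lemma allowed_mono:
  assumes "k \<in> allowed G s" "\<And>i. k' i \<le> k i" shows "k' \<in> allowed G s"
  using ok assms unfolding grand_system_ok_def by blast

lemma zero_in_Kbar: "zero_cfg s \<in> Kbar G"
  using ok unfolding grand_system_ok_def by (auto simp: Kbar_iff zero_cfg_def)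

lemma zero_in_Kbar_of: "zero_cfg s \<in> Kbar_of G s"
  using zero_in_Kbar by (auto simp: Kbar_of_iff zero_cfg_def)

lemma snd_zero_cfg[simp]: "snd (zero_cfg s) = s" and fst_zero_cfg[simp]: "fst (zero_cfg s) i = 0"
  by (auto simp: zero_cfg_def)

lemma Kbar_of_eq: "Kbar_of G s = insert (zero_cfg s) (K_of G s)"
  using zero_in_Kbar_of unfolding K_of_def by auto

lemma finite_Kbar_of[simp]: "finite (Kbar_of G s)"
proof -
  have "Kbar_of G s = (\<lambda>f. (f, s)) ` allowed G s"
    unfolding Kbar_of_def by force
  moreover have "finite (allowed G s)" using ok unfolding grand_system_ok_def by auto
  ultimately show ?thesis by simp
qed

lemma finite_Kbar[simp]: "finite (Kbar G)"
  unfolding Kbar_def by auto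

lemma finite_K[simp]: "finite (K G)" and finite_K_of[simp]: "finite (K_of G s)"
  using finite_Kbar by (auto simp: K_of_def intro: finite_subset[of _ "Kbar G"] simp: K_iff)

lemma add_del_cust: "fst k i \<ge> 1 \<Longrightarrow> add_cust (del_cust k i) i = k"
  by (auto simp: add_cust_def del_cust_def intro!: prod_eqI)

lemma del_add_cust[simp]: "del_cust (add_cust k i) i = k"
  by (auto simp: add_cust_def del_cust_def)

lemma snd_add_cust[simp]: "snd (add_cust k i) = snd k" and snd_del_cust[simp]: "snd (del_cust k i) = snd k"
  by (auto simp: add_cust_def del_cust_def)

lemma fst_add_cust: "fst (add_cust k i) j = (if j = i then fst k j + 1 else fst k j)"
  and fst_del_cust: "fst (del_cust k i) j = (if j = i then fst k j - 1 else fst k j)"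
  by (auto simp: add_cust_def del_cust_def)

lemma del_in_Kbar: "k \<in> Kbar G \<Longrightarrow> del_cust k i \<in> Kbar G"
  unfolding Kbar_iff by (auto intro: allowed_mono simp: fst_del_cust)

lemma add_in_KbarD: "add_cust k i \<in> Kbar G \<Longrightarrow> k \<in> Kbar G"
  using del_in_Kbar[of "add_cust k i" i] by simp

lemma add_cust_neq_zero[simp]: "add_cust k i \<noteq> zero_cfg s"
proof
  assume "add_cust k i = zero_cfg s"
  then have "fst (add_cust k i) i = 0" by simp
  then show False by (simp add: fst_add_cust)
qed

lemma edges_iff: "(k, i) \<in> edges G \<longleftrightarrow> k \<in> Kbar G \<and> fst k i \<ge> 1"
proof -
  have "k \<noteq> zero_cfg (snd k)" if "fst k i \<ge> 1"
    using that by (metis fst_zero_cfg not_one_le_zero)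
  then show ?thesis by (auto simp: edges_def K_iff del_in_Kbar)
qed

lemma fitting_iff: "k \<in> fitting G i \<longleftrightarrow> add_cust k i \<in> Kbar G"
  by (auto simp: fitting_def K_iff dest: add_in_KbarD)

lemma fitting_Kbar: "k \<in> fitting G i \<Longrightarrow> k \<in> Kbar G"
  by (simp add: fitting_iff add_in_KbarD)

lemma finite_fitting[simp]: "finite (fitting G i)"
  by (rule finite_subset[OF _ finite_Kbar]) (auto dest: fitting_Kbar)

lemma finite_edges[simp]: "finite (edges G)"
  by (rule finite_subset[of _ "Kbar G \<times> UNIV"]) (auto simp: edges_iff)

lemma add_edge_iff: "(add_cust k i, i) \<in> edges G \<longleftrightarrow> k \<in> fitting G i"
  by (simp add: edges_iff fitting_iff fst_add_cust)

lemma del_fitting: "(k, i) \<in> edges G \<Longrightarrow> del_cust k i \<in> fitting G i"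
  using add_edge_iff[of "del_cust k i" i] by (simp add: edges_iff add_del_cust)

lemma edge_Kbar: "(k, i) \<in> edges G \<Longrightarrow> k \<in> Kbar G"
  by (simp add: edges_iff)

text \<open>Every configuration is reached from an idle server by adding customers one at a time; monotonicity
  keeps the intermediate configurations allowed.\<close>

lemma config_induct [consumes 1, case_names zero edge]:
  assumes "k \<in> Kbar G" and zero: "\<And>s. P (zero_cfg s)"
    and edge: "\<And>k i. (k, i) \<in> edges G \<Longrightarrow> P (del_cust k i) \<Longrightarrow> P k"
  shows "P k"
  using assms(1)
proof (induction "\<Sum>i\<in>UNIV. fst k i" arbitrary: k)
  case 0
  then have "k = zero_cfg (snd k)" by (auto simp: zero_cfg_def prod_eq_iff)
  then show ?case using zero by metis
next
  case (Suc n)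
  then obtain i where i: "fst k i \<ge> 1"
    by (metis One_nat_def Suc_leI neq0_conv sum.neutral nat.distinct(1))
  have "(\<Sum>j\<in>UNIV. fst k j) = (\<Sum>j\<in>UNIV. fst (del_cust k i) j + (if j = i then 1 else 0))"
    by (rule sum.cong) (use i in \<open>auto simp: fst_del_cust\<close>)
  then have "n = (\<Sum>j\<in>UNIV. fst (del_cust k i) j)" using Suc.hyps(2) by (simp add: sum.distrib)
  then have "P (del_cust k i)" by (intro Suc.hyps(1) del_in_Kbar Suc.prems)
  then show ?case using Suc.prems i by (intro edge[of k i]) (simp_all add: edges_iff)
qed

lemma inj_add_cust: "inj (\<lambda>k. add_cust k i)"
  by (rule injI) (metis del_add_cust)

lemma edges_eq_fitting: "{k. (k, i) \<in> edges G} = (\<lambda>k. add_cust k i) ` fitting G i"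
proof -
  have "k \<in> (\<lambda>k. add_cust k i) ` fitting G i" if "(k, i) \<in> edges G" for k
    by (rule image_eqI[of _ _ "del_cust k i"]) (use that in \<open>auto simp: edges_iff add_del_cust del_fitting\<close>)
  then show ?thesis by (auto simp: add_edge_iff)
qed

lemma sum_edges_fitting: "(\<Sum>k | (k, i) \<in> edges G. f k) = (\<Sum>k\<in>fitting G i. f (add_cust k i))"
  unfolding edges_eq_fitting by (subst sum.reindex) (auto intro: inj_on_subset[OF inj_add_cust])

lemma sum_edges: "(\<Sum>e\<in>edges G. f e) = (\<Sum>i\<in>UNIV. \<Sum>k | (k, i) \<in> edges G. f (k, i))"
proof -
  have fin: "finite {k. (k, i) \<in> edges G}" for i
    unfolding edges_eq_fitting by simp
  have "(\<Sum>e\<in>edges G. f e) = (\<Sum>p\<in>(SIGMA i:UNIV. {k. (k, i) \<in> edges G}). f (snd p, fst p))"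
    by (rule sum.reindex_bij_witness[where j = "\<lambda>e. (snd e, fst e)" and i = "\<lambda>p. (snd p, fst p)"]) auto
  also have "\<dots> = (\<Sum>i\<in>UNIV. \<Sum>k | (k, i) \<in> edges G. f (k, i))"
    by (subst sum.Sigma) (auto simp: fin case_prod_beta)
  finally show ?thesis .
qed

lemma fitting_nonempty: "\<exists>s. zero_cfg s \<in> fitting G i"
proof -
  obtain s where "(\<lambda>j. if j = i then 1 else 0) \<in> allowed G s"
    using ok unfolding grand_system_ok_def by blast
  moreover have "fst (add_cust (zero_cfg s) i) = (\<lambda>j. if j = i then 1 else 0)"
    by (auto simp: fst_add_cust)
  ultimately have "zero_cfg s \<in> fitting G i" by (simp add: fitting_iff Kbar_iff)
  then show ?thesis ..
qed

text \<open>The edge \<open>(k, i)\<close> with weight \<open>w\<close> carries the mass \<open>w\<close> from \<open>k - e\<^sub>i\<close> to \<open>k\<close>.\<close>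

definition netflow :: "(('i, 's) config \<times> 'i \<Rightarrow> real) \<Rightarrow> ('i, 's) config \<Rightarrow> real" where
  "netflow w k = (\<Sum>i | (k, i) \<in> edges G. w (k, i)) - (\<Sum>i | (add_cust k i, i) \<in> edges G. w (add_cust k i, i))"

text \<open>Summation by parts: every conservation law and the derivative of the Lyapunov function come from
  this identity, for different test functions \<open>g\<close>.\<close>

lemma sum_netflow:
  "(\<Sum>k\<in>Kbar G. g k * netflow w k) = (\<Sum>e\<in>edges G. w e * (g (fst e) - g (del_cust (fst e) (snd e))))"
proof -
  have E: "edges G = (SIGMA k:Kbar G. {i. (k, i) \<in> edges G})" by (auto simp: edge_Kbar)
  have 1: "(\<Sum>k\<in>Kbar G. g k * (\<Sum>i | (k, i) \<in> edges G. w (k, i))) = (\<Sum>e\<in>edges G. w e * g (fst e))"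
    by (subst (2) E) (simp add: sum.Sigma sum_distrib_left mult.commute case_prod_beta)
  have "(\<Sum>k\<in>Kbar G. g k * (\<Sum>i | (add_cust k i, i) \<in> edges G. w (add_cust k i, i)))
      = (\<Sum>p\<in>(SIGMA k:Kbar G. {i. (add_cust k i, i) \<in> edges G}). w (add_cust (fst p) (snd p), snd p) * g (fst p))"
    by (simp add: sum.Sigma sum_distrib_left mult.commute case_prod_beta)
  also have "\<dots> = (\<Sum>e\<in>edges G. w e * g (del_cust (fst e) (snd e)))"
    by (rule sum.reindex_bij_witness[where i="\<lambda>e. (del_cust (fst e) (snd e), snd e)" and
          j="\<lambda>p. (add_cust (fst p) (snd p), snd p)"])
       (auto simp: edges_iff add_del_cust del_in_Kbar)
  finally show ?thesis
    unfolding netflow_def by (simp add: right_diff_distrib sum_subtractf 1)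
qed

lemma sum_netflow_type: "(\<Sum>k\<in>Kbar_of G s. netflow w k) = 0"
proof -
  have "(\<Sum>k\<in>Kbar_of G s. netflow w k) = (\<Sum>k\<in>Kbar G. (if snd k = s then 1 else 0) * netflow w k)"
    by (rule sum.mono_neutral_cong_left) (auto simp: Kbar_of_iff)
  also have "\<dots> = 0" unfolding sum_netflow by (rule sum.neutral) auto
  finally show ?thesis .
qed

lemma sum_netflow_customers:
  "(\<Sum>k\<in>Kbar G. real (fst k i) * netflow w k) = (\<Sum>k | (k, i) \<in> edges G. w (k, i))"
proof -
  have "(\<Sum>k\<in>Kbar G. real (fst k i) * netflow w k) = (\<Sum>e\<in>edges G. if snd e = i then w e else 0)"
    unfolding sum_netflow by (rule sum.cong) (auto simp: edges_iff fst_del_cust)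
  also have "\<dots> = (\<Sum>k | (k, i) \<in> edges G. w (k, i))"
  proof -
    have "(\<Sum>k | (k, j) \<in> edges G. if snd (k, j) = i then w (k, j) else 0)
        = (if j = i then \<Sum>k | (k, i) \<in> edges G. w (k, i) else 0)" for j
      by simp
    then show ?thesis unfolding sum_edges by simp
  qed
  finally show ?thesis .
qed

subsection \<open>Rates\<close>

text \<open>In the fluid limit an arriving type-\<open>i\<close> customer takes the edge \<open>(k, i)\<close> with probability
  \<open>y (k - e\<^sub>i) / fitmass y i\<close>, where \<open>fitmass y i\<close> is the mass of the servers that can accept it.\<close>

definition fitmass :: "(('i, 's) config \<Rightarrow> real) \<Rightarrow> 'i \<Rightarrow> real" where
  "fitmass y i = (\<Sum>k\<in>fitting G i. y k)"

definition arr :: "(('i, 's) config \<Rightarrow> real) \<Rightarrow> ('i, 's) config \<times> 'i \<Rightarrow> real" where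
  "arr y e = lam G (snd e) * (y (del_cust (fst e) (snd e)) / fitmass y (snd e))"

definition dep :: "(('i, 's) config \<Rightarrow> real) \<Rightarrow> ('i, 's) config \<times> 'i \<Rightarrow> real" where
  "dep y e = real (fst (fst e) (snd e)) * mu G (snd e) * y (fst e)"

definition drift :: "(('i, 's) config \<Rightarrow> real) \<Rightarrow> ('i, 's) config \<Rightarrow> real" where
  "drift y = netflow (\<lambda>e. arr y e - dep y e)"

lemma sum_arr: "fitmass y i > 0 \<Longrightarrow> (\<Sum>k | (k, i) \<in> edges G. arr y (k, i)) = lam G i"
  unfolding sum_edges_fitting arr_def
  by (simp add: sum_distrib_left[symmetric] sum_divide_distrib[symmetric] fitmass_def[symmetric])

lemma sum_dep: "(\<Sum>k | (k, i) \<in> edges G. dep y (k, i)) = mu G i * (\<Sum>k\<in>Kbar G. real (fst k i) * y k)"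
proof -
  have "(\<Sum>k | (k, i) \<in> edges G. dep y (k, i)) = (\<Sum>k\<in>Kbar G. mu G i * (real (fst k i) * y k))"
    by (rule sum.mono_neutral_cong_left) (auto simp: edges_iff dep_def)
  then show ?thesis by (simp add: sum_distrib_left)
qed

text \<open>\<open>X_box\<close> and \<open>X_diamond\<close> in barred coordinates.\<close>

definition server_feasible :: "(('i, 's) config \<Rightarrow> real) \<Rightarrow> bool" where
  "server_feasible y \<longleftrightarrow> (\<forall>k\<in>Kbar G. 0 \<le> y k) \<and> (\<forall>s. (\<Sum>k\<in>Kbar_of G s. y k) = frac G s)"

definition feasible :: "(('i, 's) config \<Rightarrow> real) \<Rightarrow> bool" where
  "feasible y \<longleftrightarrow> server_feasible y \<and> (\<forall>i. (\<Sum>k\<in>Kbar G. real (fst k i) * y k) = rho G i)"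

definition positive :: "(('i, 's) config \<Rightarrow> real) \<Rightarrow> bool" where
  "positive y \<longleftrightarrow> (\<forall>k\<in>Kbar G. 0 < y k)"

lemma bar_K: "k \<in> K G \<Longrightarrow> bar G x k = x k"
  by (auto simp: bar_def K_iff)

lemma bar_zero: "bar G x (zero_cfg s) = frac G s - (\<Sum>k\<in>K_of G s. x k)"
  by (simp add: bar_def)

lemma sum_bar: "(\<Sum>k\<in>Kbar_of G s. bar G x k) = frac G s"
proof -
  have "(\<Sum>k\<in>K_of G s. bar G x k) = (\<Sum>k\<in>K_of G s. x k)"
    by (rule sum.cong) (auto simp: K_of_iff bar_K)
  then show ?thesis unfolding Kbar_of_eq
    by (subst sum.insert) (auto simp: bar_zero K_of_iff K_iff)
qed

lemma Kbar_cases: "k \<in> Kbar G \<Longrightarrow> k \<in> K G \<or> k = zero_cfg (snd k)"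
  by (auto simp: K_iff)

lemma server_feasible_bar_iff: "server_feasible (bar G x) \<longleftrightarrow> x \<in> X_box G"
proof -
  have "Kbar G = K G \<union> range zero_cfg"
    using zero_in_Kbar by (auto simp: K_iff)
  then have "(\<forall>k\<in>Kbar G. 0 \<le> bar G x k) \<longleftrightarrow> (\<forall>k\<in>K G. 0 \<le> x k) \<and> (\<forall>s. 0 \<le> bar G x (zero_cfg s))"
    by (simp add: ball_Un bar_K)
  then show ?thesis by (simp add: server_feasible_def X_box_def sum_bar bar_zero)
qed

lemma sum_customers_bar: "(\<Sum>k\<in>Kbar G. real (fst k i) * bar G x k) = (\<Sum>k\<in>K G. real (fst k i) * x k)"
  by (rule sum.mono_neutral_cong_right) (auto simp: K_iff bar_K)

lemma feasible_bar_iff: "feasible (bar G x) \<longleftrightarrow> x \<in> X_diamond G"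
  by (simp add: feasible_def X_diamond_def server_feasible_bar_iff sum_customers_bar)

lemma bar_eq_self:
  assumes "\<And>s. (\<Sum>k\<in>Kbar_of G s. y k) = frac G s" "k \<in> Kbar G" shows "bar G y k = y k"
proof (cases "k \<in> K G")
  case False
  then have k: "k = zero_cfg (snd k)" using assms(2) Kbar_cases by blast
  have "frac G (snd k) = y (zero_cfg (snd k)) + (\<Sum>k'\<in>K_of G (snd k). y k')"
    using assms(1)[of "snd k"] unfolding Kbar_of_eq by (subst (asm) sum.insert) (auto simp: K_of_iff K_iff)
  then show ?thesis using k by (metis bar_zero add_diff_cancel_right')
qed (simp add: bar_K)

lemma feasible_cong: "(\<And>k. k \<in> Kbar G \<Longrightarrow> y k = z k) \<Longrightarrow> feasible y \<longleftrightarrow> feasible z"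
proof -
  assume eq: "\<And>k. k \<in> Kbar G \<Longrightarrow> y k = z k"
  then have "sum y (Kbar_of G s) = sum z (Kbar_of G s)" for s
    by (intro sum.cong) (auto simp: Kbar_of_iff)
  with eq show ?thesis unfolding feasible_def server_feasible_def by simp
qed

lemma feasible_in_X_diamond: "feasible y \<Longrightarrow> y \<in> X_diamond G"
proof -
  assume y: "feasible y"
  have "feasible (bar G y) \<longleftrightarrow> feasible y"
    by (rule feasible_cong) (use y in \<open>simp add: bar_eq_self feasible_def server_feasible_def\<close>)
  with y show ?thesis by (simp add: feasible_bar_iff)
qed

lemma server_feasible_le: "server_feasible y \<Longrightarrow> k \<in> Kbar G \<Longrightarrow> y k \<le> frac G (snd k)"
proof -
  assume a: "server_feasible y" "k \<in> Kbar G"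
  then have "y k \<le> (\<Sum>k\<in>Kbar_of G (snd k). y k)"
    by (intro member_le_sum) (auto simp: Kbar_of_iff server_feasible_def)
  then show ?thesis using a by (simp add: server_feasible_def)
qed

lemma fitmass_nonneg: "server_feasible y \<Longrightarrow> 0 \<le> fitmass y i"
  unfolding fitmass_def by (rule sum_nonneg) (auto simp: server_feasible_def fitting_Kbar)

lemma fitmass_pos_if_idle:
  assumes "server_feasible y" "\<And>s. 0 < y (zero_cfg s)" shows "0 < fitmass y i"
proof -
  obtain s where s: "zero_cfg s \<in> fitting G i" using fitting_nonempty by blast
  then have "y (zero_cfg s) \<le> fitmass y i"
    unfolding fitmass_def using assms by (intro member_le_sum) (auto simp: server_feasible_def fitting_Kbar)
  with assms(2)[of s] show ?thesis by linarith
qed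

end

section \<open>Entropy and the optimal point\<close>

text \<open>One summand of \<open>L_box\<close>, as a function of the coordinate; its derivative is \<open>ln (u c)\<close>.\<close>

definition ent :: "real \<Rightarrow> real \<Rightarrow> real" where
  "ent c u = u * ln (u * c / exp 1)"

text \<open>Strict convexity, which for \<open>w > 0\<close> is \<open>ln x < x - 1\<close> at \<open>x = u / w\<close>.\<close>

lemma ent_tangent_strict:
  assumes "c > 0" "u > 0" "w \<ge> 0" "w \<noteq> u"
  shows "ent c u + ln (u * c) * (w - u) < ent c w"
proof (cases "w = 0")
  case True
  have "ent c u = u * ln (u * c) - u"
    using assms by (simp add: ent_def ln_div algebra_simps)
  moreover have "ent c w = 0" using True by (simp add: ent_def)
  ultimately show ?thesis using True assms by (simp add: algebra_simps)
next
  case False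
  with assms have w: "w > 0" by simp
  have "ln (u / w) < u / w - 1"
    using assms w ln_le_minus_one[of "u / w"] ln_eq_minus_one[of "u / w"] by (auto simp: less_le)
  then have "w * (ln u - ln w) < u - w"
    using assms w by (simp add: ln_div field_simps)
  then show ?thesis
    using assms w by (simp add: ent_def ln_div ln_mult algebra_simps)
qed

lemma ent_tangent:
  assumes "c > 0" "u > 0" "w \<ge> 0"
  shows "ent c u + ln (u * c) * (w - u) \<le> ent c w"
  using ent_tangent_strict[OF assms] by (cases "w = u") auto

lemma DERIV_ent:
  assumes "c > 0" "u > 0" shows "(ent c has_real_derivative ln (u * c)) (at u)"
proof -
  have "((\<lambda>u. u * (ln u + ln c - 1)) has_real_derivative ln (u * c)) (at u)"
    using assms by (auto intro!: derivative_eq_intros simp: ln_mult)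
  then show ?thesis
  proof (rule has_field_derivative_transform_within_open[where S="{0<..}"])
    show "x * (ln x + ln c - 1) = ent c x" if "x \<in> {0<..}" for x
      using that assms by (simp add: ent_def ln_div ln_mult)
  qed (use assms in auto)
qed

text \<open>This bound, which yields the continuity of \<open>u ln u\<close> at \<open>0\<close>, is \<open>ln s \<le> s - 1\<close> for \<open>s = 1 / sqrt u\<close>.\<close>

lemma abs_u_ln_u_le:
  fixes u :: real assumes "0 < u" "u \<le> 1" shows "\<bar>u * ln u\<bar> \<le> 2 * sqrt u"
proof -
  have s: "0 < sqrt u" using assms by simp
  have "ln (1 / sqrt u) \<le> 1 / sqrt u - 1"
    using s by (intro ln_le_minus_one) simp
  then have "- ln u \<le> 2 / sqrt u"
    using assms s by (simp add: ln_div ln_sqrt)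
  then have "u * (- ln u) \<le> u * (2 / sqrt u)"
    using assms by (intro mult_left_mono) auto
  also have "u * (2 / sqrt u) = 2 * sqrt u"
    using assms s by (simp add: field_simps)
  finally show ?thesis using assms by (simp add: abs_mult)
qed

lemma continuous_on_ent:
  assumes c: "c > 0" shows "continuous_on {0..} (ent c)"
proof -
  have lim: "((\<lambda>u::real. u * ln u) \<longlongrightarrow> 0) (at 0 within {0..})"
  proof (rule Lim_null_comparison)
    show "\<forall>\<^sub>F u::real in at 0 within {0..}. norm (u * ln u) \<le> 2 * sqrt u"
      unfolding eventually_at
      by (rule exI[of _ 1]) (auto simp: dist_norm intro!: abs_u_ln_u_le)
    have "((\<lambda>u::real. 2 * sqrt u) \<longlongrightarrow> 2 * sqrt 0) (at 0 within {0..})"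
      by (intro tendsto_intros)
    then show "((\<lambda>u::real. 2 * sqrt u) \<longlongrightarrow> 0) (at 0 within {0..})" by simp
  qed
  have "continuous (at u within {0..}) (\<lambda>u. u * ln u)" if "u \<ge> 0" for u :: real
  proof (cases "u = 0")
    case True
    with lim show ?thesis by (simp add: continuous_within)
  next
    case False
    with that show ?thesis by (intro continuous_intros) auto
  qed
  then have 1: "continuous_on {0..} (\<lambda>u::real. u * ln u)"
    by (simp add: continuous_on_eq_continuous_within)
  have 2: "ent c u = u * ln u + u * (ln c - 1)" if "u \<in> {0..}" for u
    using that c by (cases "u = 0") (auto simp: ent_def ln_div ln_mult algebra_simps)
  have "continuous_on {0..} (\<lambda>u::real. u * ln u + u * (ln c - 1))"
    by (intro continuous_intros 1)
  then show ?thesis by (rule continuous_on_eq) (use 2 in simp)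
qed

lemma c_fact_pos: "c_fact k > 0"
  by (simp add: c_fact_def prod_pos)

context grand_model
begin

definition entropy :: "(('i, 's) config \<Rightarrow> real) \<Rightarrow> real" where
  "entropy y = (\<Sum>k\<in>Kbar G. ent (c_fact k) (y k))"

text \<open>The partial derivatives of \<open>entropy\<close>, at points with positive coordinates.\<close>

definition grad :: "(('i, 's) config \<Rightarrow> real) \<Rightarrow> ('i, 's) config \<Rightarrow> real" where
  "grad y k = ln (y k * c_fact k)"

lemma L_box_eq: "L_box G x = entropy (bar G x)"
  by (simp add: L_box_def entropy_def ent_def)

lemma entropy_cong: "(\<And>k. k \<in> Kbar G \<Longrightarrow> y k = z k) \<Longrightarrow> entropy y = entropy z"
  unfolding entropy_def by (auto intro: sum.cong)

lemma entropy_tangent: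
  assumes "positive u" "\<And>k. k \<in> Kbar G \<Longrightarrow> 0 \<le> w k"
  shows "entropy u + (\<Sum>k\<in>Kbar G. grad u k * (w k - u k)) \<le> entropy w"
  unfolding entropy_def grad_def sum.distrib[symmetric]
  by (rule sum_mono) (use assms in \<open>auto intro!: ent_tangent simp: c_fact_pos positive_def\<close>)

lemma entropy_tangent_strict:
  assumes "positive u" "\<And>k. k \<in> Kbar G \<Longrightarrow> 0 \<le> w k" "k0 \<in> Kbar G" "w k0 \<noteq> u k0"
  shows "entropy u + (\<Sum>k\<in>Kbar G. grad u k * (w k - u k)) < entropy w"
  unfolding entropy_def grad_def sum.distrib[symmetric]
  by (rule sum_strict_mono_ex1)
     (use assms in \<open>auto intro!: ent_tangent ent_tangent_strict bexI[OF _ assms(3)] assms(2)[OF assms(3)] simp: c_fact_pos positive_def\<close>)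

subsection \<open>Directions that conserve servers and customers\<close>

definition conserving :: "(('i, 's) config \<Rightarrow> real) \<Rightarrow> bool" where
  "conserving v \<longleftrightarrow> (\<forall>s. (\<Sum>k\<in>Kbar_of G s. v k) = 0) \<and> (\<forall>i. (\<Sum>k\<in>Kbar G. real (fst k i) * v k) = 0)"

lemma conserving_diff: "feasible y \<Longrightarrow> feasible z \<Longrightarrow> conserving (\<lambda>k. z k - y k)"
  by (simp add: feasible_def server_feasible_def conserving_def sum_subtractf right_diff_distrib)

text \<open>A small step is harmless at the positive coordinates, at the vanishing ones the sign of \<open>v\<close> decides, and
  the remaining constraints are linear.\<close>

lemma eventually_feasible:
  assumes y: "feasible y" and v: "conserving v" and nn: "\<And>k. k \<in> Kbar G \<Longrightarrow> y k = 0 \<Longrightarrow> 0 \<le> v k"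
  shows "\<forall>\<^sub>F \<tau> in at_right 0. feasible (\<lambda>k. y k + \<tau> * v k) \<and>
           (\<forall>k\<in>Kbar G. 0 < y k \<or> 0 < v k \<longrightarrow> 0 < y k + \<tau> * v k)"
proof -
  have y0: "0 \<le> y k" if "k \<in> Kbar G" for k
    using y that by (simp add: feasible_def server_feasible_def)
  have pos: "\<forall>\<^sub>F \<tau> in at_right 0. 0 < y k \<longrightarrow> 0 < y k + \<tau> * v k" for k
  proof (cases "0 < y k")
    case True
    have "((\<lambda>\<tau>. y k + \<tau> * v k) \<longlongrightarrow> y k + 0 * v k) (at_right 0)"
      by (intro tendsto_intros)
    then show ?thesis using True order_tendstoD(1)[of _ "y k" _ 0] by (auto elim: eventually_mono)
  qed auto
  have "\<forall>\<^sub>F \<tau> in at_right 0. \<forall>k\<in>Kbar G. 0 < y k \<longrightarrow> 0 < y k + \<tau> * v k"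
    by (intro eventually_ball_finite finite_Kbar ballI pos)
  moreover have "\<forall>\<^sub>F \<tau> in at_right (0::real). 0 < \<tau>"
    by (simp add: eventually_at_right_less)
  ultimately show ?thesis
  proof eventually_elim
    case (elim \<tau>)
    have pos: "0 < y k + \<tau> * v k" if "k \<in> Kbar G" "0 < y k \<or> 0 < v k" for k
    proof (cases "0 < y k")
      case False
      with that have "y k = 0" "0 < v k" using y0[OF that(1)] by linarith+
      then show ?thesis using elim by simp
    qed (use elim that in auto)
    have nonneg: "0 \<le> y k + \<tau> * v k" if "k \<in> Kbar G" for k
    proof (cases "0 < y k")
      case False
      with that have "y k = 0" using y0[OF that] by linarith
      then show ?thesis using elim nn that by simp
    qed (use elim that in force)
    have "feasible (\<lambda>k. y k + \<tau> * v k)"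
      using y v nonneg unfolding feasible_def server_feasible_def conserving_def
      by (simp add: sum.distrib distrib_left mult.left_commute sum_distrib_left[symmetric])
    with pos show ?case by blast
  qed
qed

text \<open>If configuration \<open>k\<^sub>0\<close> is unused, it can be used a little: turn some idle servers of its type into
  \<open>k\<^sub>0\<close>, and for every customer thereby added take one customer of the same type away from a
  configuration \<open>m i\<close> that is in use.\<close>

lemma feasible_can_use:
  assumes y: "feasible y" and idle: "\<And>s. 0 < y (zero_cfg s)" and k0: "k0 \<in> Kbar G"
  shows "\<exists>z. feasible z \<and> 0 < z k0"
proof (cases "0 < y k0")
  case False
  have y0: "0 \<le> y k" if "k \<in> Kbar G" for k
    using y that by (simp add: feasible_def server_feasible_def)
  have "\<exists>m. (m, i) \<in> edges G \<and> 0 < y m" for i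
  proof (rule ccontr)
    assume none: "\<not> ?thesis"
    then have "real (fst k i) * y k = 0" if "k \<in> Kbar G" for k
      using y0[OF that] that none edges_iff[of k i] by (cases "fst k i = 0") (simp, fastforce)
    then have "(\<Sum>k\<in>Kbar G. real (fst k i) * y k) = 0" by (rule sum.neutral[OF ballI])
    then show False using y rho_pos[of i] by (simp add: feasible_def)
  qed
  then obtain m where m: "\<And>i. (m i, i) \<in> edges G" "\<And>i. 0 < y (m i)" by metis
  define \<delta> where "\<delta> = (\<lambda>k k' :: ('i, 's) config. if k' = k then 1 else 0 :: real)"
  define v where "v = (\<lambda>k. \<delta> k0 k - \<delta> (zero_cfg (snd k0)) k
      + (\<Sum>i\<in>UNIV. real (fst k0 i) * (\<delta> (del_cust (m i) i) k - \<delta> (m i) k)))"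
  have S1: "(\<Sum>k\<in>Kbar_of G s. \<delta> k' k) = (if snd k' = s then 1 else 0)" if "k' \<in> Kbar G" for s k'
    using that unfolding \<delta>_def by (simp add: Kbar_of_iff)
  have S2: "(\<Sum>k\<in>Kbar G. real (fst k j) * \<delta> k' k) = real (fst k' j)" if "k' \<in> Kbar G" for j k'
    using that unfolding \<delta>_def by (simp add: if_distrib[of "\<lambda>x. _ * x"] cong: if_cong)
  have mK: "m i \<in> Kbar G" "del_cust (m i) i \<in> Kbar G" for i
    using m(1)[of i] by (auto simp: edges_iff del_in_Kbar)
  have "(\<Sum>k\<in>Kbar_of G s. v k) = 0" for s
  proof -
    have "(\<Sum>k\<in>Kbar_of G s. v k) = (\<Sum>k\<in>Kbar_of G s. \<delta> k0 k) - (\<Sum>k\<in>Kbar_of G s. \<delta> (zero_cfg (snd k0)) k)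
      + (\<Sum>i\<in>UNIV. real (fst k0 i) * ((\<Sum>k\<in>Kbar_of G s. \<delta> (del_cust (m i) i) k) - (\<Sum>k\<in>Kbar_of G s. \<delta> (m i) k)))"
      unfolding v_def sum.distrib sum_subtractf
      by (subst sum.swap) (simp add: sum_distrib_left[symmetric] sum_subtractf)
    then show ?thesis by (simp add: S1 mK k0 zero_in_Kbar)
  qed
  moreover have "(\<Sum>k\<in>Kbar G. real (fst k j) * v k) = 0" for j
  proof -
    have "(\<Sum>k\<in>Kbar G. real (fst k j) * v k)
      = (\<Sum>k\<in>Kbar G. real (fst k j) * \<delta> k0 k) - (\<Sum>k\<in>Kbar G. real (fst k j) * \<delta> (zero_cfg (snd k0)) k)
      + (\<Sum>i\<in>UNIV. real (fst k0 i) * ((\<Sum>k\<in>Kbar G. real (fst k j) * \<delta> (del_cust (m i) i) k)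
          - (\<Sum>k\<in>Kbar G. real (fst k j) * \<delta> (m i) k)))"
      unfolding v_def distrib_left right_diff_distrib sum.distrib sum_subtractf sum_distrib_left
      by (subst (1 2) sum.swap) (simp add: algebra_simps sum_distrib_left)
    also have "\<dots> = real (fst k0 j) + (\<Sum>i\<in>UNIV. real (fst k0 i) * (real (fst (del_cust (m i) i) j) - real (fst (m i) j)))"
      by (simp add: S2 mK k0 zero_in_Kbar)
    also have "(\<Sum>i\<in>UNIV. real (fst k0 i) * (real (fst (del_cust (m i) i) j) - real (fst (m i) j)))
        = (\<Sum>i\<in>UNIV. if i = j then - real (fst k0 j) else 0)"
      using m(1) by (intro sum.cong) (auto simp: fst_del_cust edges_iff)
    finally show ?thesis by simp
  qed
  ultimately have v: "conserving v" by (simp add: conserving_def)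
  have nn: "0 \<le> v k" and v1: "k = k0 \<Longrightarrow> 1 \<le> v k" if "k \<in> Kbar G" "y k = 0" for k
  proof -
    have "k \<noteq> zero_cfg s" "k \<noteq> m i" for s i
      using idle[of s] m(2)[of i] that by auto
    then have "v k = \<delta> k0 k + (\<Sum>i\<in>UNIV. real (fst k0 i) * \<delta> (del_cust (m i) i) k)"
      unfolding v_def by (simp add: \<delta>_def)
    moreover have "0 \<le> (\<Sum>i\<in>UNIV. real (fst k0 i) * \<delta> (del_cust (m i) i) k)"
      by (rule sum_nonneg) (simp add: \<delta>_def)
    ultimately show "0 \<le> v k" "k = k0 \<Longrightarrow> 1 \<le> v k" by (auto simp: \<delta>_def)
  qed
  have "y k0 = 0" using False y0[OF k0] by simp
  then have "0 < v k0" using v1[OF k0] by simp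
  then have "\<forall>\<^sub>F \<tau> in at_right 0. feasible (\<lambda>k. y k + \<tau> * v k) \<and> 0 < y k0 + \<tau> * v k0"
    using eventually_feasible[OF y v nn] k0 by (auto elim: eventually_mono)
  then obtain \<tau> where "feasible (\<lambda>k. y k + \<tau> * v k)" "0 < y k0 + \<tau> * v k0"
    using eventually_happens'[OF trivial_limit_at_right_real] by blast
  then show ?thesis by blast
qed (use y in blast)

lemma feasible_average:
  assumes "\<And>a. a \<in> A \<Longrightarrow> feasible (z a)" "finite A" "A \<noteq> {}"
  shows "feasible (\<lambda>k. (\<Sum>a\<in>A. z a k) / card A)"
proof -
  have c: "real (card A) > 0" using assms by (simp add: card_gt_0_iff)
  have "(\<Sum>k\<in>Kbar_of G s. (\<Sum>a\<in>A. z a k) / card A) = frac G s" for s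
    unfolding sum_divide_distrib[symmetric]
    by (subst sum.swap) (use assms c in \<open>simp add: feasible_def server_feasible_def\<close>)
  moreover have "(\<Sum>k\<in>Kbar G. real (fst k i) * ((\<Sum>a\<in>A. z a k) / card A)) = rho G i" for i
    unfolding times_divide_eq_right sum_divide_distrib[symmetric] sum_distrib_left
    by (subst sum.swap) (use assms c in \<open>simp add: feasible_def\<close>)
  moreover have "0 \<le> (\<Sum>a\<in>A. z a k) / card A" if "k \<in> Kbar G" for k
    using assms that by (intro divide_nonneg_nonneg sum_nonneg) (auto simp: feasible_def server_feasible_def)
  ultimately show ?thesis by (simp add: feasible_def server_feasible_def)
qed

text \<open>The average of the points that \<open>feasible_can_use\<close> provides for the single configurations.\<close>

lemma exists_positive_feasible:
  assumes y: "feasible y" and idle: "\<And>s. 0 < y (zero_cfg s)"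
  shows "\<exists>z. feasible z \<and> positive z"
proof -
  obtain z where z: "\<And>k. k \<in> Kbar G \<Longrightarrow> feasible (z k) \<and> 0 < z k k"
    using feasible_can_use[OF y idle] by metis
  have ne: "Kbar G \<noteq> {}" using zero_in_Kbar by auto
  let ?a = "\<lambda>k. (\<Sum>a\<in>Kbar G. z a k) / card (Kbar G)"
  have "0 < ?a k" if k: "k \<in> Kbar G" for k
  proof -
    have "z k k \<le> (\<Sum>a\<in>Kbar G. z a k)"
      using z k by (intro member_le_sum) (auto simp: feasible_def server_feasible_def)
    then have "0 < (\<Sum>a\<in>Kbar G. z a k)" using z[OF k] by linarith
    then show ?thesis using ne by (simp add: card_gt_0_iff)
  qed
  moreover have "feasible ?a" using z ne by (intro feasible_average) auto
  ultimately show ?thesis unfolding positive_def by blast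
qed

subsection \<open>Existence of a minimizer\<close>

text \<open>Compactness is available in the product topology on functions once the irrelevant coordinates are
  fixed; \<open>clip\<close> below maps every feasible vector into this set.\<close>

definition feasible_set :: "(('i, 's) config \<Rightarrow> real) set" where
  "feasible_set = {y. feasible y \<and> (\<forall>k. k \<notin> Kbar G \<longrightarrow> y k = 0)}"

lemma continuous_on_coord[continuous_intros]:
  "continuous_on A (\<lambda>y :: ('i, 's) config \<Rightarrow> real. y k)"
  by (rule continuous_on_subset[OF continuous_on_product_coordinates]) simp

lemma compact_feasible_set: "compact feasible_set"
proof -
  define B where "B = (\<lambda>k. if k \<in> Kbar G then {0..frac G (snd k)} else {0})"
  have "compactin (product_topology (\<lambda>_. euclidean) UNIV) (PiE UNIV B)"
    unfolding compactin_PiE by (auto simp: B_def compactin_euclidean_iff)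
  then have "compact (PiE UNIV B)"
    by (simp add: euclidean_product_topology)
  moreover have "closed {y. feasible y}"
    unfolding feasible_def server_feasible_def Ball_def
    by (intro closed_Collect_conj closed_Collect_all closed_Collect_imp closed_Collect_le closed_Collect_eq)
       (auto intro!: continuous_intros)
  ultimately have "compact (PiE UNIV B \<inter> {y. feasible y})"
    by (rule compact_Int_closed)
  also have "PiE UNIV B \<inter> {y. feasible y} = feasible_set"
    using server_feasible_le by (auto simp: feasible_set_def B_def PiE_iff feasible_def server_feasible_def split: if_splits)
  finally show ?thesis .
qed

lemma continuous_on_entropy: "continuous_on feasible_set entropy"
  unfolding entropy_def
proof (rule continuous_on_sum)
  fix k assume "k \<in> Kbar G"
  then show "continuous_on feasible_set (\<lambda>y. ent (c_fact k) (y k))"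
    by (intro continuous_on_compose2[OF continuous_on_ent[OF c_fact_pos]] continuous_intros)
       (auto simp: feasible_set_def feasible_def server_feasible_def)
qed

definition clip :: "(('i, 's) config \<Rightarrow> real) \<Rightarrow> ('i, 's) config \<Rightarrow> real" where
  "clip y k = (if k \<in> Kbar G then y k else 0)"

lemma clip_in: "feasible y \<Longrightarrow> clip y \<in> feasible_set"
  using feasible_cong[of "clip y" y] by (auto simp: feasible_set_def clip_def)

lemma entropy_minimizer_exists:
  assumes "feasible y0" shows "\<exists>y. feasible y \<and> (\<forall>z. feasible z \<longrightarrow> entropy y \<le> entropy z)"
proof -
  obtain y where y: "y \<in> feasible_set" "\<And>z. z \<in> feasible_set \<Longrightarrow> entropy y \<le> entropy z"
    using continuous_attains_inf[OF compact_feasible_set _ continuous_on_entropy] clip_in[OF assms] by blast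
  have "entropy y \<le> entropy z" if "feasible z" for z
    using y(2)[OF clip_in[OF that]] entropy_cong[of "clip z" z] by (simp add: clip_def)
  then show ?thesis using y(1) by (auto simp: feasible_set_def)
qed

lemma x_opt_minimizes:
  assumes "feasible y0"
  shows "feasible (bar G (x_opt G)) \<and> (\<forall>z. feasible z \<longrightarrow> entropy (bar G (x_opt G)) \<le> entropy z)"
proof -
  obtain y where y: "feasible y" "\<And>z. feasible z \<Longrightarrow> entropy y \<le> entropy z"
    using entropy_minimizer_exists[OF assms] by blast
  have L: "L_box G z = entropy z" if "feasible z" for z
    unfolding L_box_eq by (rule entropy_cong) (use that in \<open>auto simp: bar_eq_self feasible_def server_feasible_def\<close>)
  have "L_box G y \<le> L_box G x" if "x \<in> X_diamond G" for x
    using y(2)[of "bar G x"] that L[OF y(1)] L_box_eq[of x] by (simp add: feasible_bar_iff)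
  then have "is_arg_min (L_box G) (\<lambda>x. x \<in> X_diamond G) y"
    using feasible_in_X_diamond[OF y(1)] by (simp add: is_arg_min_linorder)
  then have m: "is_arg_min (L_box G) (\<lambda>x. x \<in> X_diamond G) (x_opt G)"
    unfolding x_opt_def arg_min_on_def arg_min_def
    by (rule someI[where P = "is_arg_min (L_box G) (\<lambda>x. x \<in> X_diamond G)"])
  have "entropy (bar G (x_opt G)) \<le> entropy z" if "feasible z" for z
    using m feasible_in_X_diamond[OF that] unfolding is_arg_min_linorder L[OF that, symmetric] L_box_eq by auto
  then show ?thesis using m by (auto simp: is_arg_min_linorder feasible_bar_iff)
qed

end

locale slack_model = grand_model +
  assumes slack: "\<exists>x\<in>X_diamond G. idle_positive G x"
begin

definition ystar :: "('a, 'b) config \<Rightarrow> real" where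
  "ystar = bar G (x_opt G)"

lemma positive_feasible: "\<exists>z. feasible z \<and> positive z"
proof -
  obtain x where "x \<in> X_diamond G" "idle_positive G x" using slack by blast
  then show ?thesis
    by (intro exists_positive_feasible[of "bar G x"]) (auto simp: feasible_bar_iff idle_positive_def)
qed

lemma ystar_feasible: "feasible ystar"
  and ystar_min: "feasible z \<Longrightarrow> entropy ystar \<le> entropy z"
  using positive_feasible x_opt_minimizes unfolding ystar_def by auto

text \<open>The tangent at the moved point, rather than at \<open>ystar\<close>, also covers directions that leave the
  boundary, where the gradient is infinite.\<close>

lemma first_order:
  assumes "feasible (\<lambda>k. ystar k + \<tau> * v k)" "positive (\<lambda>k. ystar k + \<tau> * v k)" "\<tau> > 0"
  shows "0 \<le> (\<Sum>k\<in>Kbar G. grad (\<lambda>k. ystar k + \<tau> * v k) k * v k)"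
proof -
  let ?u = "\<lambda>k. ystar k + \<tau> * v k"
  have "entropy ?u + (\<Sum>k\<in>Kbar G. grad ?u k * (ystar k - ?u k)) \<le> entropy ystar"
    using ystar_feasible by (intro entropy_tangent assms(2)) (auto simp: feasible_def server_feasible_def)
  moreover have "(\<Sum>k\<in>Kbar G. grad ?u k * (ystar k - ?u k)) = - \<tau> * (\<Sum>k\<in>Kbar G. grad ?u k * v k)"
    by (simp add: sum_distrib_left sum_negf[symmetric] algebra_simps)
  ultimately have "0 \<le> \<tau> * (\<Sum>k\<in>Kbar G. grad ?u k * v k)"
    using ystar_min[OF assms(1)] by simp
  then show ?thesis using assms(3) by (simp add: zero_le_mult_iff)
qed

text \<open>Moving from \<open>ystar\<close> towards a positive feasible point would decrease the entropy at infinite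
  rate if some coordinate of \<open>ystar\<close> were \<open>0\<close>.\<close>

lemma ystar_positive: "positive ystar"
proof (rule ccontr)
  assume "\<not> positive ystar"
  then obtain k0 where k0: "k0 \<in> Kbar G" "ystar k0 = 0"
    using ystar_feasible by (force simp: positive_def feasible_def server_feasible_def)
  obtain z where z: "feasible z" "positive z" using positive_feasible by blast
  define v where "v = (\<lambda>k. z k - ystar k)"
  let ?g = "\<lambda>\<tau> k. grad (\<lambda>k. ystar k + \<tau> * v k) k * v k"
  have y0: "0 \<le> ystar k" if "k \<in> Kbar G" for k
    using ystar_feasible that by (simp add: feasible_def server_feasible_def)
  have vpos: "0 < v k" if "k \<in> Kbar G" "ystar k = 0" for k
    using z(2) that by (simp add: v_def positive_def)
  have ev: "\<forall>\<^sub>F \<tau> in at_right 0. feasible (\<lambda>k. ystar k + \<tau> * v k) \<and> positive (\<lambda>k. ystar k + \<tau> * v k)"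
    using eventually_feasible[OF ystar_feasible conserving_diff[OF ystar_feasible z(1)]] vpos
    by (rule_tac eventually_mono) (use y0 in \<open>force simp: positive_def v_def less_le\<close>)+
  have bot: "filterlim (\<lambda>\<tau>. ?g \<tau> k) at_bot (at_right 0)" if "k \<in> Kbar G" "ystar k = 0" for k
  proof -
    have 1: "filterlim (\<lambda>\<tau>. \<tau> * (v k * c_fact k)) (at_right 0) (at_right 0)"
    proof (rule filterlim_at_withinI)
      have "((\<lambda>\<tau>. \<tau> * (v k * c_fact k)) \<longlongrightarrow> 0 * (v k * c_fact k)) (at_right 0)"
        by (intro tendsto_intros)
      then show "((\<lambda>\<tau>. \<tau> * (v k * c_fact k)) \<longlongrightarrow> 0) (at_right 0)" by simp
      show "\<forall>\<^sub>F \<tau> in at_right 0. \<tau> * (v k * c_fact k) \<in> {0<..} - {0}"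
        using eventually_at_right_less[of "0::real"]
        by eventually_elim (use vpos[OF that] c_fact_pos[of k] in simp)
    qed
    have "filterlim (\<lambda>\<tau>. ln (\<tau> * (v k * c_fact k))) at_bot (at_right 0)"
      by (rule filterlim_compose[OF ln_at_0 1])
    then have "filterlim (\<lambda>\<tau>. ln (\<tau> * (v k * c_fact k)) * v k) at_bot (at_right 0)"
      by (subst mult.commute) (rule filterlim_tendsto_pos_mult_at_bot[OF tendsto_const vpos[OF that]])
    then show ?thesis using that by (simp add: grad_def mult.assoc)
  qed
  have bdd: "\<exists>B. \<forall>\<^sub>F \<tau> in at_right 0. ?g \<tau> k \<le> B" if "k \<in> Kbar G" for k
  proof (cases "ystar k = 0")
    case True
    then show ?thesis using bot[OF that True] by (auto simp: filterlim_at_bot)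
  next
    case False
    with y0[OF that] have "0 < ystar k" by simp
    then have "((\<lambda>\<tau>. ?g \<tau> k) \<longlongrightarrow> ln ((ystar k + 0 * v k) * c_fact k) * v k) (at_right 0)"
      unfolding grad_def using c_fact_pos[of k] by (intro tendsto_intros) auto
    from order_tendstoD(2)[OF this, of "ln ((ystar k + 0 * v k) * c_fact k) * v k + 1"]
    have "\<forall>\<^sub>F \<tau> in at_right 0. ?g \<tau> k \<le> ln ((ystar k + 0 * v k) * c_fact k) * v k + 1"
      by (auto elim: eventually_mono)
    then show ?thesis ..
  qed
  then have "\<forall>k\<in>Kbar G. \<exists>B. \<forall>\<^sub>F \<tau> in at_right 0. ?g \<tau> k \<le> B" by (intro ballI)
  from bchoice[OF this] obtain B where B: "\<forall>k\<in>Kbar G. \<forall>\<^sub>F \<tau> in at_right 0. ?g \<tau> k \<le> B k" ..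
  have "\<forall>\<^sub>F \<tau> in at_right 0. \<forall>k\<in>Kbar G. ?g \<tau> k \<le> B k"
    using B by (intro eventually_ball_finite) auto
  moreover have "\<forall>\<^sub>F \<tau> in at_right 0. ?g \<tau> k0 \<le> - (\<Sum>k\<in>Kbar G - {k0}. B k) - 1"
    using bot[OF k0] by (simp add: filterlim_at_bot)
  moreover note ev eventually_at_right_less[of "0::real"]
  ultimately have "\<forall>\<^sub>F \<tau> in at_right (0::real). False"
  proof eventually_elim
    case (elim \<tau>)
    have "(\<Sum>k\<in>Kbar G. ?g \<tau> k) = ?g \<tau> k0 + (\<Sum>k\<in>Kbar G - {k0}. ?g \<tau> k)"
      using k0 by (simp add: sum.remove)
    also have "(\<Sum>k\<in>Kbar G - {k0}. ?g \<tau> k) \<le> (\<Sum>k\<in>Kbar G - {k0}. B k)"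
      using elim by (intro sum_mono) auto
    finally have "(\<Sum>k\<in>Kbar G. ?g \<tau> k) \<le> -1" using elim by simp
    moreover have "0 \<le> (\<Sum>k\<in>Kbar G. ?g \<tau> k)" using elim by (intro first_order) auto
    ultimately show False by linarith
  qed
  then show False by simp
qed

text \<open>The limit of \<open>first_order\<close> as the step tends to \<open>0\<close>; since \<open>- v\<close> conserves as well, the sum is in
  fact \<open>0\<close>.\<close>

lemma ystar_stationary:
  assumes v: "conserving v" shows "0 \<le> (\<Sum>k\<in>Kbar G. grad ystar k * v k)"
proof (rule tendsto_lowerbound)
  have "\<forall>\<^sub>F \<tau> in at_right 0. feasible (\<lambda>k. ystar k + \<tau> * v k) \<and> positive (\<lambda>k. ystar k + \<tau> * v k)"
    using eventually_feasible[OF ystar_feasible v] ystar_positive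
    by (rule_tac eventually_mono) (force simp: positive_def)+
  then show "\<forall>\<^sub>F \<tau> in at_right 0. 0 \<le> (\<Sum>k\<in>Kbar G. grad (\<lambda>k. ystar k + \<tau> * v k) k * v k)"
    using eventually_at_right_less[of "0::real"] by eventually_elim (auto intro: first_order)
  have "((\<lambda>\<tau>. \<Sum>k\<in>Kbar G. ln ((ystar k + \<tau> * v k) * c_fact k) * v k)
      \<longlongrightarrow> (\<Sum>k\<in>Kbar G. ln ((ystar k + 0 * v k) * c_fact k) * v k)) (at_right 0)"
  proof (intro tendsto_intros)
    fix k assume "k \<in> Kbar G"
    then have "0 < ystar k" using ystar_positive by (simp add: positive_def)
    then show "(ystar k + 0 * v k) * c_fact k \<noteq> 0" using c_fact_pos[of k] by simp
  qed
  then show "((\<lambda>\<tau>. \<Sum>k\<in>Kbar G. grad (\<lambda>k. ystar k + \<tau> * v k) k * v k) \<longlongrightarrow> (\<Sum>k\<in>Kbar G. grad ystar k * v k)) (at_right 0)"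
    by (simp add: grad_def)
qed simp

text \<open>The tangent at \<open>ystar\<close> is nonnegative in every feasible direction, and the entropy lies strictly
  above it.\<close>

lemma ystar_unique:
  assumes y: "feasible y" "entropy y \<le> entropy ystar" and k: "k \<in> Kbar G" shows "y k = ystar k"
proof (rule ccontr)
  assume "y k \<noteq> ystar k"
  then have "entropy ystar + (\<Sum>k\<in>Kbar G. grad ystar k * (y k - ystar k)) < entropy y"
    using y k by (intro entropy_tangent_strict ystar_positive) (auto simp: feasible_def server_feasible_def)
  moreover have "0 \<le> (\<Sum>k\<in>Kbar G. grad ystar k * (y k - ystar k))"
    by (intro ystar_stationary conserving_diff ystar_feasible y)
  ultimately show False using y by linarith
qed

subsection \<open>Dissipation\<close>

text \<open>The sum over the customer types of \<open>\<lambda>\<^sub>i\<close> times the symmetrized Kullback-Leibler divergence between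
  the distributions of arrivals and of departures over the edges; it will be the rate at which the
  entropy falls.\<close>

definition dissip :: "(('a, 'b) config \<Rightarrow> real) \<Rightarrow> real" where
  "dissip y = (\<Sum>e\<in>edges G. (arr y e - dep y e) * (ln (arr y e) - ln (dep y e)))"

lemma positive_fitmass: "positive y \<Longrightarrow> 0 < fitmass y i"
  unfolding fitmass_def using fitting_nonempty[of i]
  by (intro sum_pos) (auto simp: positive_def fitting_Kbar)

lemma arr_pos: "positive y \<Longrightarrow> e \<in> edges G \<Longrightarrow> 0 < arr y e"
  using positive_fitmass[of y "snd e"] lam_pos[of "snd e"]
  by (cases e) (auto simp: arr_def edges_iff positive_def del_in_Kbar)

lemma dep_pos: "positive y \<Longrightarrow> e \<in> edges G \<Longrightarrow> 0 < dep y e"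
  using mu_pos[of "snd e"] by (cases e) (auto simp: dep_def edges_iff positive_def)

lemma dissip_terms_nonneg:
  fixes a b :: real assumes "0 < a" "0 < b" shows "0 \<le> (a - b) * (ln a - ln b)"
  using assms by (cases "a \<le> b") (auto simp: zero_le_mult_iff)

lemma dissip_nonneg: "positive y \<Longrightarrow> 0 \<le> dissip y"
  unfolding dissip_def by (intro sum_nonneg dissip_terms_nonneg arr_pos dep_pos)

lemma dissip_0D:
  assumes "positive y" "dissip y = 0" "e \<in> edges G" shows "arr y e = dep y e"
proof -
  have "(arr y e - dep y e) * (ln (arr y e) - ln (dep y e)) = 0"
    using assms(2,3) unfolding dissip_def
    by (subst (asm) sum_nonneg_eq_0_iff)
       (auto intro!: dissip_terms_nonneg arr_pos dep_pos assms(1))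
  then show ?thesis using arr_pos[OF assms(1,3)] dep_pos[OF assms(1,3)] by auto
qed

lemma c_fact_edge:
  assumes "(k, i) \<in> edges G" shows "c_fact k = real (fst k i) * c_fact (del_cust k i)"
proof -
  have "fst k i = Suc (fst k i - 1)" using assms by (simp add: edges_iff)
  then have "fact (fst k i) = real (fst k i) * fact (fst k i - 1)"
    by (metis fact_Suc)
  moreover have "(\<Prod>j\<in>UNIV - {i}. fact (fst (del_cust k i) j)) = (\<Prod>j\<in>UNIV - {i}. fact (fst k j) :: real)"
    by (rule prod.cong) (auto simp: fst_del_cust)
  ultimately show ?thesis unfolding c_fact_def
    by (simp add: prod.remove[of UNIV i] fst_del_cust)
qed

text \<open>The factor \<open>k\<^sub>i\<close> by which \<open>c_fact\<close> grows along the edge is the one in the departure rate; so the gradient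
  grows by the logarithm of the ratio of the departure and arrival rates, up to a term that depends only on
  the customer type.\<close>

lemma grad_edge:
  assumes "positive y" "(k, i) \<in> edges G"
  shows "grad y k - grad y (del_cust k i)
    = ln (dep y (k, i)) - ln (arr y (k, i)) + ln (lam G i / (mu G i * fitmass y i))"
proof -
  have p: "0 < y k" "0 < y (del_cust k i)" "0 < fitmass y i" "0 < real (fst k i)"
    using assms positive_fitmass[of y i] by (auto simp: positive_def edges_iff del_in_Kbar)
  then show ?thesis
    using lam_pos[of i] mu_pos[of i] c_fact_pos[of "del_cust k i"]
    unfolding grad_def c_fact_edge[OF assms(2)] dep_def arr_def
    by (simp add: ln_mult ln_div)
qed

lemma sum_net_0:
  assumes "feasible y" "fitmass y i > 0"
  shows "(\<Sum>k | (k, i) \<in> edges G. arr y (k, i) - dep y (k, i)) = 0"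
proof -
  have "(\<Sum>k\<in>Kbar G. real (fst k i) * y k) = rho G i" using assms(1) by (simp add: feasible_def)
  then show ?thesis unfolding sum_subtractf sum_arr[OF assms(2)] sum_dep
    using mu_pos[of i] by (simp add: rho_def)
qed

text \<open>The chain rule turns the derivative of the entropy along the drift into a sum over edges. The part of
  the gradient difference that depends only on the customer type contributes nothing, because at a feasible
  point the arrivals and departures of each type balance.\<close>

lemma grad_drift:
  assumes "feasible y" "positive y"
  shows "(\<Sum>k\<in>Kbar G. grad y k * drift y k) = - dissip y"
proof -
  let ?w = "\<lambda>e. arr y e - dep y e" and ?c = "\<lambda>i. ln (lam G i / (mu G i * fitmass y i))"
  have "(\<Sum>k\<in>Kbar G. grad y k * drift y k)
      = (\<Sum>e\<in>edges G. ?w e * (grad y (fst e) - grad y (del_cust (fst e) (snd e))))"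
    unfolding drift_def by (rule sum_netflow)
  also have "\<dots> = (\<Sum>e\<in>edges G. - (?w e * (ln (arr y e) - ln (dep y e))) + ?w e * ?c (snd e))"
  proof (rule sum.cong)
    fix e assume "e \<in> edges G"
    then have "grad y (fst e) - grad y (del_cust (fst e) (snd e)) = - (ln (arr y e) - ln (dep y e)) + ?c (snd e)"
      using grad_edge[OF assms(2), of "fst e" "snd e"] by simp
    then show "?w e * (grad y (fst e) - grad y (del_cust (fst e) (snd e)))
        = - (?w e * (ln (arr y e) - ln (dep y e))) + ?w e * ?c (snd e)"
      by (simp only:) (simp add: algebra_simps)
  qed simp
  also have "\<dots> = - dissip y + (\<Sum>e\<in>edges G. ?w e * ?c (snd e))"
    by (simp add: sum.distrib dissip_def sum_negf del: uminus_add_conv_diff)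
  also have "(\<Sum>e\<in>edges G. ?w e * ?c (snd e)) = (\<Sum>i\<in>UNIV. (\<Sum>k | (k, i) \<in> edges G. ?w (k, i)) * ?c i)"
    unfolding sum_edges by (simp add: sum_distrib_right)
  also have "\<dots> = 0" using sum_net_0[OF assms(1) positive_fitmass[OF assms(2)]] by simp
  finally show ?thesis by simp
qed

text \<open>Balance along every edge makes the gradient affine in \<open>k\<close>, hence orthogonal to every conserving
  direction; by convexity such a point minimizes the entropy.\<close>

lemma balanced_eq_ystar:
  assumes y: "feasible y" "positive y" and bal: "\<And>e. e \<in> edges G \<Longrightarrow> arr y e = dep y e"
    and k: "k \<in> Kbar G"
  shows "y k = ystar k"
proof (rule ccontr)
  assume ne: "y k \<noteq> ystar k"
  define c where "c = (\<lambda>i. ln (lam G i / (mu G i * fitmass y i)))"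
  have g: "grad y k = grad y (zero_cfg (snd k)) + (\<Sum>i\<in>UNIV. real (fst k i) * c i)" if "k \<in> Kbar G" for k
    using that
  proof (induction rule: config_induct)
    case (zero s)
    show ?case by simp
  next
    case (edge k i)
    have f: "real (fst k j) = real (fst (del_cust k i) j) + (if j = i then 1 else 0)" for j
      using edge(1) by (auto simp: fst_del_cust edges_iff)
    have "(\<Sum>j\<in>UNIV. real (fst k j) * c j) = (\<Sum>j\<in>UNIV. real (fst (del_cust k i) j) * c j) + c i"
      by (subst f) (simp add: sum.distrib distrib_right if_distrib[of "\<lambda>x. x * _"] cong: if_cong)
    moreover have "grad y k - grad y (del_cust k i) = c i"
      using grad_edge[OF y(2) edge(1)] bal[OF edge(1)] by (simp add: c_def)
    ultimately show ?case using edge(2) by simp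
  qed
  let ?v = "\<lambda>k. ystar k - y k"
  have v: "conserving ?v" by (rule conserving_diff[OF y(1) ystar_feasible])
  have "(\<Sum>k\<in>Kbar G. grad y (zero_cfg (snd k)) * ?v k) = (\<Sum>s\<in>UNIV. \<Sum>k\<in>Kbar_of G s. grad y (zero_cfg (snd k)) * ?v k)"
    unfolding Kbar_def by (rule sum.UNION_disjoint) (auto simp: Kbar_of_iff)
  also have "\<dots> = (\<Sum>s\<in>UNIV. grad y (zero_cfg s) * (\<Sum>k\<in>Kbar_of G s. ?v k))"
    unfolding sum_distrib_left by (intro sum.cong) (auto simp: Kbar_of_iff)
  also have "\<dots> = 0" using v by (simp add: conserving_def)
  finally have 1: "(\<Sum>k\<in>Kbar G. grad y (zero_cfg (snd k)) * ?v k) = 0" .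
  have "(\<Sum>k\<in>Kbar G. (\<Sum>i\<in>UNIV. real (fst k i) * c i) * ?v k) = (\<Sum>i\<in>UNIV. c i * (\<Sum>k\<in>Kbar G. real (fst k i) * ?v k))"
    unfolding sum_distrib_left sum_distrib_right by (subst sum.swap) (simp add: algebra_simps)
  also have "\<dots> = 0" using v by (simp add: conserving_def)
  finally have 2: "(\<Sum>k\<in>Kbar G. (\<Sum>i\<in>UNIV. real (fst k i) * c i) * ?v k) = 0" .
  have "(\<Sum>k\<in>Kbar G. grad y k * ?v k)
      = (\<Sum>k\<in>Kbar G. grad y (zero_cfg (snd k)) * ?v k + (\<Sum>i\<in>UNIV. real (fst k i) * c i) * ?v k)"
    using g by (intro sum.cong) (auto simp: distrib_right)
  then have "(\<Sum>k\<in>Kbar G. grad y k * ?v k) = 0" by (simp add: sum.distrib 1 2)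
  moreover have "entropy y + (\<Sum>k\<in>Kbar G. grad y k * ?v k) < entropy ystar"
    using ystar_feasible ne k
    by (intro entropy_tangent_strict[where ?k0.0 = k] y(2)) (auto simp: feasible_def server_feasible_def)
  ultimately show False using ystar_min[OF y(1)] by simp
qed

lemma conserving_drift: "feasible y \<Longrightarrow> positive y \<Longrightarrow> conserving (drift y)"
  unfolding conserving_def drift_def
  by (simp add: sum_netflow_type sum_netflow_customers sum_net_0 positive_fitmass)

text \<open>The drift at \<open>ystar\<close> is itself a conserving direction, and the entropy falls along it at rate
  \<open>dissip ystar\<close>; minimality forces this rate to vanish.\<close>

lemma ystar_balanced: "e \<in> edges G \<Longrightarrow> arr ystar e = dep ystar e"
proof (rule dissip_0D[OF ystar_positive])
  have "0 \<le> (\<Sum>k\<in>Kbar G. grad ystar k * drift ystar k)"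
    by (intro ystar_stationary conserving_drift ystar_feasible ystar_positive)
  then show "dissip ystar = 0"
    using grad_drift[OF ystar_feasible ystar_positive] dissip_nonneg[OF ystar_positive] by linarith
qed

end

section \<open>Fluid solutions\<close>

lemma compact_positive_lower_bound:
  fixes f :: "'a::topological_space \<Rightarrow> real"
  assumes "compact S" "continuous_on S f" "\<And>z. z \<in> S \<Longrightarrow> 0 < f z"
  shows "\<exists>c>0. \<forall>z\<in>S. c \<le> f z"
proof (cases "S = {}")
  case False
  then obtain z where "z \<in> S" "\<And>w. w \<in> S \<Longrightarrow> f z \<le> f w"
    using continuous_attains_inf[OF assms(1) False assms(2)] by blast
  then show ?thesis using assms(3) by blast
qed (auto intro: exI[of _ 1])

lemma derivative_bound_decrease:
  fixes f :: "real \<Rightarrow> real"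
  assumes "0 \<le> b" "\<And>t. t \<in> {0..b} \<Longrightarrow> (f has_real_derivative f' t) (at t within {0..b})"
    and "\<And>t. t \<in> {0..b} \<Longrightarrow> f' t \<le> - c"
  shows "f b \<le> f 0 - c * b"
proof (cases "b = 0")
  case False
  with assms(1) have b: "0 < b" by simp
  have "\<exists>x\<in>{0<..<b}. f b - f 0 = f' x * (b - 0)"
    using assms(2) by (intro mvt_simple[OF b]) (auto simp: has_field_derivative_def)
  then obtain x where "x \<in> {0<..<b}" "f b - f 0 = f' x * b" by auto
  moreover from this have "f' x * b \<le> - c * b" using assms(3)[of x] b by (intro mult_right_mono) auto
  ultimately show ?thesis by simp
qed simp

context grand_model
begin

text \<open>The fluid equations need hold only as long as there is room for every customer type, because the
  splitting of the arrivals over the configurations is not determined when \<open>fitmass\<close> vanishes.\<close>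

definition fluid_solution :: "(real \<Rightarrow> ('i, 's) config \<Rightarrow> real) \<Rightarrow> bool" where
  "fluid_solution y \<longleftrightarrow>
     (\<forall>k\<in>Kbar G. continuous_on {0..} (\<lambda>t. y t k)) \<and>
     (\<forall>t\<ge>0. server_feasible (y t)) \<and>
     (\<forall>t\<ge>0. (\<forall>u\<in>{0..t}. \<forall>i. 0 < fitmass (y u) i) \<longrightarrow>
        (\<forall>k\<in>Kbar G. y t k = y 0 k + netflow (\<lambda>e. integral {0..t} (\<lambda>u. arr (y u) e - dep (y u) e)) k))"

lemma fluid_solution_continuous: "fluid_solution y \<Longrightarrow> k \<in> Kbar G \<Longrightarrow> continuous_on {0..} (\<lambda>t. y t k)"
  and fluid_solution_servers: "fluid_solution y \<Longrightarrow> 0 \<le> t \<Longrightarrow> server_feasible (y t)"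
  by (simp_all add: fluid_solution_def)

lemma fluid_solution_balance:
  assumes "fluid_solution y" "0 \<le> t" "\<And>u i. u \<in> {0..t} \<Longrightarrow> 0 < fitmass (y u) i" "k \<in> Kbar G"
  shows "y t k = y 0 k + netflow (\<lambda>e. integral {0..t} (\<lambda>u. arr (y u) e - dep (y u) e)) k"
  using assms unfolding fluid_solution_def by blast

lemma continuous_on_fitmass:
  fixes y :: "'x::topological_space \<Rightarrow> ('i, 's) config \<Rightarrow> real"
  assumes "\<And>k. k \<in> Kbar G \<Longrightarrow> continuous_on A (\<lambda>t. y t k)"
  shows "continuous_on A (\<lambda>t. fitmass (y t) i)"
  unfolding fitmass_def by (intro continuous_on_sum assms fitting_Kbar)

lemma continuous_on_arr:
  fixes y :: "'x::topological_space \<Rightarrow> ('i, 's) config \<Rightarrow> real"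
  assumes "\<And>k. k \<in> Kbar G \<Longrightarrow> continuous_on A (\<lambda>t. y t k)" "\<And>t. t \<in> A \<Longrightarrow> 0 < fitmass (y t) (snd e)"
    and "e \<in> edges G"
  shows "continuous_on A (\<lambda>t. arr (y t) e)"
  using assms(2,3) unfolding arr_def
  by (cases e) (intro continuous_intros continuous_on_fitmass assms(1),
      auto simp: edges_iff del_in_Kbar less_imp_neq[symmetric])

lemma continuous_on_dep:
  fixes y :: "'x::topological_space \<Rightarrow> ('i, 's) config \<Rightarrow> real"
  assumes "\<And>k. k \<in> Kbar G \<Longrightarrow> continuous_on A (\<lambda>t. y t k)" "e \<in> edges G"
  shows "continuous_on A (\<lambda>t. dep (y t) e)"
  unfolding dep_def using assms(2) by (intro continuous_intros assms(1)) (cases e, auto simp: edges_iff)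

end

context slack_model
begin

context
  fixes y :: "real \<Rightarrow> ('a, 'b) config \<Rightarrow> real" and b :: real
  assumes y: "fluid_solution y" and b: "0 \<le> b" and room: "\<And>u i. u \<in> {0..b} \<Longrightarrow> 0 < fitmass (y u) i"
begin

lemma solution_derivative:
  assumes k: "k \<in> Kbar G" and t: "t \<in> {0..b}"
  shows "((\<lambda>t. y t k) has_real_derivative drift (y t) k) (at t within {0..b})"
proof -
  have cont: "continuous_on {0..b} (\<lambda>t. y t k)" if "k \<in> Kbar G" for k
    using fluid_solution_continuous[OF y that] by (rule continuous_on_subset) auto
  let ?w = "\<lambda>e t. arr (y t) e - dep (y t) e"
  have I: "((\<lambda>t. integral {0..t} (?w e)) has_real_derivative ?w e t) (at t within {0..b})" if "e \<in> edges G" for e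
    unfolding has_real_derivative_iff_has_vector_derivative
    by (intro integral_has_vector_derivative t continuous_intros continuous_on_arr continuous_on_dep cont room that)
  have "((\<lambda>t. y 0 k + netflow (\<lambda>e. integral {0..t} (?w e)) k) has_real_derivative 0 + drift (y t) k) (at t within {0..b})"
    unfolding drift_def netflow_def
    by (intro DERIV_add DERIV_const DERIV_diff DERIV_sum I) auto
  then have "((\<lambda>t. y 0 k + netflow (\<lambda>e. integral {0..t} (?w e)) k) has_real_derivative drift (y t) k) (at t within {0..b})"
    by simp
  then show ?thesis
  proof (rule has_field_derivative_transform_within[OF _ zero_less_one t])
    fix t' assume "t' \<in> {0..b}"
    then show "y 0 k + netflow (\<lambda>e. integral {0..t'} (?w e)) k = y t' k"
      by (intro fluid_solution_balance[symmetric] y k room) auto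
  qed
qed

lemma customers_derivative:
  assumes t: "t \<in> {0..b}"
  shows "((\<lambda>t. \<Sum>k\<in>Kbar G. real (fst k i) * y t k) has_real_derivative
      lam G i - mu G i * (\<Sum>k\<in>Kbar G. real (fst k i) * y t k)) (at t within {0..b})"
proof -
  have "(\<Sum>k\<in>Kbar G. real (fst k i) * drift (y t) k) = lam G i - mu G i * (\<Sum>k\<in>Kbar G. real (fst k i) * y t k)"
    unfolding drift_def sum_netflow_customers sum_subtractf sum_arr[OF room[OF t]] sum_dep ..
  moreover have "((\<lambda>t. \<Sum>k\<in>Kbar G. real (fst k i) * y t k) has_real_derivative
      (\<Sum>k\<in>Kbar G. real (fst k i) * drift (y t) k)) (at t within {0..b})"
    by (intro DERIV_sum DERIV_cmult solution_derivative t)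
  ultimately show ?thesis by simp
qed

text \<open>The number of type-\<open>i\<close> customers solves \<open>z' = \<lambda>\<^sub>i - \<mu>\<^sub>i z\<close>, and \<open>\<rho>\<^sub>i\<close> is the rest point.\<close>

lemma solution_feasible:
  assumes y0: "feasible (y 0)" and t: "t \<in> {0..b}" shows "feasible (y t)"
proof -
  have "(\<Sum>k\<in>Kbar G. real (fst k i) * y t k) = rho G i" for i
  proof -
    define z where "z = (\<lambda>t. \<Sum>k\<in>Kbar G. real (fst k i) * y t k)"
    have "((\<lambda>t. (z t - rho G i) * exp (mu G i * t)) has_vector_derivative 0) (at u within {0..b})"
      if "u \<in> {0..b}" for u
    proof -
      have "(z has_real_derivative lam G i - mu G i * z u) (at u within {0..b})"
        using customers_derivative[OF that] by (simp add: z_def)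
      then have "((\<lambda>t. (z t - rho G i) * exp (mu G i * t)) has_real_derivative
         (lam G i - mu G i * z u) * exp (mu G i * u) + (exp (mu G i * u) * mu G i) * (z u - rho G i)) (at u within {0..b})"
        by (auto intro!: derivative_eq_intros)
      moreover have "(lam G i - mu G i * z u) * exp (mu G i * u) + (exp (mu G i * u) * mu G i) * (z u - rho G i) = 0"
        using mu_pos[of i] by (simp add: rho_def algebra_simps)
      ultimately show ?thesis by (simp add: has_real_derivative_iff_has_vector_derivative)
    qed
    then obtain c where c: "\<And>u. u \<in> {0..b} \<Longrightarrow> (z u - rho G i) * exp (mu G i * u) = c"
      by (rule has_vector_derivative_zero_constant[rotated]) auto
    have "z 0 = rho G i" using y0 by (simp add: z_def feasible_def)
    then have "c = 0" using c[of 0] b by simp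
    then show ?thesis using c[OF t] by (simp add: z_def)
  qed
  then show ?thesis using fluid_solution_servers[OF y] t by (auto simp: feasible_def)
qed

lemma entropy_derivative:
  assumes y0: "feasible (y 0)" and t: "t \<in> {0..b}" and pos: "positive (y t)"
  shows "((\<lambda>t. entropy (y t)) has_real_derivative - dissip (y t)) (at t within {0..b})"
proof -
  have "((\<lambda>t. ent (c_fact k) (y t k)) has_real_derivative grad (y t) k * drift (y t) k) (at t within {0..b})"
    if "k \<in> Kbar G" for k
    unfolding grad_def using pos that
    by (intro DERIV_chain2[OF DERIV_ent solution_derivative] c_fact_pos t) (auto simp: positive_def)
  then have "((\<lambda>t. entropy (y t)) has_real_derivative (\<Sum>k\<in>Kbar G. grad (y t) k * drift (y t) k)) (at t within {0..b})"
    unfolding entropy_def by (intro DERIV_sum)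
  then show ?thesis using grad_drift[OF solution_feasible[OF y0 t] pos] by simp
qed

lemma entropy_decrease:
  assumes "feasible (y 0)" "\<And>t. t \<in> {0..b} \<Longrightarrow> positive (y t)" "\<And>t. t \<in> {0..b} \<Longrightarrow> c \<le> dissip (y t)"
  shows "entropy (y b) \<le> entropy (y 0) - c * b"
  using assms entropy_derivative[OF assms(1)] by (intro derivative_bound_decrease[OF b]) auto

end

subsection \<open>Local stability\<close>

text \<open>The distance \<open>distK\<close> to the optimal point, on barred vectors.\<close>

definition gap :: "(('a, 'b) config \<Rightarrow> real) \<Rightarrow> real" where
  "gap y = L2_set (\<lambda>k. y k - ystar k) (K G)"

lemma gap_cong: "(\<And>k. k \<in> Kbar G \<Longrightarrow> y k = z k) \<Longrightarrow> gap y = gap z"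
  unfolding gap_def by (rule L2_set_cong) (auto simp: K_iff)

lemma gap_ystar: "(\<And>k. k \<in> Kbar G \<Longrightarrow> y k = ystar k) \<Longrightarrow> gap y = 0"
  unfolding gap_def by (simp add: L2_set_eq_0_iff K_iff)

lemma gap_coord: "k \<in> K G \<Longrightarrow> \<bar>y k - ystar k\<bar> \<le> gap y"
  unfolding gap_def using member_le_L2_set[of "K G" k "\<lambda>k. \<bar>y k - ystar k\<bar>"] by (simp add: L2_set_def)

lemma gap_nonneg: "0 \<le> gap y"
  by (simp add: gap_def L2_set_nonneg)

lemma gap_eq_0D:
  assumes "gap y = 0" "server_feasible y" "k \<in> Kbar G" shows "y k = ystar k"
proof -
  have K: "y k = ystar k" if "k \<in> K G" for k
    using gap_coord[OF that, of y] assms(1) by simp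
  have "(\<Sum>k'\<in>K_of G (snd k). y k') = (\<Sum>k'\<in>K_of G (snd k). ystar k')"
    by (rule sum.cong) (simp_all add: K K_of_iff)
  then have "bar G y k = bar G ystar k"
    using assms(3) K[of k] unfolding bar_def by (auto simp: K_iff)
  then show ?thesis
    using bar_eq_self[OF _ assms(3), of y] bar_eq_self[OF _ assms(3), of ystar] assms(2) ystar_feasible
    by (simp add: feasible_def server_feasible_def)
qed

lemma continuous_on_gap:
  fixes y :: "'x::topological_space \<Rightarrow> ('a, 'b) config \<Rightarrow> real"
  assumes "\<And>k. k \<in> Kbar G \<Longrightarrow> continuous_on A (\<lambda>t. y t k)"
  shows "continuous_on A (\<lambda>t. gap (y t))"
  unfolding gap_def L2_set_def by (intro continuous_intros assms) (simp add: K_iff)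

text \<open>Idle servers make up what is left of their type, so their number is controlled by the other
  coordinates.\<close>

lemma gap_all:
  assumes "server_feasible y" "k \<in> Kbar G"
  shows "\<bar>y k - ystar k\<bar> \<le> real (card (K G) + 1) * gap y"
proof (cases "k \<in> K G")
  case True
  have "1 * gap y \<le> real (card (K G) + 1) * gap y" by (intro mult_right_mono gap_nonneg) simp
  then show ?thesis using gap_coord[OF True, of y] by linarith
next
  case False
  then have k: "k = zero_cfg (snd k)" using assms(2) Kbar_cases by blast
  have "bar G y k - bar G ystar k = - (\<Sum>k'\<in>K_of G (snd k). y k' - ystar k')"
    unfolding bar_def using k by (simp add: sum_subtractf)
  then have "\<bar>y k - ystar k\<bar> = \<bar>\<Sum>k'\<in>K_of G (snd k). y k' - ystar k'\<bar>"
    using bar_eq_self[OF _ assms(2), of y] bar_eq_self[OF _ assms(2), of ystar] assms(1) ystar_feasible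
    by (simp add: feasible_def server_feasible_def)
  also have "\<dots> \<le> (\<Sum>k'\<in>K_of G (snd k). \<bar>y k' - ystar k'\<bar>)" by (rule sum_abs)
  also have "\<dots> \<le> (\<Sum>k'\<in>K_of G (snd k). gap y)"
    by (intro sum_mono gap_coord) (simp add: K_of_iff)
  also have "\<dots> \<le> (\<Sum>k'\<in>K G. gap y)"
    by (intro sum_mono2 gap_nonneg) (auto simp: K_of_iff)
  also have "\<dots> \<le> real (card (K G) + 1) * gap y"
    using gap_nonneg[of y] by (simp add: algebra_simps)
  finally show ?thesis .
qed

lemma positive_near_ystar: "\<exists>\<epsilon>>0. \<forall>y. server_feasible y \<and> gap y \<le> \<epsilon> \<longrightarrow> positive y"
proof -
  define m where "m = Min (ystar ` Kbar G)"
  have ne: "Kbar G \<noteq> {}" using zero_in_Kbar by auto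
  have m: "0 < m" "\<And>k. k \<in> Kbar G \<Longrightarrow> m \<le> ystar k"
    using ystar_positive ne unfolding m_def by (auto simp: positive_def)
  let ?n = "real (card (K G) + 1)" let ?\<epsilon> = "m / (2 * ?n)"
  have "positive y" if y: "server_feasible y" "gap y \<le> ?\<epsilon>" for y
    unfolding positive_def
  proof
    fix k assume k: "k \<in> Kbar G"
    have "\<bar>y k - ystar k\<bar> \<le> ?n * gap y" by (rule gap_all[OF y(1) k])
    also have "\<dots> \<le> ?n * ?\<epsilon>" by (intro mult_left_mono y(2)) simp
    also have "\<dots> = m / 2" by (simp add: field_simps)
    finally show "0 < y k" using m(1) m(2)[OF k] by linarith
  qed
  moreover have "0 < ?\<epsilon>" using m by simp
  ultimately show ?thesis by blast
qed

lemma feasible_clip: "feasible y \<Longrightarrow> clip y \<in> feasible_set \<and> entropy (clip y) = entropy y \<and> gap (clip y) = gap y"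
  by (auto intro!: clip_in entropy_cong gap_cong simp: clip_def)

lemma compact_entropy_ge: "compact {y\<in>feasible_set. b \<le> entropy y}"
proof -
  have "closed (feasible_set \<inter> entropy -` {b..})"
    using compact_imp_closed[OF compact_feasible_set] continuous_on_entropy
    by (intro continuous_closed_preimage) auto
  then show ?thesis
    using compact_Int_closed[OF compact_feasible_set, of "feasible_set \<inter> entropy -` {b..}"]
    by (simp add: Int_def vimage_def)
qed

text \<open>The three facts on which stability rests compare, by compactness, the entropy excess, the distance to
  the optimal point and the dissipation.\<close>

lemma gap_entropy_bound:
  assumes "0 < \<delta>" shows "\<exists>\<eta>>0. \<forall>y. feasible y \<and> \<delta> \<le> gap y \<longrightarrow> entropy ystar + \<eta> \<le> entropy y"
proof -
  let ?S = "feasible_set \<inter> {y. \<delta> \<le> gap y}"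
  have "\<exists>\<eta>>0. \<forall>y\<in>?S. \<eta> \<le> entropy y - entropy ystar"
  proof (rule compact_positive_lower_bound)
    show "compact ?S"
      by (intro compact_Int_closed compact_feasible_set closed_Collect_le continuous_on_const
          continuous_on_gap continuous_intros)
    show "continuous_on ?S (\<lambda>y. entropy y - entropy ystar)"
      by (intro continuous_intros continuous_on_subset[OF continuous_on_entropy]) auto
    fix y assume "y \<in> ?S"
    then have y: "feasible y" "gap y \<noteq> 0" using assms by (auto simp: feasible_set_def)
    then show "0 < entropy y - entropy ystar"
      using ystar_unique[OF y(1)] gap_ystar[of y] by force
  qed
  then obtain \<eta> where "\<eta> > 0" "\<And>y. y \<in> ?S \<Longrightarrow> \<eta> \<le> entropy y - entropy ystar" by blast
  moreover have "clip y \<in> ?S" "entropy (clip y) = entropy y" if "feasible y" "\<delta> \<le> gap y" for y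
    using feasible_clip[OF that(1)] that by auto
  ultimately show ?thesis by (intro exI[of _ \<eta>]) force
qed

lemma entropy_gap_bound:
  assumes "0 < \<eta>" shows "\<exists>\<epsilon>>0. \<forall>y. feasible y \<and> gap y < \<epsilon> \<longrightarrow> entropy y < entropy ystar + \<eta>"
proof -
  let ?S = "{y\<in>feasible_set. entropy ystar + \<eta> \<le> entropy y}"
  have "\<exists>\<epsilon>>0. \<forall>y\<in>?S. \<epsilon> \<le> gap y"
  proof (rule compact_positive_lower_bound)
    show "compact ?S" by (rule compact_entropy_ge)
    show "continuous_on ?S gap"
      using continuous_on_gap[of ?S "\<lambda>y. y"] by (simp add: continuous_on_coord)
    fix y assume y: "y \<in> ?S"
    show "0 < gap y"
    proof (rule ccontr)
      assume "\<not> 0 < gap y"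
      then have "gap y = 0" using gap_nonneg[of y] by simp
      then have "entropy y = entropy ystar"
        using gap_eq_0D[of y] y by (intro entropy_cong) (auto simp: feasible_set_def feasible_def)
      then show False using y assms by simp
    qed
  qed
  then obtain \<epsilon> where e: "\<epsilon> > 0" "\<And>y. y \<in> ?S \<Longrightarrow> \<epsilon> \<le> gap y" by blast
  have "entropy y < entropy ystar + \<eta>" if "feasible y" "gap y < \<epsilon>" for y
    using feasible_clip[OF that(1)] that(2) e(2)[of "clip y"] by (auto simp: not_le[symmetric])
  then show ?thesis using e(1) by blast
qed

lemma dissip_lower_bound:
  assumes "0 < \<eta>" and pos: "\<And>y. server_feasible y \<Longrightarrow> gap y \<le> \<epsilon> \<Longrightarrow> positive y"
  shows "\<exists>\<phi>>0. \<forall>y. feasible y \<and> gap y \<le> \<epsilon> \<and> entropy ystar + \<eta> \<le> entropy y \<longrightarrow> \<phi> \<le> dissip y"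
proof -
  let ?S = "{y\<in>feasible_set. entropy ystar + \<eta> \<le> entropy y} \<inter> {y. gap y \<le> \<epsilon>}"
  have P: "positive y" if "y \<in> ?S" for y
    using that by (auto intro!: pos simp: feasible_set_def feasible_def)
  have "\<exists>\<phi>>0. \<forall>y\<in>?S. \<phi> \<le> dissip y"
  proof (rule compact_positive_lower_bound)
    show "compact ?S"
      by (intro compact_Int_closed compact_entropy_ge closed_Collect_le continuous_on_const continuous_on_gap continuous_intros)
    have "continuous_on ?S (\<lambda>y. arr y e)" "continuous_on ?S (\<lambda>y. dep y e)" if "e \<in> edges G" for e
      using P that by (auto intro!: continuous_on_arr[where y="\<lambda>y. y"] continuous_on_dep[where y="\<lambda>y. y"]
          continuous_on_coord positive_fitmass)
    then show "continuous_on ?S dissip"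
      unfolding dissip_def using arr_pos[OF P] dep_pos[OF P]
      by (intro continuous_intros) (auto simp: less_imp_neq[symmetric])
    fix y assume y: "y \<in> ?S"
    show "0 < dissip y"
    proof (rule ccontr)
      assume "\<not> 0 < dissip y"
      then have "dissip y = 0" using dissip_nonneg[OF P[OF y]] by simp
      then have "y k = ystar k" if "k \<in> Kbar G" for k
        using y that by (intro balanced_eq_ystar P dissip_0D) (auto simp: feasible_set_def)
      then have "entropy y = entropy ystar" by (rule entropy_cong)
      then show False using y assms(1) by simp
    qed
  qed
  then obtain \<phi> where e: "\<phi> > 0" "\<And>y. y \<in> ?S \<Longrightarrow> \<phi> \<le> dissip y" by blast
  have "\<phi> \<le> dissip y" if "feasible y" "gap y \<le> \<epsilon>" "entropy ystar + \<eta> \<le> entropy y" for y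
  proof -
    have "fitmass (clip y) i = fitmass y i" for i
      unfolding fitmass_def by (rule sum.cong) (auto simp: clip_def fitting_Kbar)
    then have "arr (clip y) e = arr y e" "dep (clip y) e = dep y e" if "e \<in> edges G" for e
      using that by (cases e; auto simp: arr_def dep_def clip_def edges_iff del_in_Kbar)+
    then have "dissip (clip y) = dissip y" unfolding dissip_def by (auto intro: sum.cong)
    then show ?thesis using feasible_clip[OF that(1)] that e(2)[of "clip y"] by auto
  qed
  then show ?thesis using e(1) by blast
qed

text \<open>The entropy cannot rise, so a solution that starts in a low sublevel set cannot cross the sphere
  \<open>gap = \<epsilon>\<^sub>0\<close>, where the entropy is higher. As long as it stays outside a \<open>\<delta>\<close>-ball the entropy falls at
  least at a rate \<open>\<phi>\<close> that does not depend on the solution, which bounds the time spent there.\<close>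

theorem fluid_stability:
  "\<exists>\<epsilon>>0. \<forall>\<delta>>0. \<exists>T\<ge>0. \<forall>y. fluid_solution y \<and> feasible (y 0) \<and> gap (y 0) \<le> \<epsilon> \<longrightarrow> (\<forall>t\<ge>T. gap (y t) < \<delta>)"
proof -
  obtain \<epsilon>0 where e0: "\<epsilon>0 > 0" and pos: "\<And>y. server_feasible y \<Longrightarrow> gap y \<le> \<epsilon>0 \<Longrightarrow> positive y"
    using positive_near_ystar by blast
  obtain \<eta> where eta: "\<eta> > 0" "\<And>y. feasible y \<Longrightarrow> \<epsilon>0 \<le> gap y \<Longrightarrow> entropy ystar + \<eta> \<le> entropy y"
    using gap_entropy_bound[OF e0] by blast
  obtain \<epsilon>1 where e1: "\<epsilon>1 > 0" "\<And>y. feasible y \<Longrightarrow> gap y < \<epsilon>1 \<Longrightarrow> entropy y < entropy ystar + \<eta>"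
    using entropy_gap_bound[OF eta(1)] by blast
  define \<epsilon> where "\<epsilon> = min \<epsilon>0 \<epsilon>1 / 2"
  have eps: "0 < \<epsilon>" "\<epsilon> < \<epsilon>0" "\<epsilon> < \<epsilon>1" using e0 e1(1) by (auto simp: \<epsilon>_def)
  have main: "gap (y t) < \<epsilon>0" if y: "fluid_solution y" "feasible (y 0)" "gap (y 0) \<le> \<epsilon>" and t: "0 \<le> t" for y t
  proof (rule ccontr)
    assume far: "\<not> gap (y t) < \<epsilon>0"
    let ?A = "{u\<in>{0..t}. \<epsilon>0 \<le> gap (y u)}"
    have cont: "continuous_on {0..t} (\<lambda>u. gap (y u))" for t
      by (rule continuous_on_gap, rule continuous_on_subset[OF fluid_solution_continuous[OF y(1)]]) auto
    have "closed ({0..t} \<inter> (\<lambda>u. gap (y u)) -` {\<epsilon>0..})"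
      by (intro continuous_closed_preimage cont) auto
    then have cl: "closed ?A" by (simp add: Int_def vimage_def conj_commute)
    have ne: "?A \<noteq> {}" and bd: "bdd_below ?A" using far t by (auto intro!: bdd_belowI[of _ 0])
    define t1 where "t1 = Inf ?A"
    have t1: "t1 \<in> ?A" unfolding t1_def using closed_contains_Inf[OF ne bd cl] .
    have before: "gap (y u) < \<epsilon>0" if "u \<in> {0..t}" "u < t1" for u
      using cInf_lower[OF _ bd, of u] that unfolding t1_def by force
    have "\<exists>u\<ge>0. u \<le> t1 \<and> gap (y u) = \<epsilon>0"
      by (rule IVT') (use t1 y(3) eps cont in auto)
    then obtain u where "0 \<le> u" "u \<le> t1" "gap (y u) = \<epsilon>0" by blast
    then have "gap (y t1) = \<epsilon>0" using before[of u] t1 by (cases "u = t1") auto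
    then have near: "gap (y u) \<le> \<epsilon>0" if "u \<in> {0..t1}" for u
      using before[of u] that t1 by (cases "u = t1") force+
    have P: "positive (y u)" if "u \<in> {0..t1}" for u
      using fluid_solution_servers[OF y(1)] near[OF that] that by (intro pos) auto
    have F: "feasible (y t1)"
      using solution_feasible[OF y(1), of t1 t1] y(2) t1 P positive_fitmass by auto
    have "entropy (y t1) \<le> entropy (y 0) - 0 * t1"
      using y t1 P positive_fitmass dissip_nonneg by (intro entropy_decrease) auto
    moreover have "entropy (y 0) < entropy ystar + \<eta>" using e1(2) y eps by auto
    ultimately show False using eta(2)[OF F] t1 by auto
  qed
  have "\<exists>T\<ge>0. \<forall>y. fluid_solution y \<and> feasible (y 0) \<and> gap (y 0) \<le> \<epsilon> \<longrightarrow> (\<forall>t\<ge>T. gap (y t) < \<delta>)"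
    if delta: "\<delta> > 0" for \<delta>
  proof -
    obtain \<eta>' where eta': "\<eta>' > 0" "\<And>y. feasible y \<Longrightarrow> \<delta> \<le> gap y \<Longrightarrow> entropy ystar + \<eta>' \<le> entropy y"
      using gap_entropy_bound[OF delta] by blast
    obtain \<phi> where phi: "\<phi> > 0" "\<And>y. feasible y \<Longrightarrow> gap y \<le> \<epsilon>0 \<Longrightarrow> entropy ystar + \<eta>' \<le> entropy y \<Longrightarrow> \<phi> \<le> dissip y"
      using dissip_lower_bound[OF eta'(1) pos] by blast
    \<comment> \<open>The entropy excess is less than \<open>\<eta>\<close> at the start, hence exhausted at rate \<open>\<phi>\<close> by the time \<open>\<eta> / \<phi>\<close>.\<close>
    have "gap (y t) < \<delta>" if y: "fluid_solution y" "feasible (y 0)" "gap (y 0) \<le> \<epsilon>" and t: "\<eta> / \<phi> \<le> t" for y t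
    proof (rule ccontr)
      assume far: "\<not> gap (y t) < \<delta>"
      have t0: "0 \<le> t" using t eta(1) phi(1) by (meson divide_pos_pos less_le_trans less_imp_le)
      have near: "gap (y u) \<le> \<epsilon>0" if "0 \<le> u" for u using main[OF y that] by simp
      have P: "positive (y u)" if "0 \<le> u" for u
        using fluid_solution_servers[OF y(1)] near[OF that] that by (intro pos) auto
      have F: "feasible (y u)" if "0 \<le> u" for u
        using solution_feasible[OF y(1), of u u] y(2) that P positive_fitmass by auto
      have mono: "entropy (y t) \<le> entropy (y u)" if u: "u \<in> {0..t}" for u
      proof -
        have D: "((\<lambda>t. entropy (y t)) has_real_derivative - dissip (y s)) (at s within {0..t})" if "s \<in> {0..t}" for s
          using entropy_derivative[OF y(1) t0 _ y(2) that P] P positive_fitmass that by auto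
        show ?thesis
        proof (rule DERIV_nonpos_imp_decreasing_open[where f = "\<lambda>t. entropy (y t)"])
          show "continuous_on {u..t} (\<lambda>t. entropy (y t))"
            using D u by (intro continuous_on_subset[OF DERIV_continuous_on[OF D]]) auto
          fix s assume s: "u < s" "s < t"
          then have "((\<lambda>t. entropy (y t)) has_real_derivative - dissip (y s)) (at s)"
            using D[of s] u at_within_Icc_at[of 0 s t] by auto
          then show "\<exists>l. ((\<lambda>t. entropy (y t)) has_real_derivative l) (at s) \<and> l \<le> 0"
            using dissip_nonneg[OF P[of s]] u s by auto
        qed (use u in auto)
      qed
      have "\<phi> \<le> dissip (y u)" if "u \<in> {0..t}" for u
        using phi(2)[of "y u"] F[of u] near[of u] that mono[OF that] eta'(2)[OF F[OF t0]] far by auto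
      then have "entropy (y t) \<le> entropy (y 0) - \<phi> * t"
        using y t0 P positive_fitmass by (intro entropy_decrease) auto
      moreover have "\<eta> \<le> \<phi> * t" using t phi(1) by (simp add: field_simps)
      moreover have "entropy (y 0) < entropy ystar + \<eta>" using e1(2) y eps by auto
      ultimately show False using ystar_min[OF F[OF t0]] by linarith
    qed
    then show ?thesis using eta(1) phi(1) by (intro exI[of _ "\<eta> / \<phi>"]) auto
  qed
  then show ?thesis using eps(1) by blast
qed

subsection \<open>Invariant solutions\<close>

text \<open>An unused configuration that can be reached by one arrival from a used one has a positive inflow and
  no outflow; so at a rest point with idle servers of every type all configurations are used.\<close>

lemma rest_point_positive:
  assumes sf: "server_feasible y" and idle: "\<And>s. 0 < y (zero_cfg s)"
    and rest: "\<And>k. k \<in> Kbar G \<Longrightarrow> drift y k = 0"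
  shows "positive y"
  unfolding positive_def
proof
  have y0: "0 \<le> y k" if "k \<in> Kbar G" for k using sf that by (simp add: server_feasible_def)
  have fm: "0 < fitmass y i" for i by (rule fitmass_pos_if_idle[OF sf idle])
  fix k assume "k \<in> Kbar G"
  then show "0 < y k"
  proof (induction rule: config_induct)
    case (zero s)
    show ?case by (rule idle)
  next
    case (edge k i)
    note e = edge(1) and d = edge(2)
    have k: "k \<in> Kbar G" using e by (rule edge_Kbar)
    show ?case
    proof (rule ccontr)
      assume "\<not> 0 < y k"
      then have k0: "y k = 0" using y0[OF k] by simp
      have a0: "0 \<le> arr y e" if "e \<in> edges G" for e
        using that y0[of "del_cust (fst e) (snd e)"] fm[of "snd e"] lam_pos[of "snd e"]
        by (cases e) (simp add: arr_def edges_iff del_in_Kbar)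
      have d0: "0 \<le> dep y e" if "e \<in> edges G" for e
        using that y0[of "fst e"] mu_pos[of "snd e"] by (cases e) (simp add: dep_def edges_iff)
      have "arr y (k, i) \<le> (\<Sum>j | (k, j) \<in> edges G. arr y (k, j))"
        using e a0 by (intro member_le_sum) auto
      moreover have "0 < arr y (k, i)" using d fm[of i] lam_pos[of i] by (simp add: arr_def)
      moreover have "0 \<le> (\<Sum>j | (add_cust k j, j) \<in> edges G. dep y (add_cust k j, j))"
        by (intro sum_nonneg d0) auto
      moreover have "drift y k = (\<Sum>j | (k, j) \<in> edges G. arr y (k, j))
          + (\<Sum>j | (add_cust k j, j) \<in> edges G. dep y (add_cust k j, j))"
        unfolding drift_def netflow_def
        by (simp add: sum_subtractf) (simp add: dep_def arr_def k0)
      ultimately show False using rest[OF k] by linarith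
    qed
  qed
qed

text \<open>Invariance makes the drift vanish. The customer equation then gives \<open>\<rho>\<^sub>i\<close> customers of type \<open>i\<close>, and
  the dissipation vanishes too, which leaves only the optimal point.\<close>

theorem invariant_solution_unique:
  assumes y: "fluid_solution y" and inv: "\<And>t k. 0 \<le> t \<Longrightarrow> k \<in> Kbar G \<Longrightarrow> y t k = y 0 k"
    and idle: "\<And>s. 0 < y 0 (zero_cfg s)" and k: "k \<in> Kbar G"
  shows "y 0 k = ystar k"
proof -
  have sf: "server_feasible (y t)" if "0 \<le> t" for t using fluid_solution_servers[OF y that] .
  have fm: "0 < fitmass (y u) i" if "u \<in> {0..1}" for u i
    using that inv[of u "zero_cfg _"] zero_in_Kbar idle by (intro fitmass_pos_if_idle sf) auto
  note D = solution_derivative[OF y zero_le_one fm, of _ 0] customers_derivative[OF y zero_le_one fm, of 0]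
  have const: "d = 0" if "(f has_real_derivative d) (at 0 within {0..1})" "\<And>t. t \<in> {0..1} \<Longrightarrow> f t = f 0"
    for f :: "real \<Rightarrow> real" and d
  proof -
    have "((\<lambda>_. f 0) has_real_derivative d) (at 0 within {0..1})"
      by (rule has_field_derivative_transform_within[OF that(1) zero_less_one]) (simp, rule that(2))
    moreover have "((\<lambda>_. f 0) has_real_derivative 0) (at 0 within {0..1})" by simp
    moreover have "at 0 within {0..1::real} \<noteq> bot"
      by (simp add: trivial_limit_within islimpt_Icc)
    ultimately show ?thesis
      unfolding has_field_derivative_iff using tendsto_unique by blast
  qed
  have rest: "drift (y 0) k = 0" if "k \<in> Kbar G" for k
  proof (rule const[OF D(1)])
    show "\<And>t. t \<in> {0..1} \<Longrightarrow> y t k = y 0 k" using inv that by (meson atLeastAtMost_iff)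
  qed (use that in auto)
  have pos: "positive (y 0)" by (rule rest_point_positive[OF sf idle rest]) auto
  have "(\<Sum>k\<in>Kbar G. real (fst k i) * y 0 k) = rho G i" for i
  proof -
    have "lam G i - mu G i * (\<Sum>k\<in>Kbar G. real (fst k i) * y 0 k) = 0"
      proof (rule const[OF D(2)])
      fix t :: real assume "t \<in> {0..1}"
      then show "(\<Sum>k\<in>Kbar G. real (fst k i) * y t k) = (\<Sum>k\<in>Kbar G. real (fst k i) * y 0 k)"
        by (intro sum.cong) (simp_all add: inv[of t])
    qed auto
    then show ?thesis using mu_pos[of i] by (simp add: rho_def field_simps)
  qed
  then have F: "feasible (y 0)" using sf by (simp add: feasible_def)
  have "dissip (y 0) = 0" using grad_drift[OF F pos] rest by simp
  then show ?thesis by (intro balanced_eq_ystar F pos k dissip_0D)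
qed

end

section \<open>Step functions and counting paths\<close>

text \<open>The condition of \<open>step_path\<close>, for values of any type: a rate of a path is a function of finitely many
  coordinates of the state and inherits the property.\<close>

definition step_function :: "(real \<Rightarrow> 'b) \<Rightarrow> bool" where
  "step_function f \<longleftrightarrow>
     (\<forall>t\<ge>0. \<forall>\<^sub>F u in at_right t. f u = f t) \<and>
     (\<forall>t>0. \<exists>y. \<forall>\<^sub>F u in at_left t. f u = y)"

lemma step_path_iff: "step_path f \<longleftrightarrow> step_function f"
  by (simp add: step_path_def step_function_def)

lemma step_function_compose: "step_function f \<Longrightarrow> step_function (\<lambda>t. g (f t))"
proof -
  assume f: "step_function f"
  have "\<exists>y. \<forall>\<^sub>F u in at_left t. g (f u) = y" if "0 < t" for t
  proof -
    have "\<exists>y. \<forall>\<^sub>F u in at_left t. f u = y" using f that unfolding step_function_def by simp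
    then obtain y where "\<forall>\<^sub>F u in at_left t. f u = y" ..
    then have "\<forall>\<^sub>F u in at_left t. g (f u) = g y" by eventually_elim simp
    then show ?thesis by (rule exI[where x = "g y"])
  qed
  moreover have "\<forall>\<^sub>F u in at_right t. g (f u) = g (f t)" if "0 \<le> t" for t
  proof -
    have "\<forall>\<^sub>F u in at_right t. f u = f t" using f that unfolding step_function_def by simp
    then show ?thesis by eventually_elim simp
  qed
  ultimately show ?thesis unfolding step_function_def by simp
qed

lemma step_function_restrict:
  assumes "finite S" "\<And>k. k \<in> S \<Longrightarrow> step_function (\<lambda>t. f t k)"
  shows "step_function (\<lambda>t. restrict (f t) S)"
  unfolding step_function_def
proof (intro conjI allI impI)
  fix t :: real assume "0 \<le> t"
  then have "\<forall>\<^sub>F u in at_right t. \<forall>k\<in>S. f u k = f t k"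
    using assms by (intro eventually_ball_finite) (auto simp: step_function_def)
  then show "\<forall>\<^sub>F u in at_right t. restrict (f u) S = restrict (f t) S"
    by eventually_elim (auto simp: restrict_def)
next
  fix t :: real assume "0 < t"
  then have "\<forall>k\<in>S. \<exists>y. \<forall>\<^sub>F u in at_left t. f u k = y"
    using assms(2) unfolding step_function_def by simp
  from bchoice[OF this] obtain y where "\<forall>k\<in>S. \<forall>\<^sub>F u in at_left t. f u k = y k" ..
  then have "\<forall>\<^sub>F u in at_left t. \<forall>k\<in>S. f u k = y k"
    using assms(1) by (intro eventually_ball_finite)
  then have "\<forall>\<^sub>F u in at_left t. restrict (f u) S = restrict y S"
    by eventually_elim (auto simp: restrict_def)
  then show "\<exists>y. \<forall>\<^sub>F u in at_left t. restrict (f u) S = y" by (rule exI[where x = "restrict y S"])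
qed

lemma step_function_integrable:
  fixes f :: "real \<Rightarrow> real"
  assumes f: "step_function f" and a: "0 \<le> a" shows "f integrable_on {a..b}"
proof (cases "a \<le> b")
  case True
  define g where "g = (\<lambda>t. if t < 0 then f 0 else f t)"
  have "g integrable_on {a..b}"
    using True
  proof (induction rule: Bolzano)
    case (trans a b c)
    then show ?case by (auto intro: Henstock_Kurzweil_Integration.integrable_combine)
  next
    case (local x)
    have "\<forall>\<^sub>F u in at_right x. g u = g x"
    proof (cases "0 \<le> x")
      case True
      then have "\<forall>\<^sub>F u in at_right x. f u = f x" using f by (simp add: step_function_def)
      then show ?thesis using eventually_at_right_less[of x]
        by eventually_elim (use True in \<open>auto simp: g_def\<close>)
    next
      case False
      then show ?thesis by (auto simp: g_def eventually_at_right[of x 0] intro!: exI[of _ 0])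
    qed
    then obtain r where r: "r > x" "\<And>u. x < u \<Longrightarrow> u < r \<Longrightarrow> g u = g x"
      by (auto simp: eventually_at_right[of x "x + 1"])
    have "\<exists>y. \<forall>\<^sub>F u in at_left x. g u = y"
    proof (cases "0 < x")
      case True
      then have "\<exists>y. \<forall>\<^sub>F u in at_left x. f u = y" using f unfolding step_function_def by simp
      then obtain y where "\<forall>\<^sub>F u in at_left x. f u = y" ..
      moreover have "\<forall>\<^sub>F u in at_left x. 0 < u"
        using True eventually_at_left[of 0 x] by auto
      ultimately have "\<forall>\<^sub>F u in at_left x. g u = y"
        by eventually_elim (auto simp: g_def)
      then show ?thesis ..
    next
      case False
      have "\<forall>\<^sub>F u in at_left x. g u = f 0"
        using False by (auto simp: g_def eventually_at_left[of "x - 1" x] intro!: exI[of _ "x - 1"])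
      then show ?thesis ..
    qed
    then obtain y l where l: "l < x" "\<And>u. l < u \<Longrightarrow> u < x \<Longrightarrow> g u = y"
      by (auto simp: eventually_at_left[of "x - 1" x])
    have "g integrable_on {a..b}" if ab: "a \<le> x" "x \<le> b" "b - a < min (r - x) (x - l)" for a b
    proof (rule Henstock_Kurzweil_Integration.integrable_combine[OF ab(1,2)])
      show "g integrable_on {a..x}"
        by (rule integrable_spike[where f = "\<lambda>_. y" and S = "{x}"]) (use ab l in auto)
      show "g integrable_on {x..b}"
      proof (rule integrable_eq[where f = "\<lambda>_. g x"])
        fix u assume "u \<in> {x..b}"
        then show "g x = g u" using r(2)[of u] ab by (cases "u = x") auto
      qed auto
    qed
    moreover have "0 < min (r - x) (x - l)" using r(1) l(1) by simp
    ultimately show ?case by blast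
  qed
  then show ?thesis by (rule integrable_eq) (use a in \<open>auto simp: g_def\<close>)
next
  case False
  then have "{a..b} = {}" by simp
  then show ?thesis using integrable_on_empty by metis
qed

lemma poisson_path_times:
  assumes "poisson_path N"
  obtains T where "0 < T 0" "strict_mono T" "\<And>t n. 0 \<le> t \<Longrightarrow> T n \<le> t \<longleftrightarrow> n < N t"
proof -
  from assms obtain T :: "nat \<Rightarrow> real" where T: "0 < T 0" "strict_mono T" "filterlim T at_top sequentially"
    "\<And>t. 0 \<le> t \<Longrightarrow> N t = card {n. T n \<le> t}"
    unfolding poisson_path_def by auto
  have "T n \<le> t \<longleftrightarrow> n < N t" if t: "0 \<le> t" for t n
  proof -
    have "\<forall>\<^sub>F n in sequentially. t < T n" using T(3) by (simp add: filterlim_at_top_dense)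
    then have ex: "\<exists>n. t < T n" by (auto simp: eventually_sequentially)
    define M where "M = (LEAST n. t < T n)"
    have "T n \<le> t \<longleftrightarrow> n < M" for n
    proof
      assume "T n \<le> t"
      moreover have "t < T M" unfolding M_def by (rule LeastI_ex[OF ex])
      ultimately have "T n < T M" by linarith
      then show "n < M" using T(2) by (simp add: strict_mono_less)
    next
      assume "n < M"
      then show "T n \<le> t" unfolding M_def using not_less_Least by fastforce
    qed
    moreover from this have "{n. T n \<le> t} = {..<M}" by auto
    ultimately show ?thesis using T(4)[OF t] by simp
  qed
  with T that show ?thesis by blast
qed

lemma poisson_path_mono: "poisson_path N \<Longrightarrow> 0 \<le> s \<Longrightarrow> s \<le> t \<Longrightarrow> N s \<le> N t"
  by (erule poisson_path_times) (metis linorder_not_le order_trans less_irrefl)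

lemma poisson_event:
  assumes N: "poisson_path N" and c: "0 < c" and m: "1 \<le> m"
  shows "0 < event_time N c m" and "0 \<le> t \<Longrightarrow> event_time N c m \<le> t \<longleftrightarrow> m \<le> N (c * t)"
proof -
  obtain T where T: "0 < T 0" "strict_mono T" "\<And>t n. 0 \<le> t \<Longrightarrow> T n \<le> t \<longleftrightarrow> n < N t"
    using poisson_path_times[OF N] by blast
  have pos: "0 < T (m - 1)"
    using T(1) strict_mono_less_eq[OF T(2), of 0 "m - 1"] by simp
  have iff: "m \<le> N (c * t) \<longleftrightarrow> T (m - 1) / c \<le> t" if "0 \<le> t" for t
  proof -
    have "m \<le> N (c * t) \<longleftrightarrow> T (m - 1) \<le> c * t"
      using T(3)[of "c * t" "m - 1"] that c m by auto
    then show ?thesis using c by (simp add: field_simps)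
  qed
  have "{t. 0 \<le> t \<and> m \<le> N (c * t)} = {T (m - 1) / c..}"
  proof (intro set_eqI iffI)
    fix t assume "t \<in> {T (m - 1) / c..}"
    moreover have "0 < T (m - 1) / c" using pos c by simp
    ultimately show "t \<in> {t. 0 \<le> t \<and> m \<le> N (c * t)}" using iff[of t] by auto
  qed (use iff in auto)
  then have "event_time N c m = T (m - 1) / c" unfolding event_time_def by simp
  then show "0 < event_time N c m" "0 \<le> t \<Longrightarrow> event_time N c m \<le> t \<longleftrightarrow> m \<le> N (c * t)"
    using pos c iff by auto
qed

section \<open>Random assignment\<close>

context grand_model
begin

lemma listing_distinct: "distinct (listing G i)" and listing_set: "set (listing G i) = fitting G i"
  using ok unfolding grand_system_ok_def by auto

lemma sum_listing: "(\<Sum>l<length (listing G i). f (listing G i ! l)) = (\<Sum>k\<in>fitting G i. f k)"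
  using sum.reindex_bij_betw[OF bij_betw_nth[OF listing_distinct refl refl]]
  by (simp add: listing_set)

text \<open>The left end point of the subinterval of \<open>[0, 1]\<close> for entry \<open>j\<close> of the list, counted from \<open>0\<close>.\<close>

definition cum :: "(('i, 's) config \<Rightarrow> real) \<Rightarrow> 'i \<Rightarrow> nat \<Rightarrow> real" where
  "cum y i j = (\<Sum>l<j. y (listing G i ! l)) / fitmass y i"

lemma fit_count_real: "real (fit_count G Y i) = fitmass (\<lambda>k. real (Y k)) i"
  by (simp add: fit_count_def fitmass_def)

lemma cum_scale: "r \<noteq> 0 \<Longrightarrow> cum (\<lambda>k. y k / r) i j = cum y i j"
  by (simp add: cum_def fitmass_def sum_divide_distrib[symmetric])

lemma cum_length: "fitmass y i > 0 \<Longrightarrow> cum y i (length (listing G i)) = 1"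
  unfolding cum_def sum_listing fitmass_def by simp

lemma cum_bounds:
  assumes y: "\<And>k. k \<in> Kbar G \<Longrightarrow> 0 \<le> y k" and j: "j \<le> length (listing G i)"
  shows "0 \<le> cum y i j" "cum y i j \<le> 1"
proof -
  have nn: "0 \<le> y (listing G i ! l)" if "l < length (listing G i)" for l
    using nth_mem[OF that] by (intro y fitting_Kbar[of _ i]) (simp add: listing_set)
  have le: "(\<Sum>l<j. y (listing G i ! l)) \<le> (\<Sum>l<length (listing G i). y (listing G i ! l))"
    using j nn by (intro sum_mono2) auto
  have "0 \<le> (\<Sum>l<j. y (listing G i ! l))" using j nn by (intro sum_nonneg) auto
  with le show "0 \<le> cum y i j" "cum y i j \<le> 1"
    unfolding sum_listing cum_def fitmass_def[symmetric] by (auto simp: divide_le_eq_1)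
qed

lemma cum_Suc: "cum y i (Suc j) = cum y i j + y (listing G i ! j) / fitmass y i"
  by (simp add: cum_def add_divide_distrib)

lemma selected_cong:
  assumes "\<And>k. k \<in> fitting G i \<Longrightarrow> Y k = Z k"
  shows "fit_count G Y i = fit_count G Z i" "selected G Y i u = selected G Z i u"
proof -
  show fc: "fit_count G Y i = fit_count G Z i"
    unfolding fit_count_def using assms by (auto intro: sum.cong)
  have "Y (listing G i ! l) = Z (listing G i ! l)" if "l < length (listing G i)" for l
    using assms nth_mem[OF that] by (simp add: listing_set)
  then have eq: "(j < length (listing G i) \<and> 0 < Y (listing G i ! j) \<and>
      u \<le> (\<Sum>l\<le>j. real (Y (listing G i ! l)) / real (fit_count G Y i))) \<longleftrightarrow>
     (j < length (listing G i) \<and> 0 < Z (listing G i ! j) \<and>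
      u \<le> (\<Sum>l\<le>j. real (Z (listing G i ! l)) / real (fit_count G Z i)))" for j
  proof (cases "j < length (listing G i)")
    case True
    then have "(\<Sum>l\<le>j. real (Y (listing G i ! l)) / real (fit_count G Y i))
        = (\<Sum>l\<le>j. real (Z (listing G i ! l)) / real (fit_count G Z i))"
      using \<open>\<And>l. l < length (listing G i) \<Longrightarrow> Y (listing G i ! l) = Z (listing G i ! l)\<close> fc
      by (intro sum.cong) auto
    with True show ?thesis
      using \<open>\<And>l. l < length (listing G i) \<Longrightarrow> Y (listing G i ! l) = Z (listing G i ! l)\<close> by simp
  qed simp
  then show "selected G Y i u = selected G Z i u" unfolding selected_def by simp
qed

context
  fixes Y :: "('i, 's) config \<Rightarrow> nat" and i :: 'i
  assumes room: "1 \<le> fit_count G Y i"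
begin

abbreviation "cumY \<equiv> cum (\<lambda>k. real (Y k)) i"

text \<open>\<open>selected\<close> takes the least index that is hit.\<close>

definition hits :: "real \<Rightarrow> nat \<Rightarrow> bool" where
  "hits u j \<longleftrightarrow> j < length (listing G i) \<and> 0 < Y (listing G i ! j) \<and> u \<le> cumY (Suc j)"

lemma selected_eq: "selected G Y i u = listing G i ! (LEAST j. hits u j)"
  unfolding selected_def hits_def cum_def
  by (simp add: lessThan_Suc_atMost sum_divide_distrib fit_count_real)

text \<open>At the first \<open>j\<close> with \<open>u \<le> cumY j\<close> the last summand is positive, so the index \<open>j - 1\<close> is hit.\<close>

lemma hits_before:
  assumes "0 < u" "u \<le> cumY j" "j \<le> length (listing G i)" shows "\<exists>j'<j. hits u j'"
  using assms(2,3)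
proof (induction j)
  case 0
  then show ?case using assms(1) by (simp add: cum_def)
next
  case (Suc j)
  show ?case
  proof (cases "u \<le> cumY j")
    case True
    then show ?thesis using Suc by (auto intro: less_SucI)
  next
    case False
    with Suc.prems have "0 < real (Y (listing G i ! j)) / fitmass (\<lambda>k. real (Y k)) i"
      by (simp add: cum_Suc)
    then have "Y (listing G i ! j) \<noteq> 0" by (intro notI) simp
    then show ?thesis using Suc.prems by (auto simp: hits_def)
  qed
qed

lemma hits_exists: assumes "u \<le> 1" shows "\<exists>j. hits u j"
proof -
  have "0 < fitmass (\<lambda>k. real (Y k)) i" using room by (simp add: fit_count_real[symmetric])
  then obtain j where "hits 1 j"
    using hits_before[of 1 "length (listing G i)"] cum_length[of "\<lambda>k. real (Y k)" i] by auto
  then show ?thesis using assms by (auto simp: hits_def)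
qed

lemma selected_fits:
  assumes "u \<le> 1" shows "selected G Y i u \<in> fitting G i" "0 < Y (selected G Y i u)"
proof -
  have "hits u (LEAST j. hits u j)" using hits_exists[OF assms] by (rule LeastI_ex)
  then show "selected G Y i u \<in> fitting G i" "0 < Y (selected G Y i u)"
    unfolding selected_eq hits_def[of u "LEAST j. hits u j"] by (simp_all add: listing_set[symmetric])
qed

lemma selected_iff:
  assumes u: "0 < u" "u \<le> 1" and j: "j < length (listing G i)"
  shows "selected G Y i u = listing G i ! j \<longleftrightarrow> cumY j < u \<and> u \<le> cumY (Suc j)"
proof -
  let ?J = "LEAST j. hits u j"
  have J: "hits u ?J" using hits_exists[OF u(2)] by (rule LeastI_ex)
  have cum_mono: "cumY a \<le> cumY b" if "a \<le> b" for a b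
    unfolding cum_def using that
    by (intro divide_right_mono sum_mono2) (auto simp: fit_count_real[symmetric])
  have "selected G Y i u = listing G i ! j \<longleftrightarrow> ?J = j"
    unfolding selected_eq using J j unfolding hits_def[of u ?J]
    by (simp add: nth_eq_iff_index_eq[OF listing_distinct])
  also have "\<dots> \<longleftrightarrow> cumY j < u \<and> u \<le> cumY (Suc j)"
  proof
    assume "?J = j"
    with J have "hits u j" by simp
    moreover have "\<not> u \<le> cumY j"
      using hits_before[OF u(1), of j] not_less_Least[of _ "hits u"] j \<open>?J = j\<close> by fastforce
    ultimately show "cumY j < u \<and> u \<le> cumY (Suc j)" by (simp add: hits_def)
  next
    assume c: "cumY j < u \<and> u \<le> cumY (Suc j)"
    then have "0 < real (Y (listing G i ! j)) / fitmass (\<lambda>k. real (Y k)) i"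
      by (simp add: cum_Suc)
    then have "Y (listing G i ! j) \<noteq> 0" by (intro notI) simp
    then have "hits u j" using c j by (simp add: hits_def)
    moreover have "\<not> hits u j'" if "j' < j" for j'
      using cum_mono[of "Suc j'" j] that c by (simp add: hits_def)
    ultimately show "?J = j" by (intro Least_equality) (auto simp: not_less[symmetric])
  qed
  finally show ?thesis .
qed

end

lemma ratio_perturbation:
  fixes P f :: real
  assumes "0 \<le> P" "P \<le> f" "0 < f" "0 < c" "c \<le> f'" "\<bar>P - P'\<bar> \<le> d" "\<bar>f - f'\<bar> \<le> d"
  shows "\<bar>P / f - P' / f'\<bar> \<le> 2 * d / c"
proof -
  have f': "0 < f'" using assms by linarith
  have "P / f - P' / f' = (P - P') / f' + (P / f) * ((f' - f) / f')"
    using assms(3) f' by (simp add: field_simps)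
  also have "\<bar>\<dots>\<bar> \<le> \<bar>(P - P') / f'\<bar> + \<bar>P / f\<bar> * \<bar>(f' - f) / f'\<bar>"
    by (metis abs_triangle_ineq abs_mult)
  also have "\<dots> \<le> d / f' + 1 * (d / f')"
    using assms f' by (intro add_mono mult_mono) (auto simp: abs_minus_commute divide_right_mono)
  also have "\<dots> = 2 * d / f'" by simp
  also have "\<dots> \<le> 2 * d / c" using assms f' by (intro divide_left_mono) auto
  finally show ?thesis .
qed

lemma cum_perturbation:
  assumes y: "\<And>k. k \<in> Kbar G \<Longrightarrow> 0 \<le> y k" and "0 < fitmass y i" "0 < c" "c \<le> fitmass z i"
    and d: "\<And>k. k \<in> Kbar G \<Longrightarrow> \<bar>y k - z k\<bar> \<le> d" and j: "j \<le> length (listing G i)"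
  shows "\<bar>cum y i j - cum z i j\<bar> \<le> 2 * (real (card (Kbar G)) * d) / c"
  unfolding cum_def
proof (rule ratio_perturbation)
  have mem: "listing G i ! l \<in> Kbar G" if "l < length (listing G i)" for l
    using nth_mem[OF that] by (intro fitting_Kbar[of _ i]) (simp add: listing_set)
  have d0: "0 \<le> d" using d[OF zero_in_Kbar[of undefined]] by linarith
  have len: "length (listing G i) \<le> card (Kbar G)"
    using distinct_card[OF listing_distinct[of i]] listing_set[of i]
    by (metis card_mono finite_Kbar fitting_Kbar subsetI)
  have *: "\<bar>(\<Sum>l<j. y (listing G i ! l)) - (\<Sum>l<j. z (listing G i ! l))\<bar> \<le> real (card (Kbar G)) * d"
    if "j \<le> length (listing G i)" for j
  proof -
    have "\<bar>(\<Sum>l<j. y (listing G i ! l)) - (\<Sum>l<j. z (listing G i ! l))\<bar> \<le> (\<Sum>l<j. d)"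
      unfolding sum_subtractf[symmetric] using that
      by (intro order_trans[OF sum_abs] sum_mono d mem) auto
    also have "\<dots> \<le> real (card (Kbar G)) * d" using that len d0 by (auto intro!: mult_right_mono)
    finally show ?thesis .
  qed
  show "\<bar>(\<Sum>l<j. y (listing G i ! l)) - (\<Sum>l<j. z (listing G i ! l))\<bar> \<le> real (card (Kbar G)) * d"
    by (rule *[OF j])
  show "\<bar>fitmass y i - fitmass z i\<bar> \<le> real (card (Kbar G)) * d"
    using *[OF order_refl] unfolding sum_listing fitmass_def .
  show "0 \<le> (\<Sum>l<j. y (listing G i ! l))" using j by (intro sum_nonneg y mem) auto
  have "(\<Sum>l<j. y (listing G i ! l)) \<le> (\<Sum>l<length (listing G i). y (listing G i ! l))"
    using j by (intro sum_mono2) (auto intro!: y mem)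
  then show "(\<Sum>l<j. y (listing G i ! l)) \<le> fitmass y i" unfolding sum_listing fitmass_def .
qed (use assms in auto)

lemma arr_cum:
  assumes "(k, i) \<in> edges G"
  obtains j where "j < length (listing G i)" "listing G i ! j = del_cust k i"
    "\<And>y. arr y (k, i) = lam G i * (cum y i (Suc j) - cum y i j)"
proof -
  have "del_cust k i \<in> set (listing G i)" using del_fitting[OF assms] by (simp add: listing_set)
  then obtain j where "j < length (listing G i)" "listing G i ! j = del_cust k i"
    by (auto simp: in_set_conv_nth)
  then show thesis by (intro that[of j]) (auto simp: arr_def cum_Suc)
qed

lemma netflow_cong: "(\<And>e. e \<in> edges G \<Longrightarrow> v e = w e) \<Longrightarrow> netflow v k = netflow w k"
  by (simp add: netflow_def)

lemma netflow_diff: "netflow (\<lambda>e. v e - w e) k = netflow v k - netflow w k"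
  by (simp add: netflow_def sum_subtractf)

lemma netflow_bound:
  assumes "\<And>e. e \<in> edges G \<Longrightarrow> \<bar>w e\<bar> \<le> c" "0 \<le> c"
  shows "\<bar>netflow w k\<bar> \<le> 2 * real CARD('i) * c"
proof -
  have *: "\<bar>\<Sum>i\<in>A. w (f i, i)\<bar> \<le> real CARD('i) * c" if "\<And>i. i \<in> A \<Longrightarrow> (f i, i) \<in> edges G" for A :: "'i set" and f
  proof -
    have "\<bar>\<Sum>i\<in>A. w (f i, i)\<bar> \<le> (\<Sum>i\<in>A. c)"
      using assms(1) that by (intro order_trans[OF sum_abs] sum_mono) auto
    also have "\<dots> \<le> real CARD('i) * c"
      using assms(2) by (simp add: mult_right_mono card_mono)
    finally show ?thesis .
  qed
  show ?thesis unfolding netflow_def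
    using *[of "{i. (k, i) \<in> edges G}" "\<lambda>_. k"] *[of "{i. (add_cust k i, i) \<in> edges G}" "add_cust k"]
    by auto
qed

end

section \<open>Laws of large numbers along a path\<close>

lemma integral_close:
  fixes f g :: "real \<Rightarrow> real"
  assumes "f integrable_on {s..t}" "g integrable_on {s..t}" "s \<le> t" "\<And>u. u \<in> {s..t} \<Longrightarrow> \<bar>f u - g u\<bar> \<le> B"
  shows "\<bar>integral {s..t} f - integral {s..t} g\<bar> \<le> B * (t - s)"
proof -
  have "0 \<le> B" using assms(3) assms(4)[of s] by auto
  moreover have "((\<lambda>u. f u - g u) has_integral (integral {s..t} f - integral {s..t} g)) {s..t}"
    by (intro has_integral_diff integrable_integral assms)
  ultimately have "norm (integral {s..t} f - integral {s..t} g) \<le> B * measure lborel {s..t}"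
    using assms(4) by (intro has_integral_bound_real[where S = "{}"]) auto
  then show ?thesis using assms(3) by simp
qed

locale driven_model = grand_model G for G :: "('i::finite, 's::finite) grand_system" +
  fixes rs :: "nat \<Rightarrow> real" and Pd :: "('i, 's) config \<times> 'i \<Rightarrow> real \<Rightarrow> nat"
    and Pa :: "'i \<Rightarrow> real \<Rightarrow> nat" and xi :: "'i \<Rightarrow> nat \<Rightarrow> real"
  assumes scal: "scaling_sequence G rs" and prim: "primitives_ok G rs Pd Pa xi"
begin

lemma rs_pos: "0 < rs n" and rs_nz: "rs n \<noteq> 0"
  using scal unfolding scaling_sequence_def by (auto simp: less_le_trans[OF zero_less_one] intro: less_imp_neq[symmetric])
    (metis not_one_le_zero)

lemma Pa_poisson: "poisson_path (Pa i)" and xi_unit: "0 \<le> xi i m" "xi i m \<le> 1"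
  using prim unfolding primitives_ok_def by auto

definition path :: "nat \<Rightarrow> (real \<Rightarrow> ('i, 's) config \<Rightarrow> nat) \<Rightarrow> (real \<Rightarrow> ('i, 's) config \<times> 'i \<Rightarrow> nat) \<Rightarrow>
    (real \<Rightarrow> ('i, 's) config \<times> 'i \<Rightarrow> nat) \<Rightarrow> bool" where
  "path n = grand_f_path G (rs n) Pd Pa xi"

definition scaled :: "nat \<Rightarrow> (real \<Rightarrow> ('i, 's) config \<Rightarrow> nat) \<Rightarrow> real \<Rightarrow> ('i, 's) config \<Rightarrow> real" where
  "scaled n X t k = real (X t k) / rs n"

definition arrivals :: "nat \<Rightarrow> 'i \<Rightarrow> real \<Rightarrow> nat" where
  "arrivals n i t = Pa i (lam G i * rs n * t)"

definition placed :: "nat \<Rightarrow> (real \<Rightarrow> ('i, 's) config \<Rightarrow> nat) \<Rightarrow> ('i, 's) config \<Rightarrow> 'i \<Rightarrow> nat \<Rightarrow> bool" where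
  "placed n X k i m \<longleftrightarrow> (let Y = state_before X (event_time (Pa i) (lam G i * rs n) m)
     in fit_count G Y i \<ge> 1 \<and> selected G Y i (xi i m) = del_cust k i)"

lemma placed_arrivals_eq:
  "placed_arrivals G (rs n) Pa xi X k i t = {m \<in> {1..arrivals n i t}. placed n X k i m}"
  by (auto simp: placed_arrivals_def placed_def arrivals_def)

lemma arrivals_mono: "0 \<le> s \<Longrightarrow> s \<le> t \<Longrightarrow> arrivals n i s \<le> arrivals n i t"
  unfolding arrivals_def using lam_pos[of i] rs_pos[of n]
  by (intro poisson_path_mono Pa_poisson) (auto intro: mult_left_mono)

lemma arrivals_event:
  assumes "1 \<le> m"
  shows "0 < event_time (Pa i) (lam G i * rs n) m"
    and "0 \<le> t \<Longrightarrow> event_time (Pa i) (lam G i * rs n) m \<le> t \<longleftrightarrow> m \<le> arrivals n i t"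
proof -
  have "0 < lam G i * rs n" using lam_pos[of i] rs_pos[of n] by simp
  note ev = poisson_event[OF Pa_poisson[of i] this assms]
  show "0 < event_time (Pa i) (lam G i * rs n) m" by (rule ev(1))
  show "0 \<le> t \<Longrightarrow> event_time (Pa i) (lam G i * rs n) m \<le> t \<longleftrightarrow> m \<le> arrivals n i t"
    unfolding arrivals_def by (rule ev(2))
qed

subsection \<open>Limits of the primitives\<close>

lemma arrivals_limit:
  assumes "0 < \<epsilon>"
  shows "\<forall>\<^sub>F n in sequentially. \<forall>i. \<forall>t\<in>{0..C}. \<bar>real (arrivals n i t) / rs n - lam G i * t\<bar> \<le> \<epsilon>"
proof (rule eventually_all_finite)
  fix i
  have "uniform_limit {0..lam G i * C} (\<lambda>n t. real (Pa i (rs n * t)) / rs n) (\<lambda>t. t) sequentially"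
    using prim unfolding primitives_ok_def by blast
  from uniform_limitD[OF this assms]
  show "\<forall>\<^sub>F n in sequentially. \<forall>t\<in>{0..C}. \<bar>real (arrivals n i t) / rs n - lam G i * t\<bar> \<le> \<epsilon>"
  proof eventually_elim
    case (elim n)
    show ?case
    proof
      fix t assume "t \<in> {0..C}"
      then have "lam G i * t \<in> {0..lam G i * C}" using lam_pos[of i] by (auto intro: mult_left_mono)
      with elim have "dist (real (Pa i (rs n * (lam G i * t))) / rs n) (lam G i * t) < \<epsilon>" by blast
      then show "\<bar>real (arrivals n i t) / rs n - lam G i * t\<bar> \<le> \<epsilon>"
        by (simp add: arrivals_def dist_real_def ac_simps)
    qed
  qed
qed

definition marks_below :: "nat \<Rightarrow> 'i \<Rightarrow> real \<Rightarrow> real \<Rightarrow> nat" where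
  "marks_below n i t \<zeta> = card {m \<in> {1..arrivals n i t}. xi i m \<le> \<zeta>}"

lemma marks_limit:
  assumes "0 < \<epsilon>" and C: "0 \<le> C"
  shows "\<forall>\<^sub>F n in sequentially. \<forall>i. \<forall>t\<in>{0..C}. \<forall>\<zeta>\<in>{0..1}.
           \<bar>real (marks_below n i t \<zeta>) / rs n - lam G i * t * \<zeta>\<bar> \<le> \<epsilon>"
proof (rule eventually_all_finite)
  fix i
  define e where "e = min 1 (\<epsilon> / 2)"
  have e: "0 < e" "e \<le> 1" "e \<le> \<epsilon> / 2" using assms by (auto simp: e_def)
  have "uniform_limit ({0..lam G i * C + 1} \<times> {0..1})
      (\<lambda>n (\<sigma>, \<zeta>). real (card {m \<in> {1..nat \<lfloor>rs n * \<sigma>\<rfloor>}. xi i m \<le> \<zeta>}) / rs n)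
      (\<lambda>(\<sigma>, \<zeta>). \<sigma> * \<zeta>) sequentially"
    using prim unfolding primitives_ok_def by blast
  from uniform_limitD[OF this e(1)] arrivals_limit[OF e(1), of C]
  show "\<forall>\<^sub>F n in sequentially. \<forall>t\<in>{0..C}. \<forall>\<zeta>\<in>{0..1}.
           \<bar>real (marks_below n i t \<zeta>) / rs n - lam G i * t * \<zeta>\<bar> \<le> \<epsilon>"
  proof eventually_elim
    case (elim n)
    show ?case
    proof (intro ballI)
      fix t \<zeta> :: real assume t: "t \<in> {0..C}" and z: "\<zeta> \<in> {0..1}"
      define \<sigma> where "\<sigma> = real (arrivals n i t) / rs n"
      have s: "\<bar>\<sigma> - lam G i * t\<bar> \<le> e" using elim(2) t by (simp add: \<sigma>_def)
      have "lam G i * t \<le> lam G i * C" using t lam_pos[of i] by (auto intro: mult_left_mono)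
      then have "\<sigma> \<in> {0..lam G i * C + 1}" using s e(2) rs_pos[of n] by (auto simp: \<sigma>_def)
      then have "(\<sigma>, \<zeta>) \<in> {0..lam G i * C + 1} \<times> {0..1}" using z by simp
      from bspec[OF elim(1) this]
      have "\<bar>real (card {m \<in> {1..nat \<lfloor>rs n * \<sigma>\<rfloor>}. xi i m \<le> \<zeta>}) / rs n - \<sigma> * \<zeta>\<bar> < e"
        by (simp add: dist_real_def)
      moreover have "nat \<lfloor>rs n * \<sigma>\<rfloor> = arrivals n i t" using rs_nz[of n] by (simp add: \<sigma>_def)
      ultimately have 1: "\<bar>real (marks_below n i t \<zeta>) / rs n - \<sigma> * \<zeta>\<bar> < e" by (simp add: marks_below_def)
      have "\<bar>\<sigma> * \<zeta> - lam G i * t * \<zeta>\<bar> = \<bar>\<sigma> - lam G i * t\<bar> * \<zeta>"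
        using z by (simp add: left_diff_distrib[symmetric] abs_mult)
      also have "\<dots> \<le> e * 1" using s z by (intro mult_mono) auto
      finally show "\<bar>real (marks_below n i t \<zeta>) / rs n - lam G i * t * \<zeta>\<bar> \<le> \<epsilon>"
        using 1 e(3) by linarith
    qed
  qed
qed

subsection \<open>Paths of the finite systems\<close>

lemma arr_cong: "e \<in> edges G \<Longrightarrow> (\<And>k. k \<in> Kbar G \<Longrightarrow> y k = z k) \<Longrightarrow> arr y e = arr z e"
  unfolding arr_def fitmass_def by (cases e) (auto simp: edges_iff del_in_Kbar fitting_Kbar)

lemma dep_cong: "e \<in> edges G \<Longrightarrow> (\<And>k. k \<in> Kbar G \<Longrightarrow> y k = z k) \<Longrightarrow> dep y e = dep z e"
  unfolding dep_def by (cases e) (auto simp: edges_iff)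

context
  fixes n X D A assumes path: "path n X D A"
begin

lemma path_step: "k \<in> Kbar G \<Longrightarrow> step_function (\<lambda>t. X t k)"
  using path unfolding path_def grand_f_path_def step_path_iff by blast

lemma path_servers: assumes "0 \<le> t" shows "server_feasible (scaled n X t)"
proof -
  have "(\<Sum>k\<in>Kbar_of G s. scaled n X t k) = frac G s" for s
  proof -
    have "real (\<Sum>k\<in>Kbar_of G s. X t k) = frac G s * rs n"
      using path assms unfolding path_def grand_f_path_def by blast
    then show ?thesis using rs_nz[of n] unfolding scaled_def sum_divide_distrib[symmetric] by simp
  qed
  then show ?thesis using rs_pos[of n] by (auto simp: server_feasible_def scaled_def)
qed

lemma scaled_bounds: "0 \<le> t \<Longrightarrow> k \<in> Kbar G \<Longrightarrow> 0 \<le> scaled n X t k \<and> scaled n X t k \<le> frac G (snd k)"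
  using path_servers server_feasible_le by (auto simp: server_feasible_def)

lemma scaled_step:
  assumes "\<And>y z. (\<And>k. k \<in> Kbar G \<Longrightarrow> y k = z k) \<Longrightarrow> g y = g z"
  shows "step_function (\<lambda>t. g (scaled n X t))"
proof -
  have "g (scaled n X t) = g (\<lambda>k. real (restrict (X t) (Kbar G) k) / rs n)" for t
    by (rule assms) (simp add: scaled_def)
  then show ?thesis
    using step_function_compose[OF step_function_restrict[OF finite_Kbar path_step],
        where g = "\<lambda>Y. g (\<lambda>k. real (Y k) / rs n)"] by simp
qed

lemma arr_integrable: "e \<in> edges G \<Longrightarrow> 0 \<le> s \<Longrightarrow> (\<lambda>u. arr (scaled n X u) e) integrable_on {s..t}"
  by (intro step_function_integrable scaled_step arr_cong)

lemma dep_integrable: "e \<in> edges G \<Longrightarrow> 0 \<le> s \<Longrightarrow> (\<lambda>u. dep (scaled n X u) e) integrable_on {s..t}"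
  by (intro step_function_integrable scaled_step dep_cong)

lemma path_D:
  assumes "e \<in> edges G" "0 \<le> t"
  shows "D t e = Pd e (rs n * integral {0..t} (\<lambda>u. dep (scaled n X u) e))"
proof -
  obtain k i where e: "e = (k, i)" by (cases e)
  have "D t (k, i) = Pd (k, i) (integral {0..t} (\<lambda>u. real (X u k) * real (fst k i) * mu G i))"
    using path assms unfolding path_def grand_f_path_def e by blast
  also have "(\<lambda>u. real (X u k) * real (fst k i) * mu G i) = (\<lambda>u. rs n * dep (scaled n X u) e)"
    using rs_nz[of n] by (auto simp: dep_def scaled_def e)
  finally show ?thesis by (simp add: e)
qed

lemma path_A: "(k, i) \<in> edges G \<Longrightarrow> 0 \<le> t \<Longrightarrow> A t (k, i) = card {m \<in> {1..arrivals n i t}. placed n X k i m}"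
  using path unfolding path_def grand_f_path_def placed_arrivals_eq by blast

lemma path_balance:
  assumes "k \<in> Kbar G" "0 \<le> t"
  shows "scaled n X t k = scaled n X 0 k + netflow (\<lambda>e. (real (A t e) - real (D t e)) / rs n) k"
proof -
  have "real (X t k) = real (X 0 k)
          + (\<Sum>i | (k, i) \<in> edges G. real (A t (k, i)) - real (D t (k, i)))
          - (\<Sum>i | (add_cust k i, i) \<in> edges G. real (A t (add_cust k i, i)) - real (D t (add_cust k i, i)))"
    using path assms unfolding path_def grand_f_path_def by blast
  then show ?thesis
    unfolding scaled_def netflow_def sum_divide_distrib[symmetric]
    by (simp only: add_divide_distrib diff_divide_distrib)
qed

lemma A_increment:
  assumes "(k, i) \<in> edges G" "0 \<le> s" "s \<le> t"
  shows "real (A t (k, i)) - real (A s (k, i)) = real (card {m \<in> {arrivals n i s<..arrivals n i t}. placed n X k i m})"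
proof -
  have "{m \<in> {1..arrivals n i t}. placed n X k i m} = {m \<in> {1..arrivals n i s}. placed n X k i m}
      \<union> {m \<in> {arrivals n i s<..arrivals n i t}. placed n X k i m}"
    using arrivals_mono[OF assms(2,3), of n i] by auto
  then have "card {m \<in> {1..arrivals n i t}. placed n X k i m} = card {m \<in> {1..arrivals n i s}. placed n X k i m}
      + card {m \<in> {arrivals n i s<..arrivals n i t}. placed n X k i m}"
    by (simp only:) (rule card_Un_disjoint, auto)
  then show ?thesis using path_A[OF assms(1), of t] path_A[OF assms(1), of s] assms by simp
qed

text \<open>The left limit of a step function is the value that it takes shortly before.\<close>

lemma state_before_attained:
  assumes "0 \<le> s" "s < t"
  shows "\<exists>u. s \<le> u \<and> u < t \<and> (\<forall>k\<in>Kbar G. state_before X t k = X u k)"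
proof -
  have "\<forall>\<^sub>F u in at_left t. X u k = state_before X t k" if "k \<in> Kbar G" for k
  proof -
    have "\<exists>y. \<forall>\<^sub>F u in at_left t. X u k = y"
      using path_step[OF that] assms unfolding step_function_def by auto
    then obtain y where y: "\<forall>\<^sub>F u in at_left t. X u k = y" ..
    then have "Lim (at_left t) (\<lambda>u. X u k) = y"
      by (intro tendsto_Lim tendsto_eventually) auto
    with y show ?thesis by (simp add: state_before_def)
  qed
  then have "\<forall>\<^sub>F u in at_left t. \<forall>k\<in>Kbar G. X u k = state_before X t k"
    by (intro eventually_ball_finite) auto
  moreover have "\<forall>\<^sub>F u in at_left t. s < u" using assms eventually_at_left[of s t] by auto
  moreover have "\<forall>\<^sub>F u in at_left t. u < t" by (simp add: eventually_at_filter)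
  ultimately have "\<forall>\<^sub>F u in at_left t. s \<le> u \<and> u < t \<and> (\<forall>k\<in>Kbar G. state_before X t k = X u k)"
    by eventually_elim auto
  from eventually_happens'[OF trivial_limit_at_left_real this] show ?thesis .
qed

text \<open>The type-\<open>i\<close> arrivals on a short interval: the subinterval that assigns an arrival to \<open>k - e\<^sub>i\<close> stays
  \<open>\<eta>\<close>-close to \<open>(a, b]\<close>, so the arrivals so assigned are squeezed between the numbers of marks in two fixed
  intervals. Marks equal to \<open>0\<close> are assigned to the first nonempty subinterval and are counted apart.\<close>

lemma arrivals_block:
  assumes k: "(k, i) \<in> edges G" and st: "0 \<le> s" "s \<le> t"
    and marks: "\<And>\<tau> \<zeta>. \<tau> \<in> {s, t} \<Longrightarrow> \<zeta> \<in> {0..1} \<Longrightarrow> \<bar>real (marks_below n i \<tau> \<zeta>) / rs n - lam G i * \<tau> * \<zeta>\<bar> \<le> \<epsilon>"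
    and room: "\<And>u. u \<in> {s..t} \<Longrightarrow> 0 < fitmass (scaled n X u) i"
    and j: "j < length (listing G i)" "listing G i ! j = del_cust k i"
    and a: "\<And>u. u \<in> {s..t} \<Longrightarrow> \<bar>cum (scaled n X u) i j - a\<bar> \<le> \<eta>"
    and b: "\<And>u. u \<in> {s..t} \<Longrightarrow> \<bar>cum (scaled n X u) i (Suc j) - b\<bar> \<le> \<eta>"
    and ab: "0 \<le> a" "a \<le> b" "b \<le> 1" and \<eta>: "0 \<le> \<eta>"
  shows "\<bar>(real (A t (k, i)) - real (A s (k, i))) / rs n - lam G i * (t - s) * (b - a)\<bar>
      \<le> 2 * \<eta> * lam G i * (t - s) + 6 * \<epsilon>"
proof -
  let ?l = "lam G i * (t - s)" and ?I = "{arrivals n i s<..arrivals n i t}"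
  have l0: "0 \<le> ?l" using lam_pos[of i] st by simp
  define c where "c = (\<lambda>\<zeta>. card {m \<in> ?I. xi i m \<le> \<zeta>})"
  have eps: "0 \<le> \<epsilon>" using order_trans[OF abs_ge_zero marks[of s 0]] by simp
  have c: "\<bar>real (c \<zeta>) / rs n - ?l * \<zeta>\<bar> \<le> 2 * \<epsilon>" if "\<zeta> \<in> {0..1}" for \<zeta>
  proof -
    have "{m \<in> {1..arrivals n i t}. xi i m \<le> \<zeta>} = {m \<in> {1..arrivals n i s}. xi i m \<le> \<zeta>} \<union> {m \<in> ?I. xi i m \<le> \<zeta>}"
      using arrivals_mono[OF st, of n i] by auto
    then have "marks_below n i t \<zeta> = marks_below n i s \<zeta> + c \<zeta>"
      unfolding marks_below_def c_def by (simp only:) (rule card_Un_disjoint, auto)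
    then have "real (c \<zeta>) / rs n - ?l * \<zeta> = (real (marks_below n i t \<zeta>) / rs n - lam G i * t * \<zeta>)
        - (real (marks_below n i s \<zeta>) / rs n - lam G i * s * \<zeta>)"
      by (simp add: add_divide_distrib algebra_simps)
    then show ?thesis using marks[of t \<zeta>] marks[of s \<zeta>] that by simp
  qed
  have assigned: "placed n X k i m \<longleftrightarrow> cum (scaled n X u) i j < xi i m \<and> xi i m \<le> cum (scaled n X u) i (Suc j)"
    if u: "u \<in> {s..t}" "\<forall>k\<in>Kbar G. state_before X (event_time (Pa i) (lam G i * rs n) m) k = X u k" and xi: "0 < xi i m"
    for u m
  proof -
    let ?Y = "state_before X (event_time (Pa i) (lam G i * rs n) m)"
    have eq: "fit_count G ?Y i = fit_count G (X u) i" "selected G ?Y i (xi i m) = selected G (X u) i (xi i m)"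
      using u(2) fitting_Kbar by (auto intro!: selected_cong)
    have sc: "cum (scaled n X u) i l = cum (\<lambda>k. real (X u k)) i l" for l
      unfolding scaled_def by (rule cum_scale[OF rs_nz])
    have "fitmass (scaled n X u) i = real (fit_count G (X u) i) / rs n"
      by (simp add: fit_count_real fitmass_def scaled_def sum_divide_distrib)
    then have room': "1 \<le> fit_count G (X u) i" using room[OF u(1)] rs_pos[of n] by (simp add: zero_less_divide_iff)
    show ?thesis
      using selected_iff[OF room' xi xi_unit(2) j(1)] room' unfolding placed_def Let_def eq j(2) sc by simp
  qed
  have at: "\<exists>u\<in>{s..t}. \<forall>k\<in>Kbar G. state_before X (event_time (Pa i) (lam G i * rs n) m) k = X u k"
    if "m \<in> ?I" for m
  proof -
    have m: "1 \<le> m" using that by auto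
    have "s < event_time (Pa i) (lam G i * rs n) m" "event_time (Pa i) (lam G i * rs n) m \<le> t"
      using arrivals_event(2)[OF m, of s i n] arrivals_event(2)[OF m, of t i n] that st by auto
    then show ?thesis using state_before_attained[OF st(1)] by fastforce
  qed
  let ?M = "{m \<in> ?I. placed n X k i m}"
  have fin: "finite {m \<in> ?I. Q m}" for Q by simp
  have upper: "real (card ?M) / rs n \<le> ?l * (b - a + 2 * \<eta>) + 6 * \<epsilon>"
  proof -
    define a' b' where "a' = max 0 (a - \<eta>)" and "b' = min 1 (b + \<eta>)"
    have ab': "a' \<in> {0..1}" "b' \<in> {0..1}" "a' \<le> b'" using ab \<eta> by (auto simp: a'_def b'_def)
    have "?M \<subseteq> ({m \<in> ?I. xi i m \<le> b'} - {m \<in> ?I. xi i m \<le> a'}) \<union> {m \<in> ?I. xi i m \<le> 0}"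
    proof
      fix m assume m: "m \<in> ?M"
      then obtain u where u: "u \<in> {s..t}" "\<forall>k\<in>Kbar G. state_before X (event_time (Pa i) (lam G i * rs n) m) k = X u k"
        using at by blast
      show "m \<in> ({m \<in> ?I. xi i m \<le> b'} - {m \<in> ?I. xi i m \<le> a'}) \<union> {m \<in> ?I. xi i m \<le> 0}"
      proof (cases "0 < xi i m")
        case True
        then show ?thesis
          using assigned[OF u True] m a[OF u(1)] b[OF u(1)] xi_unit(2)[of i m] by (auto simp: a'_def b'_def)
      qed (use m in auto)
    qed
    then have "card ?M \<le> card (({m \<in> ?I. xi i m \<le> b'} - {m \<in> ?I. xi i m \<le> a'}) \<union> {m \<in> ?I. xi i m \<le> 0})"
      by (intro card_mono) auto
    also have "\<dots> \<le> card ({m \<in> ?I. xi i m \<le> b'} - {m \<in> ?I. xi i m \<le> a'}) + c 0"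
      unfolding c_def by (rule card_Un_le)
    also have "card ({m \<in> ?I. xi i m \<le> b'} - {m \<in> ?I. xi i m \<le> a'}) = c b' - c a'"
      unfolding c_def using ab'(3) by (intro card_Diff_subset) auto
    finally have le: "card ?M \<le> c b' - c a' + c 0" .
    have "c a' \<le> c b'" unfolding c_def using ab'(3) by (intro card_mono fin) auto
    with le have "real (card ?M) \<le> real (c b') - real (c a') + real (c 0)" by linarith
    then have "real (card ?M) / rs n \<le> real (c b') / rs n - real (c a') / rs n + real (c 0) / rs n"
      using rs_pos[of n] by (simp add: field_simps)
    also have "\<dots> \<le> ?l * (b' - a') + 6 * \<epsilon>"
    proof -
      have "real (c 0) / rs n \<le> 2 * \<epsilon>" using order_trans[OF abs_ge_self c[of 0]] by simp
      moreover have "?l * (b' - a') = ?l * b' - ?l * a'" by (rule right_diff_distrib)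
      ultimately show ?thesis using c[OF ab'(1)] c[OF ab'(2)] by linarith
    qed
    also have "?l * (b' - a') \<le> ?l * (b - a + 2 * \<eta>)"
      using l0 by (intro mult_left_mono) (auto simp: a'_def b'_def)
    finally show ?thesis by simp
  qed
  have lower: "?l * (b - a - 2 * \<eta>) - 6 * \<epsilon> \<le> real (card ?M) / rs n"
  proof -
    define a' b' where "a' = min 1 (a + \<eta>)" and "b' = max 0 (b - \<eta>)"
    have ab': "a' \<in> {0..1}" "b' \<in> {0..1}" using ab \<eta> by (auto simp: a'_def b'_def)
    have "{m \<in> ?I. xi i m \<le> b'} - {m \<in> ?I. xi i m \<le> a'} \<subseteq> ?M"
    proof
      fix m assume m: "m \<in> {m \<in> ?I. xi i m \<le> b'} - {m \<in> ?I. xi i m \<le> a'}"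
      then obtain u where u: "u \<in> {s..t}" "\<forall>k\<in>Kbar G. state_before X (event_time (Pa i) (lam G i * rs n) m) k = X u k"
        using at by blast
      have pos: "0 < xi i m" using m ab'(1) by auto
      have "cum (scaled n X u) i j < xi i m" "xi i m \<le> cum (scaled n X u) i (Suc j)"
        using m a[OF u(1)] b[OF u(1)] pos xi_unit(2)[of i m] by (auto simp: a'_def b'_def)
      then show "m \<in> ?M" using assigned[OF u pos] m by auto
    qed
    then have "card ({m \<in> ?I. xi i m \<le> b'} - {m \<in> ?I. xi i m \<le> a'}) \<le> card ?M"
      by (intro card_mono) auto
    moreover have "c b' - c a' \<le> card ({m \<in> ?I. xi i m \<le> b'} - {m \<in> ?I. xi i m \<le> a'})"
      unfolding c_def by (rule diff_card_le_card_Diff) auto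
    ultimately have "real (c b') - real (c a') \<le> real (card ?M)" by linarith
    then have "real (c b') / rs n - real (c a') / rs n \<le> real (card ?M) / rs n"
      unfolding diff_divide_distrib[symmetric] by (rule divide_right_mono) (rule less_imp_le[OF rs_pos])
    moreover have "?l * (b' - a') - 6 * \<epsilon> \<le> real (c b') / rs n - real (c a') / rs n"
      using c[OF ab'(1)] c[OF ab'(2)] eps unfolding right_diff_distrib by linarith
    moreover have "?l * (b - a - 2 * \<eta>) \<le> ?l * (b' - a')"
      using l0 by (intro mult_left_mono) (auto simp: a'_def b'_def)
    ultimately show ?thesis by linarith
  qed
  show ?thesis using upper lower unfolding A_increment[OF k st] by (simp add: abs_le_iff algebra_simps)
qed

end

lemma departures_limit:
  assumes "0 < \<epsilon>"
  shows "\<forall>\<^sub>F n in sequentially. \<forall>e\<in>edges G. \<forall>X D A. path n X D A \<longrightarrow>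
     (\<forall>t\<in>{0..C}. \<bar>real (D t e) / rs n - integral {0..t} (\<lambda>u. dep (scaled n X u) e)\<bar> \<le> \<epsilon>)"
proof (intro eventually_ball_finite finite_edges ballI)
  fix e assume e: "e \<in> edges G"
  define R where "R = real (fst (fst e) (snd e)) * mu G (snd e) * frac G (snd (fst e))"
  have R0: "0 \<le> R" using mu_pos[of "snd e"] frac_pos[of "snd (fst e)"] by (simp add: R_def)
  have "uniform_limit {0..R * C} (\<lambda>n t. real (Pd e (rs n * t)) / rs n) (\<lambda>t. t) sequentially"
    using prim e unfolding primitives_ok_def by blast
  from uniform_limitD[OF this assms]
  show "\<forall>\<^sub>F n in sequentially. \<forall>X D A. path n X D A \<longrightarrow>
     (\<forall>t\<in>{0..C}. \<bar>real (D t e) / rs n - integral {0..t} (\<lambda>u. dep (scaled n X u) e)\<bar> \<le> \<epsilon>)"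
  proof eventually_elim
    case (elim n)
    show ?case
    proof (intro allI impI ballI)
      fix X D A t assume p: "path n X D A" and t: "t \<in> {0..C}"
      have eK: "fst e \<in> Kbar G" using e by (cases e) (simp add: edges_iff)
      have b: "0 \<le> dep (scaled n X u) e \<and> dep (scaled n X u) e \<le> R" if "0 \<le> u" for u
        using scaled_bounds[OF p that eK] mu_pos[of "snd e"] unfolding dep_def R_def
        by (auto intro!: mult_left_mono)
      let ?I = "integral {0..t} (\<lambda>u. dep (scaled n X u) e)"
      have "0 \<le> ?I" using b by (intro integral_nonneg dep_integrable[OF p e]) auto
      moreover have "?I \<le> integral {0..t} (\<lambda>u. R)"
        using b by (intro integral_le dep_integrable[OF p e]) auto
      moreover have "R * t \<le> R * C" using t R0 by (intro mult_left_mono) auto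
      ultimately have "?I \<in> {0..R * C}" using t by (simp add: mult.commute)
      with elim have "dist (real (Pd e (rs n * ?I)) / rs n) ?I < \<epsilon>" by blast
      then show "\<bar>real (D t e) / rs n - ?I\<bar> \<le> \<epsilon>"
        using path_D[OF p e, of t] t by (simp add: dist_real_def)
    qed
  qed
qed

text \<open>A bound, in fluid scale, on the rate of events along any single edge.\<close>

definition rate_bound :: real where
  "rate_bound = (\<Sum>i\<in>UNIV. lam G i) + (\<Sum>e\<in>edges G. real (fst (fst e) (snd e)) * mu G (snd e) * frac G (snd (fst e)))"

lemma lam_le_rate_bound: "lam G i \<le> (\<Sum>i\<in>UNIV. lam G i)"
  by (rule member_le_sum) (auto intro: less_imp_le[OF lam_pos])

lemma rate_bound_ge:
  assumes "e \<in> edges G"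
  shows "lam G (snd e) + real (fst (fst e) (snd e)) * mu G (snd e) * frac G (snd (fst e)) \<le> rate_bound"
  unfolding rate_bound_def using assms
  by (intro add_mono lam_le_rate_bound member_le_sum[where f = "\<lambda>e. real (fst (fst e) (snd e)) * mu G (snd e) * frac G (snd (fst e))"])
     (auto intro!: mult_nonneg_nonneg less_imp_le[OF mu_pos] less_imp_le[OF frac_pos])

lemma rate_bound_nonneg: "0 \<le> rate_bound"
  unfolding rate_bound_def
  by (intro add_nonneg_nonneg sum_nonneg mult_nonneg_nonneg) (auto intro: less_imp_le[OF lam_pos] less_imp_le[OF mu_pos] less_imp_le[OF frac_pos])

text \<open>Paths are asymptotically Lipschitz, because the numbers of events are.\<close>

lemma scaled_oscillation:
  assumes "0 < \<epsilon>"
  shows "\<forall>\<^sub>F n in sequentially. \<forall>X D A. path n X D A \<longrightarrow> (\<forall>s t. 0 \<le> s \<and> s \<le> t \<and> t \<le> C \<longrightarrow>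
     (\<forall>k\<in>Kbar G. \<bar>scaled n X t k - scaled n X s k\<bar> \<le> 2 * real CARD('i) * rate_bound * (t - s) + \<epsilon>))"
proof -
  define e where "e = \<epsilon> / (8 * real CARD('i))"
  have e: "0 < e" using assms by (simp add: e_def)
  show ?thesis
    using arrivals_limit[OF e, of C] departures_limit[OF e, of C]
  proof eventually_elim
    case (elim n)
    show ?case
    proof (intro allI impI ballI)
      fix X D A s t k assume p: "path n X D A" and st: "0 \<le> s \<and> s \<le> t \<and> t \<le> C" and k: "k \<in> Kbar G"
      let ?w = "\<lambda>t e. (real (A t e) - real (D t e)) / rs n"
      have w: "\<bar>?w t ed - ?w s ed\<bar> \<le> rate_bound * (t - s) + 4 * e" if ed: "ed \<in> edges G" for ed
      proof -
        obtain k i where ki: "ed = (k, i)" by (cases ed)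
        let ?R = "real (fst k i) * mu G i * frac G (snd k)"
        have i: "(k, i) \<in> edges G" using ed ki by simp
        have k: "k \<in> Kbar G" using i by (simp add: edges_iff)
        let ?dA = "(real (A t ed) - real (A s ed)) / rs n"
        have "real (card {m \<in> {arrivals n i s<..arrivals n i t}. placed n X k i m}) \<le> real (card {arrivals n i s<..arrivals n i t})"
          by (intro of_nat_mono card_mono) auto
        also have "\<dots> = real (arrivals n i t) - real (arrivals n i s)"
          using arrivals_mono[of s t n i] st by simp
        finally have "?dA \<le> (real (arrivals n i t) - real (arrivals n i s)) / rs n" "0 \<le> ?dA"
          using A_increment[OF p i, of s t] st rs_pos[of n] by (auto simp: ki intro: divide_right_mono)
        moreover have "\<bar>real (arrivals n i t) / rs n - lam G i * t\<bar> \<le> e" "\<bar>real (arrivals n i s) / rs n - lam G i * s\<bar> \<le> e"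
          using elim(1) st by auto
        ultimately have 1: "0 \<le> ?dA" "?dA \<le> lam G i * (t - s) + 2 * e"
          unfolding diff_divide_distrib right_diff_distrib by linarith+
        let ?I = "\<lambda>a b. integral {a..b} (\<lambda>u. dep (scaled n X u) ed)"
        have b: "0 \<le> dep (scaled n X u) ed \<and> dep (scaled n X u) ed \<le> ?R" if "0 \<le> u" for u
          using scaled_bounds[OF p that k] mu_pos[of i] unfolding dep_def ki
          by (auto intro!: mult_left_mono)
        have int: "(\<lambda>u. dep (scaled n X u) ed) integrable_on {a..b}" if "0 \<le> a" for a b
          by (rule dep_integrable[OF p ed that])
        have "?I s t \<le> integral {s..t} (\<lambda>u. ?R)" using b st by (intro integral_le int) auto
        then have "?I s t \<le> ?R * (t - s)" using st by (simp add: ac_simps)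
        moreover have "0 \<le> ?I s t" using b st by (intro integral_nonneg int) auto
        moreover have "?I 0 s + ?I s t = ?I 0 t"
          using st by (intro Henstock_Kurzweil_Integration.integral_combine int) auto
        moreover have "\<bar>real (D t ed) / rs n - ?I 0 t\<bar> \<le> e" "\<bar>real (D s ed) / rs n - ?I 0 s\<bar> \<le> e"
          using elim(2) ed p st by (meson atLeastAtMost_iff order_trans)+
        ultimately have "\<bar>real (D t ed) / rs n - real (D s ed) / rs n\<bar> \<le> ?R * (t - s) + 2 * e"
          by linarith
        moreover have "?w t ed - ?w s ed = ?dA - (real (D t ed) / rs n - real (D s ed) / rs n)"
          by (simp add: diff_divide_distrib)
        ultimately have "\<bar>?w t ed - ?w s ed\<bar> \<le> (lam G i + ?R) * (t - s) + 4 * e"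
          using 1 by (simp add: distrib_right abs_le_iff)
        moreover have "(lam G i + ?R) * (t - s) \<le> rate_bound * (t - s)"
          using rate_bound_ge[OF ed] st by (intro mult_right_mono) (auto simp: ki)
        ultimately show ?thesis by linarith
      qed
      have "scaled n X t k - scaled n X s k = netflow (\<lambda>e. ?w t e - ?w s e) k"
        using path_balance[OF p k, of t] path_balance[OF p k, of s] st unfolding netflow_diff by simp
      also have "\<bar>\<dots>\<bar> \<le> 2 * real CARD('i) * (rate_bound * (t - s) + 4 * e)"
        using rate_bound_nonneg st e by (intro netflow_bound w) auto
      also have "\<dots> = 2 * real CARD('i) * rate_bound * (t - s) + \<epsilon>"
        by (simp add: e_def distrib_left)
      finally show "\<bar>scaled n X t k - scaled n X s k\<bar> \<le> 2 * real CARD('i) * rate_bound * (t - s) + \<epsilon>" .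
    qed
  qed
qed

text \<open>Cut \<open>[0, t]\<close> into \<open>J\<close> intervals. On each of them \<open>arrivals_block\<close> has an error proportional to the
  oscillation of the path there, plus the discrepancy \<open>\<epsilon>\<^sub>1\<close> of the marks. Hence \<open>J\<close> is chosen first, to make
  the oscillation small, and then \<open>\<epsilon>\<^sub>1\<close>, to beat the \<open>J\<close>-fold sum of the discrepancies.\<close>

theorem arrivals_law:
  assumes c: "0 < c" and eps: "0 < \<epsilon>" and C: "0 < C"
  shows "\<forall>\<^sub>F n in sequentially. \<forall>X D A. path n X D A \<longrightarrow> (\<forall>i. \<forall>t\<in>{0..C}.
     (\<forall>u\<in>{0..t}. c \<le> fitmass (scaled n X u) i) \<longrightarrow> (\<forall>k. (k, i) \<in> edges G \<longrightarrow>
       \<bar>real (A t (k, i)) / rs n - integral {0..t} (\<lambda>u. arr (scaled n X u) (k, i))\<bar> \<le> \<epsilon>))"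
proof -
  define M L B where "M = real (card (Kbar G))" and "L = (\<Sum>i\<in>UNIV. lam G i)" and "B = 2 * real CARD('i) * rate_bound"
  have M0: "0 \<le> M" and B0: "0 \<le> B" using rate_bound_nonneg by (auto simp: M_def B_def)
  have L: "lam G i \<le> L" for i by (simp add: L_def lam_le_rate_bound)
  have L0: "0 < L" using L lam_pos less_le_trans by blast
  \<comment> \<open>An oscillation \<open>\<omega>\<close> of the coordinates within the blocks costs at most \<open>Q * \<omega>\<close> up to time \<open>C\<close>.\<close>
  define Q where "Q = 8 * M * L * C / c"
  have Q0: "0 \<le> Q" using M0 L0 C c by (simp add: Q_def)
  define J where "J = nat \<lceil>2 * Q * B * C / \<epsilon>\<rceil> + 1"
  have J1: "0 < real J" by (simp add: J_def)
  have "2 * Q * B * C / \<epsilon> \<le> real J" unfolding J_def by linarith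
  then have J2: "Q * (B * (C / J)) \<le> \<epsilon> / 2" using eps J1 by (simp add: field_simps)
  define e1 where "e1 = \<epsilon> / (2 * (Q + 6 * J))"
  have QJ: "0 < Q + 6 * J" using Q0 J1 by linarith
  then have e1: "0 < e1" using eps by (simp add: e1_def)
  have "(Q + 6 * J) * e1 = \<epsilon> / 2" using less_imp_neq[OF QJ] unfolding e1_def by (simp add: field_simps del: distrib_left_numeral)
  then have e1': "Q * e1 + 6 * J * e1 = \<epsilon> / 2" by (simp add: distrib_right)
  show ?thesis
    using marks_limit[OF e1 less_imp_le[OF C]] scaled_oscillation[OF e1, of C]
  proof eventually_elim
    case (elim n)
    show ?case
    proof (intro allI impI ballI)
      fix X D A i t k assume p: "path n X D A" and t: "t \<in> {0..C}"
        and room: "\<forall>u\<in>{0..t}. c \<le> fitmass (scaled n X u) i" and k: "(k, i) \<in> edges G"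
      obtain j where j: "j < length (listing G i)" "listing G i ! j = del_cust k i"
        "\<And>y. arr y (k, i) = lam G i * (cum y i (Suc j) - cum y i j)"
        using arr_cum[OF k] by blast
      define \<Delta> \<eta> where "\<Delta> = t / J" and "\<eta> = 2 * (M * (B * (C / J) + e1)) / c"
      have D0: "0 \<le> \<Delta>" "\<Delta> \<le> C / J" "J * \<Delta> = t"
        using t J1 by (auto simp: \<Delta>_def divide_right_mono)
      have eta0: "0 \<le> \<eta>" using M0 B0 C J1 e1 c by (simp add: \<eta>_def)
      let ?I = "\<lambda>a b. integral {a..b} (\<lambda>u. arr (scaled n X u) (k, i))"
      have block: "\<bar>(real (A (s + \<Delta>) (k, i)) - real (A s (k, i))) / rs n - ?I s (s + \<Delta>)\<bar> \<le> 4 * \<eta> * L * \<Delta> + 6 * e1"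
        if s: "0 \<le> s" "s + \<Delta> \<le> t" for s
      proof -
        define a b where "a = cum (scaled n X s) i j" and "b = cum (scaled n X s) i (Suc j)"
        have near: "\<bar>cum (scaled n X u) i l - cum (scaled n X s) i l\<bar> \<le> \<eta>"
          if u: "u \<in> {s..s + \<Delta>}" and l: "l \<le> length (listing G i)" for u l
        proof -
          have "\<bar>cum (scaled n X u) i l - cum (scaled n X s) i l\<bar> \<le> 2 * (real (card (Kbar G)) * (B * (C / J) + e1)) / c"
          proof (rule cum_perturbation[OF _ _ c _ _ l])
            fix q assume q: "q \<in> Kbar G"
            show "0 \<le> scaled n X u q" using scaled_bounds[OF p _ q] u s by auto
            have "\<bar>scaled n X u q - scaled n X s q\<bar> \<le> B * (u - s) + e1"
              using elim(2) p q u s t unfolding B_def by fastforce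
            also have "B * (u - s) \<le> B * (C / J)" using u D0 by (intro mult_left_mono B0) auto
            finally show "\<bar>scaled n X u q - scaled n X s q\<bar> \<le> B * (C / J) + e1" by simp
          next
            show "0 < fitmass (scaled n X u) i" "c \<le> fitmass (scaled n X s) i"
              using room u s D0 c by (auto intro: less_le_trans[OF c])
          qed
          then show ?thesis by (simp add: \<eta>_def M_def)
        qed
        have ab: "0 \<le> a" "a \<le> b" "b \<le> 1"
        proof -
          have dK: "del_cust k i \<in> Kbar G" using k by (simp add: edges_iff del_in_Kbar)
          have nn: "\<And>q. q \<in> Kbar G \<Longrightarrow> 0 \<le> scaled n X s q" using scaled_bounds[OF p s(1)] by blast
          show "0 \<le> a" "b \<le> 1" unfolding a_def b_def using cum_bounds[of "scaled n X s" _ i] nn j(1) by auto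
          show "a \<le> b" unfolding a_def b_def cum_Suc j(2) using nn[OF dK]
            by (simp add: fitmass_nonneg[OF path_servers[OF p s(1)]])
        qed
        have 1: "\<bar>(real (A (s + \<Delta>) (k, i)) - real (A s (k, i))) / rs n - lam G i * (s + \<Delta> - s) * (b - a)\<bar>
            \<le> 2 * \<eta> * lam G i * (s + \<Delta> - s) + 6 * e1"
        proof (rule arrivals_block[OF p k s(1) _ _ _ j(1,2) _ _ ab eta0])
          fix \<tau> \<zeta> :: real assume "\<tau> \<in> {s, s + \<Delta>}" "\<zeta> \<in> {0..1}"
          then show "\<bar>real (marks_below n i \<tau> \<zeta>) / rs n - lam G i * \<tau> * \<zeta>\<bar> \<le> e1"
            using elim(1) s t D0 by auto
        next
          fix u assume "u \<in> {s..s + \<Delta>}"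
          then show "0 < fitmass (scaled n X u) i" using room s by (auto intro: less_le_trans[OF c])
        qed (use near j(1) D0 in \<open>auto simp: a_def b_def\<close>)
        have 2: "\<bar>?I s (s + \<Delta>) - integral {s..s + \<Delta>} (\<lambda>u. lam G i * (b - a))\<bar> \<le> 2 * \<eta> * lam G i * (s + \<Delta> - s)"
        proof (rule integral_close)
          fix u assume u: "u \<in> {s..s + \<Delta>}"
          have "arr (scaled n X u) (k, i) - lam G i * (b - a)
              = lam G i * ((cum (scaled n X u) i (Suc j) - b) - (cum (scaled n X u) i j - a))"
            by (simp add: j(3) algebra_simps)
          also have "\<bar>\<dots>\<bar> \<le> lam G i * (2 * \<eta>)"
            unfolding abs_mult using near[OF u, of j] near[OF u, of "Suc j"] j(1) lam_pos[of i]
            by (auto intro!: mult_left_mono simp: a_def b_def)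
          finally show "\<bar>arr (scaled n X u) (k, i) - lam G i * (b - a)\<bar> \<le> 2 * \<eta> * lam G i" by (simp add: mult.commute)
        qed (use arr_integrable[OF p k s(1)] D0 in auto)
        have "\<eta> * lam G i * \<Delta> \<le> \<eta> * L * \<Delta>" using L eta0 D0 by (intro mult_right_mono mult_left_mono) auto
        moreover have "integral {s..s + \<Delta>} (\<lambda>u. lam G i * (b - a)) = lam G i * \<Delta> * (b - a)"
          using D0(1) by simp
        moreover have "s + \<Delta> - s = \<Delta>" by simp
        ultimately show ?thesis using 1 2 by (simp only:)
      qed
      have "\<bar>real (A (real l * \<Delta>) (k, i)) / rs n - ?I 0 (real l * \<Delta>)\<bar> \<le> real l * (4 * \<eta> * L * \<Delta> + 6 * e1)" if "l \<le> J" for l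
        using that
      proof (induction l)
        case 0
        have "arrivals n i 0 = 0"
        proof -
          have "\<not> 1 \<le> arrivals n i 0"
            using arrivals_event(1)[of 1 i n] arrivals_event(2)[of 1 0 i n] by auto
          then show ?thesis by simp
        qed
        then show ?case using path_A[OF p k, of 0] by simp
      next
        case (Suc l)
        have S: "real (Suc l) * \<Delta> = real l * \<Delta> + \<Delta>" by (simp add: distrib_right)
        have le: "real (Suc l) * \<Delta> \<le> t" unfolding D0(3)[symmetric] using Suc.prems D0 by (intro mult_right_mono) auto
        have "\<bar>(real (A (real l * \<Delta> + \<Delta>) (k, i)) - real (A (real l * \<Delta>) (k, i))) / rs n - ?I (real l * \<Delta>) (real l * \<Delta> + \<Delta>)\<bar>
            \<le> 4 * \<eta> * L * \<Delta> + 6 * e1"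
          using le D0(1) unfolding S by (intro block) auto
        moreover have "?I 0 (real l * \<Delta>) + ?I (real l * \<Delta>) (real l * \<Delta> + \<Delta>) = ?I 0 (real l * \<Delta> + \<Delta>)"
          using D0 by (intro Henstock_Kurzweil_Integration.integral_combine arr_integrable[OF p k]) auto
        moreover have "real (Suc l) * (4 * \<eta> * L * \<Delta> + 6 * e1)
            = real l * (4 * \<eta> * L * \<Delta> + 6 * e1) + (4 * \<eta> * L * \<Delta> + 6 * e1)" by (simp add: distrib_right)
        moreover have "\<bar>real (A (real l * \<Delta>) (k, i)) / rs n - ?I 0 (real l * \<Delta>)\<bar> \<le> real l * (4 * \<eta> * L * \<Delta> + 6 * e1)"
          using Suc by simp
        ultimately show ?case unfolding S diff_divide_distrib by linarith
      qed
      note total = this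
      have "\<bar>real (A t (k, i)) / rs n - ?I 0 t\<bar> \<le> 4 * \<eta> * L * t + 6 * J * e1"
      proof -
        have "real J * (4 * \<eta> * L * \<Delta> + 6 * e1) = 4 * \<eta> * L * (real J * \<Delta>) + 6 * J * e1"
          by (simp add: algebra_simps)
        then show ?thesis using total[of J] D0(3) by simp
      qed
      also have "4 * \<eta> * L * t \<le> 4 * \<eta> * L * C" using t eta0 L0 by (intro mult_left_mono) auto
      also have "4 * \<eta> * L * C = Q * (B * (C / J)) + Q * e1"
        using c by (simp add: \<eta>_def Q_def field_simps)
      finally show "\<bar>real (A t (k, i)) / rs n - ?I 0 t\<bar> \<le> \<epsilon>" using J2 e1' by linarith
    qed
  qed
qed

end

section \<open>Fluid sample paths solve the fluid equations\<close>

lemma locally_lipschitz_continuous: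
  assumes "locally_lipschitz f" shows "continuous_on {0..} f"
  unfolding continuous_on_eq_continuous_within
proof
  fix t :: real assume t: "t \<in> {0..}"
  then obtain \<delta> L where d: "\<delta> > 0" "L-lipschitz_on ({0..} \<inter> cball t \<delta>) f"
    using assms unfolding locally_lipschitz_def by auto
  then have "continuous (at t within ({0..} \<inter> cball t \<delta>)) f"
    using lipschitz_on_continuous_on[OF d(2)] t by (auto simp: continuous_on_eq_continuous_within)
  moreover have "at t within ({0..} \<inter> cball t \<delta>) = at t within {0..}"
    by (rule at_within_nhd[of t "ball t \<delta>"]) (use d(1) in auto)
  ultimately show "continuous (at t within {0..}) f" by (simp add: continuous_within)
qed

lemma integral_uniform_limit:
  fixes f :: "nat \<Rightarrow> real \<Rightarrow> real"
  assumes lim: "uniform_limit {0..t} f g sequentially" and "0 \<le> t"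
    and f: "\<And>n. f n integrable_on {0..t}" and g: "g integrable_on {0..t}"
  shows "(\<lambda>n. integral {0..t} (f n)) \<longlonglongrightarrow> integral {0..t} g"
proof (rule LIMSEQ_I)
  fix e :: real assume e: "0 < e"
  then have "0 < e / (t + 1)" using assms(2) by simp
  from uniform_limitD[OF lim this]
  have "\<forall>\<^sub>F n in sequentially. norm (integral {0..t} (f n) - integral {0..t} g) < e"
  proof eventually_elim
    case (elim n)
    have "\<bar>integral {0..t} (f n) - integral {0..t} g\<bar> \<le> e / (t + 1) * (t - 0)"
      using elim by (intro integral_close f g assms(2)) (auto simp: dist_real_def less_imp_le)
    also have "\<dots> < e" using e assms(2) by (simp add: field_simps)
    finally show ?case by simp
  qed
  then show "\<exists>no. \<forall>n\<ge>no. norm (integral {0..t} (f n) - integral {0..t} g) < e"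
    by (simp add: eventually_sequentially)
qed

lemma uniform_limit_finite_sum:
  fixes f :: "'k \<Rightarrow> 'n \<Rightarrow> 'x \<Rightarrow> 'b::real_normed_vector"
  assumes "\<And>k. k \<in> A \<Longrightarrow> uniform_limit S (\<lambda>n x. f k n x) (\<lambda>x. g k x) F"
  shows "uniform_limit S (\<lambda>n x. \<Sum>k\<in>A. f k n x) (\<lambda>x. \<Sum>k\<in>A. g k x) F"
  using assms
proof (induction A rule: infinite_finite_induct)
  case (insert k A)
  then show ?case by (simp add: uniform_limit_add)
qed (simp_all add: uniform_limit_const)

context grand_model
begin

text \<open>The laws of large numbers hold along every sequence of paths, so they pass to the uniform limit. For the
  arrivals this needs \<open>fitmass\<close> to be bounded away from \<open>0\<close> along the paths, which on a compact interval
  follows from its positivity in the limit.\<close>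

theorem fluid_sample_path_equations:
  assumes fsp: "fluid_sample_path G rs x d a" and scal: "scaling_sequence G rs"
  shows "fluid_solution (\<lambda>t. bar G (x t))"
    and "e \<in> edges G \<Longrightarrow> 0 \<le> t \<Longrightarrow> d t e = integral {0..t} (\<lambda>u. dep (bar G (x u)) e)"
    and "(k, i) \<in> edges G \<Longrightarrow> 0 \<le> t \<Longrightarrow> (\<And>u. u \<in> {0..t} \<Longrightarrow> 0 < fitmass (bar G (x u)) i) \<Longrightarrow>
      a t (k, i) = integral {0..t} (\<lambda>u. arr (bar G (x u)) (k, i))"
proof -
  obtain Pd Pa xi \<nu> X D A where prim: "primitives_ok G rs Pd Pa xi" and nu: "strict_mono \<nu>"
    and paths: "\<And>n. grand_f_path G (rs (\<nu> n)) Pd Pa xi (X n) (D n) (A n)"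
    and limX: "\<And>C k. k \<in> K G \<Longrightarrow> uniform_limit {0..C} (\<lambda>n t. real (X n t k) / rs (\<nu> n)) (\<lambda>t. x t k) sequentially"
    and limD: "\<And>C e. e \<in> edges G \<Longrightarrow> uniform_limit {0..C} (\<lambda>n t. real (D n t e) / rs (\<nu> n)) (\<lambda>t. d t e) sequentially"
    and limA: "\<And>C e. e \<in> edges G \<Longrightarrow> uniform_limit {0..C} (\<lambda>n t. real (A n t e) / rs (\<nu> n)) (\<lambda>t. a t e) sequentially"
    using fsp unfolding fluid_sample_path_def by blast
  interpret driven_model G rs Pd Pa xi
    using scal prim by unfold_locales
  have p: "path (\<nu> n) (X n) (D n) (A n)" for n
    using paths by (simp add: path_def)
  define y where "y = (\<lambda>t. bar G (x t))"
  define Y where "Y = (\<lambda>n. scaled (\<nu> n) (X n))"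
  have Y_servers: "server_feasible (Y n t)" if "0 \<le> t" for n t
    unfolding Y_def by (rule path_servers[OF p that])
  have limY: "uniform_limit {0..C} (\<lambda>n t. Y n t k) (\<lambda>t. y t k) sequentially" if k: "k \<in> Kbar G" for C k
  proof (cases "k \<in> K G")
    case True
    then show ?thesis using limX[OF True] by (simp add: Y_def y_def scaled_def bar_K)
  next
    case False
    then have k0: "k = zero_cfg (snd k)" using Kbar_cases[OF k] by blast
    have "uniform_limit {0..C} (\<lambda>n t. \<Sum>k'\<in>K_of G (snd k). Y n t k') (\<lambda>t. \<Sum>k'\<in>K_of G (snd k). x t k') sequentially"
    proof (rule uniform_limit_finite_sum)
      fix k' assume "k' \<in> K_of G (snd k)"
      then show "uniform_limit {0..C} (\<lambda>n t. Y n t k') (\<lambda>t. x t k') sequentially"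
        using limX[of k' C] by (simp add: Y_def scaled_def K_of_iff)
    qed
    then have 1: "uniform_limit {0..C} (\<lambda>n t. frac G (snd k) - (\<Sum>k'\<in>K_of G (snd k). Y n t k'))
        (\<lambda>t. frac G (snd k) - (\<Sum>k'\<in>K_of G (snd k). x t k')) sequentially"
      by (intro uniform_limit_intros)
    have 2: "frac G (snd k) - (\<Sum>k'\<in>K_of G (snd k). Y n t k') = Y n t k" if "t \<in> {0..C}" for n t
    proof -
      have "bar G (Y n t) k = Y n t k"
        using Y_servers[of t n] that by (intro bar_eq_self k) (auto simp: server_feasible_def)
      then show ?thesis using k0 by (metis bar_zero)
    qed
    have 3: "frac G (snd k) - (\<Sum>k'\<in>K_of G (snd k). x t k') = y t k" for t
      unfolding y_def using k0 by (metis bar_zero)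
    show ?thesis by (rule iffD1[OF uniform_limit_cong'[OF 2 3] 1])
  qed
  have ptY: "(\<lambda>n. Y n t k) \<longlonglongrightarrow> y t k" if "k \<in> Kbar G" "0 \<le> t" for k t
    using tendsto_uniform_limitI[OF limY[OF that(1), of t]] that(2) by simp
  have ptD: "(\<lambda>n. real (D n t e) / rs (\<nu> n)) \<longlonglongrightarrow> d t e"
    and ptA: "(\<lambda>n. real (A n t e) / rs (\<nu> n)) \<longlonglongrightarrow> a t e" if "e \<in> edges G" "0 \<le> t" for e t
    using tendsto_uniform_limitI[OF limD[OF that(1), of t]] tendsto_uniform_limitI[OF limA[OF that(1), of t]] that(2)
    by simp_all
  have cont: "continuous_on {0..} (\<lambda>t. y t k)" if k: "k \<in> Kbar G" for k
  proof -
    have "continuous_on {0..} (\<lambda>t. x t k)" if "k \<in> K G" for k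
      using fsp that unfolding fluid_sample_path_def by (blast intro: locally_lipschitz_continuous)
    then show ?thesis
      unfolding y_def bar_def using k
      by (cases "k = zero_cfg (snd k)") (auto intro!: continuous_intros simp: K_of_iff K_iff)
  qed
  have contI: "continuous_on {0..t} (\<lambda>t. y t k)" if "k \<in> Kbar G" for k t
    by (rule continuous_on_subset[OF cont[OF that]]) auto
  have servers: "server_feasible (y t)" if "0 \<le> t" for t
  proof -
    have "0 \<le> y t k" if "k \<in> Kbar G" for k
      using Y_servers[OF \<open>0 \<le> t\<close>] that
      by (intro LIMSEQ_le_const[OF ptY[OF that \<open>0 \<le> t\<close>]]) (auto simp: server_feasible_def)
    then show ?thesis unfolding server_feasible_def y_def by (simp add: sum_bar)
  qed
  have dep_eq: "d t e = integral {0..t} (\<lambda>u. dep (y u) e)" if e: "e \<in> edges G" and t: "0 \<le> t" for e t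
  proof -
    obtain k i where ki: "e = (k, i)" by (cases e)
    have k: "k \<in> Kbar G" "(k, i) \<in> edges G" using e by (auto simp: ki edges_iff)
    have "(\<lambda>n. integral {0..t} (\<lambda>u. dep (Y n u) e)) \<longlonglongrightarrow> integral {0..t} (\<lambda>u. dep (y u) e)"
    proof (rule integral_uniform_limit[OF _ t])
      show "uniform_limit {0..t} (\<lambda>n u. dep (Y n u) e) (\<lambda>u. dep (y u) e) sequentially"
        unfolding dep_def ki fst_conv snd_conv
        by (intro bounded_linear.uniform_limit[OF bounded_linear_mult_right] limY k)
      show "(\<lambda>u. dep (y u) e) integrable_on {0..t}"
        by (intro integrable_continuous_real continuous_on_dep contI e)
      show "(\<lambda>u. dep (Y n u) e) integrable_on {0..t}" for n
        unfolding Y_def by (rule dep_integrable[OF p e]) simp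
    qed
    moreover have "(\<lambda>n. real (D n t e) / rs (\<nu> n) - integral {0..t} (\<lambda>u. dep (Y n u) e)) \<longlonglongrightarrow> 0"
    proof (rule LIMSEQ_I)
      fix r :: real assume r: "0 < r"
      then have "0 < r / 2" by simp
      from eventually_subseq[OF nu departures_limit[OF this, of t]]
      have "\<forall>\<^sub>F n in sequentially. norm (real (D n t e) / rs (\<nu> n) - integral {0..t} (\<lambda>u. dep (Y n u) e) - 0) < r"
      proof eventually_elim
        case (elim n)
        have "\<bar>real (D n t e) / rs (\<nu> n) - integral {0..t} (\<lambda>u. dep (Y n u) e)\<bar> \<le> r / 2"
          unfolding Y_def using t e by (intro elim[rule_format, OF _ p]) auto
        then show ?case using r by simp
      qed
      then show "\<exists>no. \<forall>n\<ge>no. norm (real (D n t e) / rs (\<nu> n) - integral {0..t} (\<lambda>u. dep (Y n u) e) - 0) < r"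
        by (simp add: eventually_sequentially)
    qed
    ultimately have "(\<lambda>n. real (D n t e) / rs (\<nu> n)) \<longlonglongrightarrow> integral {0..t} (\<lambda>u. dep (y u) e)"
      using tendsto_add by fastforce
    then show ?thesis using ptD[OF e t] LIMSEQ_unique by blast
  qed
  have arr_eq: "a t (k, i) = integral {0..t} (\<lambda>u. arr (y u) (k, i))"
    if e: "(k, i) \<in> edges G" and t: "0 \<le> t" and room: "\<And>u. u \<in> {0..t} \<Longrightarrow> 0 < fitmass (y u) i" for t k i
  proof -
    have dK: "del_cust k i \<in> Kbar G" using e by (simp add: edges_iff del_in_Kbar)
    obtain c where c: "0 < c" "\<And>u. u \<in> {0..t} \<Longrightarrow> c \<le> fitmass (y u) i"
      using compact_positive_lower_bound[OF compact_Icc continuous_on_fitmass[OF contI] room] by blast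
    have limf: "uniform_limit {0..t} (\<lambda>n u. fitmass (Y n u) i) (\<lambda>u. fitmass (y u) i) sequentially"
      unfolding fitmass_def by (rule uniform_limit_finite_sum) (intro limY fitting_Kbar)
    have "\<forall>\<^sub>F n in sequentially. \<forall>u\<in>{0..t}. c / 2 \<le> fitmass (Y n u) i"
      using uniform_limitD[OF limf half_gt_zero[OF c(1)]]
    proof eventually_elim
      case (elim n)
      show ?case
      proof
        fix u assume u: "u \<in> {0..t}"
        with elim have "\<bar>fitmass (Y n u) i - fitmass (y u) i\<bar> < c / 2" by (simp add: dist_real_def)
        with c(2)[OF u] show "c / 2 \<le> fitmass (Y n u) i" by linarith
      qed
    qed
    note roomY = this
    have "(\<lambda>n. integral {0..t} (\<lambda>u. arr (Y n u) (k, i))) \<longlonglongrightarrow> integral {0..t} (\<lambda>u. arr (y u) (k, i))"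
    proof (rule integral_uniform_limit[OF _ t])
      have "uniform_limit {0..t} (\<lambda>n u. Y n u (del_cust k i) / fitmass (Y n u) i) (\<lambda>u. y u (del_cust k i) / fitmass (y u) i) sequentially"
      proof (rule uniform_lim_divide[OF limY[OF dK] limf _ _ c(1)])
        show "bounded ((\<lambda>u. y u (del_cust k i)) ` {0..t})"
          by (intro compact_imp_bounded compact_continuous_image contI dK compact_Icc)
        show "c \<le> norm (fitmass (y u) i)" if "u \<in> {0..t}" for u using c(2)[OF that] by simp
      qed
      then show "uniform_limit {0..t} (\<lambda>n u. arr (Y n u) (k, i)) (\<lambda>u. arr (y u) (k, i)) sequentially"
        unfolding arr_def fst_conv snd_conv by (rule bounded_linear.uniform_limit[OF bounded_linear_mult_right])
      show "(\<lambda>u. arr (y u) (k, i)) integrable_on {0..t}"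
        by (intro integrable_continuous_real continuous_on_arr contI e, unfold snd_conv) (assumption | erule room)+
      show "(\<lambda>u. arr (Y n u) (k, i)) integrable_on {0..t}" for n
        unfolding Y_def by (rule arr_integrable[OF p e]) simp
    qed
    moreover have "(\<lambda>n. real (A n t (k, i)) / rs (\<nu> n) - integral {0..t} (\<lambda>u. arr (Y n u) (k, i))) \<longlonglongrightarrow> 0"
    proof (rule LIMSEQ_I)
      fix r :: real assume r: "0 < r"
      have "0 < c / 2" "0 < r / 2" "0 < t + 1" using c r t by auto
      from roomY eventually_subseq[OF nu arrivals_law[OF this]]
      have "\<forall>\<^sub>F n in sequentially. norm (real (A n t (k, i)) / rs (\<nu> n) - integral {0..t} (\<lambda>u. arr (Y n u) (k, i)) - 0) < r"
      proof eventually_elim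
        case (elim n)
        have "\<bar>real (A n t (k, i)) / rs (\<nu> n) - integral {0..t} (\<lambda>u. arr (Y n u) (k, i))\<bar> \<le> r / 2"
          unfolding Y_def using elim(1) t e by (intro elim(2)[rule_format, OF p]) (auto simp: Y_def)
        then show ?case using r by simp
      qed
      then show "\<exists>no. \<forall>n\<ge>no. norm (real (A n t (k, i)) / rs (\<nu> n) - integral {0..t} (\<lambda>u. arr (Y n u) (k, i)) - 0) < r"
        by (simp add: eventually_sequentially)
    qed
    ultimately have "(\<lambda>n. real (A n t (k, i)) / rs (\<nu> n)) \<longlonglongrightarrow> integral {0..t} (\<lambda>u. arr (y u) (k, i))"
      using tendsto_add by fastforce
    then show ?thesis using ptA[OF e t] LIMSEQ_unique by blast
  qed
  have balance: "y t k = y 0 k + netflow (\<lambda>e. a t e - d t e) k" if k: "k \<in> Kbar G" and t: "0 \<le> t" for k t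
  proof -
    have "(\<lambda>n. Y n 0 k + netflow (\<lambda>e. (real (A n t e) - real (D n t e)) / rs (\<nu> n)) k)
        \<longlonglongrightarrow> y 0 k + netflow (\<lambda>e. a t e - d t e) k"
      unfolding netflow_def diff_divide_distrib
      by (intro tendsto_intros ptY ptA ptD k t) auto
    moreover have "(\<lambda>n. Y n 0 k + netflow (\<lambda>e. (real (A n t e) - real (D n t e)) / rs (\<nu> n)) k) = (\<lambda>n. Y n t k)"
      unfolding Y_def using path_balance[OF p k t] by auto
    ultimately show ?thesis using ptY[OF k t] LIMSEQ_unique by simp
  qed
  have "y t k = y 0 k + netflow (\<lambda>e. integral {0..t} (\<lambda>u. arr (y u) e - dep (y u) e)) k"
    if t: "0 \<le> t" and room: "\<forall>u\<in>{0..t}. \<forall>i. 0 < fitmass (y u) i" and k: "k \<in> Kbar G" for t k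
  proof -
    have "integral {0..t} (\<lambda>u. arr (y u) e - dep (y u) e) = a t e - d t e" if e: "e \<in> edges G" for e
    proof -
      obtain k i where ki: "e = (k, i)" by (cases e)
      have "integral {0..t} (\<lambda>u. arr (y u) e - dep (y u) e) = integral {0..t} (\<lambda>u. arr (y u) e) - integral {0..t} (\<lambda>u. dep (y u) e)"
        using room
        by (intro Henstock_Kurzweil_Integration.integral_diff integrable_continuous_real continuous_on_arr continuous_on_dep contI e) auto
      then show ?thesis using arr_eq[of k i t] dep_eq[OF e t] room e t by (simp add: ki)
    qed
    then have "netflow (\<lambda>e. integral {0..t} (\<lambda>u. arr (y u) e - dep (y u) e)) k = netflow (\<lambda>e. a t e - d t e) k"
      unfolding netflow_def by simp
    then show ?thesis using balance[OF k t] by simp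
  qed
  then show "fluid_solution (\<lambda>t. bar G (x t))"
    using cont servers unfolding fluid_solution_def y_def by blast
  show "e \<in> edges G \<Longrightarrow> 0 \<le> t \<Longrightarrow> d t e = integral {0..t} (\<lambda>u. dep (bar G (x u)) e)"
    using dep_eq by (simp add: y_def)
  show "(k, i) \<in> edges G \<Longrightarrow> 0 \<le> t \<Longrightarrow> (\<And>u. u \<in> {0..t} \<Longrightarrow> 0 < fitmass (bar G (x u)) i) \<Longrightarrow>
      a t (k, i) = integral {0..t} (\<lambda>u. arr (bar G (x u)) (k, i))"
    using arr_eq by (simp add: y_def)
qed

end

section \<open>A realization of the primitives\<close>

subsection \<open>Equidistributed marks\<close>

text \<open>The integers from \<open>q\<^sup>2\<close> to \<open>(q + 1)\<^sup>2 - 1\<close> are mapped to the grid of the points \<open>j / (2 q + 1)\<close>,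
  \<open>0 \<le> j \<le> 2 q\<close>, of which \<open>[0, \<zeta>]\<close> contains its proportional share up to one point. About \<open>sqrt N\<close> of these
  blocks meet \<open>{1..N}\<close>, so the discrepancy of the first \<open>N\<close> marks is of the order of \<open>sqrt N\<close>.\<close>

definition grid_mark :: "nat \<Rightarrow> real" where
  "grid_mark m = real (m - (floor_sqrt m)\<^sup>2) / real (2 * floor_sqrt m + 1)"

lemma floor_sqrt_bounds: "(floor_sqrt m)\<^sup>2 \<le> m" "m \<le> (floor_sqrt m)\<^sup>2 + 2 * floor_sqrt m"
proof -
  show "(floor_sqrt m)\<^sup>2 \<le> m" by simp
  have "m < (Suc (floor_sqrt m))\<^sup>2" by (rule Suc_floor_sqrt_power2_gt)
  then show "m \<le> (floor_sqrt m)\<^sup>2 + 2 * floor_sqrt m" by (simp add: power2_eq_square)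
qed

lemma grid_mark_unit: "grid_mark m \<in> {0..1}"
proof -
  have "m - (floor_sqrt m)\<^sup>2 \<le> 2 * floor_sqrt m + 1" using floor_sqrt_bounds[of m] by linarith
  then have "real (m - (floor_sqrt m)\<^sup>2) \<le> real (2 * floor_sqrt m + 1)" by (rule of_nat_mono)
  then show ?thesis unfolding grid_mark_def by (simp add: divide_le_eq_1)
qed

lemma grid_count_squares:
  assumes z: "\<zeta> \<in> {0..1}"
  shows "\<bar>real (card {m\<in>{..<q\<^sup>2}. grid_mark m \<le> \<zeta>}) - real (q\<^sup>2) * \<zeta>\<bar> \<le> real q"
proof (induction q)
  case 0
  then show ?case by simp
next
  case (Suc q)
  let ?L = "2 * q + 1"
  have sq: "(Suc q)\<^sup>2 = q\<^sup>2 + ?L" by (simp add: power2_eq_square)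
  have gm: "grid_mark (q\<^sup>2 + j) = real j / real ?L" if "j < ?L" for j
  proof -
    have "floor_sqrt (q\<^sup>2 + j) = q"
      using that by (intro floor_sqrt_unique) (simp_all add: power2_eq_square)
    then show ?thesis by (simp add: grid_mark_def)
  qed
  have "{m\<in>{..<(Suc q)\<^sup>2}. grid_mark m \<le> \<zeta>} = {m\<in>{..<q\<^sup>2}. grid_mark m \<le> \<zeta>} \<union> (\<lambda>j. q\<^sup>2 + j) ` {j\<in>{..<?L}. real j \<le> \<zeta> * real ?L}"
  proof (intro set_eqI iffI)
    fix m assume m: "m \<in> {m\<in>{..<(Suc q)\<^sup>2}. grid_mark m \<le> \<zeta>}"
    show "m \<in> {m\<in>{..<q\<^sup>2}. grid_mark m \<le> \<zeta>} \<union> (\<lambda>j. q\<^sup>2 + j) ` {j\<in>{..<?L}. real j \<le> \<zeta> * real ?L}"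
    proof (cases "m < q\<^sup>2")
      case False
      then have j: "m = q\<^sup>2 + (m - q\<^sup>2)" "m - q\<^sup>2 < ?L" using m sq by auto
      then have "real (m - q\<^sup>2) \<le> \<zeta> * real ?L"
        using m gm[OF j(2)] by (simp add: divide_le_eq)
      then show ?thesis using j by blast
    qed (use m in auto)
  next
    fix m assume "m \<in> {m\<in>{..<q\<^sup>2}. grid_mark m \<le> \<zeta>} \<union> (\<lambda>j. q\<^sup>2 + j) ` {j\<in>{..<?L}. real j \<le> \<zeta> * real ?L}"
    then show "m \<in> {m\<in>{..<(Suc q)\<^sup>2}. grid_mark m \<le> \<zeta>}"
      using gm sq by (auto simp: divide_le_eq)
  qed
  then have "card {m\<in>{..<(Suc q)\<^sup>2}. grid_mark m \<le> \<zeta>} = card {m\<in>{..<q\<^sup>2}. grid_mark m \<le> \<zeta>}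
      + card ((\<lambda>j. q\<^sup>2 + j) ` {j\<in>{..<?L}. real j \<le> \<zeta> * real ?L})"
    by (simp only:) (rule card_Un_disjoint, auto)
  also have "card ((\<lambda>j. q\<^sup>2 + j) ` {j\<in>{..<?L}. real j \<le> \<zeta> * real ?L}) = card {j\<in>{..<?L}. real j \<le> \<zeta> * real ?L}"
    by (rule card_image) (simp add: inj_on_def)
  also have "{j\<in>{..<?L}. real j \<le> \<zeta> * real ?L} = {..<min ?L (nat \<lfloor>\<zeta> * real ?L\<rfloor> + 1)}"
  proof -
    have "real j \<le> \<zeta> * real ?L \<longleftrightarrow> j < nat \<lfloor>\<zeta> * real ?L\<rfloor> + 1" for j
    proof -
      have "0 \<le> \<zeta> * real ?L" using z by simp
      then show ?thesis by (simp add: le_nat_iff le_floor_iff less_Suc_eq_le)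
    qed
    then have "{j\<in>{..<?L}. real j \<le> \<zeta> * real ?L} = {j. j < ?L \<and> j < nat \<lfloor>\<zeta> * real ?L\<rfloor> + 1}"
      by (simp only: lessThan_iff)
    also have "\<dots> = {..<min ?L (nat \<lfloor>\<zeta> * real ?L\<rfloor> + 1)}"
      unfolding lessThan_def min_less_iff_conj ..
    finally show ?thesis .
  qed
  finally have card: "card {m\<in>{..<(Suc q)\<^sup>2}. grid_mark m \<le> \<zeta>}
      = card {m\<in>{..<q\<^sup>2}. grid_mark m \<le> \<zeta>} + min ?L (nat \<lfloor>\<zeta> * real ?L\<rfloor> + 1)" by simp
  define n where "n = nat \<lfloor>\<zeta> * real ?L\<rfloor>"
  have "0 \<le> \<zeta> * real ?L" using z by simp
  then have "real n \<le> \<zeta> * real ?L" "\<zeta> * real ?L \<le> real n + 1" unfolding n_def by linarith+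
  moreover have "\<zeta> * real ?L \<le> 1 * real ?L" by (rule mult_right_mono) (use z in auto)
  then have "\<zeta> * real ?L \<le> real ?L" by (simp only: mult_1_left)
  ultimately have "\<zeta> * real ?L \<le> real (min ?L (n + 1))" "real (min ?L (n + 1)) \<le> \<zeta> * real ?L + 1"
    by (auto simp only: of_nat_min of_nat_add of_nat_1 min_def split: if_split)
  moreover have "real ((Suc q)\<^sup>2) * \<zeta> = real (q\<^sup>2) * \<zeta> + \<zeta> * real ?L"
    unfolding sq of_nat_add[of "q\<^sup>2"] by (subst distrib_right) (simp only: mult.commute)
  moreover have "real (card {m\<in>{..<(Suc q)\<^sup>2}. grid_mark m \<le> \<zeta>})
      = real (card {m\<in>{..<q\<^sup>2}. grid_mark m \<le> \<zeta>}) + real (min ?L (n + 1))"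
    unfolding card n_def by (rule of_nat_add)
  ultimately show ?case using Suc of_nat_Suc[of q, where 'a = real] by linarith
qed

lemma grid_count:
  assumes z: "\<zeta> \<in> {0..1}"
  shows "\<bar>real (card {m\<in>{1..N}. grid_mark m \<le> \<zeta>}) - real N * \<zeta>\<bar> \<le> 3 * sqrt (real N) + 4"
proof -
  let ?c = "\<lambda>n. card {m\<in>{..<n}. grid_mark m \<le> \<zeta>}"
  define q where "q = floor_sqrt N"
  have q: "q\<^sup>2 \<le> N" "N \<le> q\<^sup>2 + 2 * q" using floor_sqrt_bounds[of N] by (auto simp: q_def)
  have "{m\<in>{..<Suc N}. grid_mark m \<le> \<zeta>} \<subseteq> {m\<in>{..<q\<^sup>2}. grid_mark m \<le> \<zeta>} \<union> {q\<^sup>2..<Suc N}"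
    by auto
  then have "?c (Suc N) \<le> card ({m\<in>{..<q\<^sup>2}. grid_mark m \<le> \<zeta>} \<union> {q\<^sup>2..<Suc N})"
    by (intro card_mono) auto
  also have "\<dots> \<le> ?c (q\<^sup>2) + card {q\<^sup>2..<Suc N}" by (rule card_Un_le)
  finally have up: "?c (Suc N) \<le> ?c (q\<^sup>2) + (2 * q + 1)" using q by simp
  have lo: "?c (q\<^sup>2) \<le> ?c (Suc N)" using q by (intro card_mono) auto
  have "{m\<in>{..<Suc N}. grid_mark m \<le> \<zeta>} \<subseteq> insert 0 {m\<in>{1..N}. grid_mark m \<le> \<zeta>}"
    by (auto simp: Suc_le_eq)
  then have "?c (Suc N) \<le> card (insert 0 {m\<in>{1..N}. grid_mark m \<le> \<zeta>})" by (intro card_mono) auto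
  then have 1: "?c (Suc N) \<le> Suc (card {m\<in>{1..N}. grid_mark m \<le> \<zeta>})" by (simp add: card_insert_if split: if_splits)
  have 2: "card {m\<in>{1..N}. grid_mark m \<le> \<zeta>} \<le> ?c (Suc N)" by (intro card_mono) auto
  have "real (q\<^sup>2) * \<zeta> \<le> real N * \<zeta>" "(real N - real (q\<^sup>2)) * \<zeta> \<le> (2 * real q) * 1"
    using q(1) z of_nat_mono[OF q(2), where 'a = real] of_nat_mono[OF q(1), where 'a = real]
    by (intro mult_right_mono mult_mono; simp)+
  then have "\<bar>real (card {m\<in>{1..N}. grid_mark m \<le> \<zeta>}) - real N * \<zeta>\<bar> \<le> 3 * real q + 4"
    using grid_count_squares[OF z, of q] of_nat_mono[OF up, where 'a = real] of_nat_mono[OF lo, where 'a = real]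
      of_nat_mono[OF 1, where 'a = real] of_nat_mono[OF 2, where 'a = real]
    unfolding left_diff_distrib abs_le_iff of_nat_add of_nat_Suc of_nat_mult by simp
  moreover have "real q \<le> sqrt (real N)"
    using of_nat_mono[OF q(1), where 'a = real] by (intro real_le_rsqrt) simp
  ultimately show ?thesis by linarith
qed

lemma grid_marks_limit:
  assumes rs: "filterlim rs at_top sequentially" "\<And>n. 1 \<le> rs n"
  shows "uniform_limit ({0..C} \<times> {0..1})
     (\<lambda>n (\<sigma>, \<zeta>). real (card {m \<in> {1..nat \<lfloor>rs n * \<sigma>\<rfloor>}. grid_mark m \<le> \<zeta>}) / rs n)
     (\<lambda>(\<sigma>, \<zeta>). \<sigma> * \<zeta>) sequentially"
proof (rule uniform_limitI)
  fix e :: real assume e: "0 < e"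
  let ?B = "3 * sqrt \<bar>C\<bar> + 5"
  have "((\<lambda>n. ?B / sqrt (rs n)) \<longlongrightarrow> 0) sequentially"
    by (intro tendsto_divide_0[OF tendsto_const] filterlim_at_top_imp_at_infinity filterlim_compose[OF sqrt_at_top] rs)
  from order_tendstoD(2)[OF this e]
  show "\<forall>\<^sub>F n in sequentially. \<forall>p\<in>{0..C} \<times> {0..1}.
      dist (case p of (\<sigma>, \<zeta>) \<Rightarrow> real (card {m \<in> {1..nat \<lfloor>rs n * \<sigma>\<rfloor>}. grid_mark m \<le> \<zeta>}) / rs n) (case p of (\<sigma>, \<zeta>) \<Rightarrow> \<sigma> * \<zeta>) < e"
  proof eventually_elim
    case (elim n)
    have "\<bar>real (card {m \<in> {1..nat \<lfloor>rs n * \<sigma>\<rfloor>}. grid_mark m \<le> \<zeta>}) / rs n - \<sigma> * \<zeta>\<bar> < e"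
      if s: "\<sigma> \<in> {0..C}" and z: "\<zeta> \<in> {0..1}" for \<sigma> \<zeta>
    proof -
      have r: "1 \<le> rs n" "0 < rs n" using rs(2)[of n] by auto
      define N where "N = nat \<lfloor>rs n * \<sigma>\<rfloor>"
      have "0 \<le> rs n * \<sigma>" using r s by simp
      then have N: "real N \<le> rs n * \<sigma>" "rs n * \<sigma> \<le> real N + 1" unfolding N_def by linarith+
      have "rs n * \<sigma> \<le> rs n * \<bar>C\<bar>" using r s by (intro mult_left_mono) auto
      then have "sqrt (real N) \<le> sqrt (rs n) * sqrt \<bar>C\<bar>"
        using N(1) by (simp add: real_sqrt_mult[symmetric])
      moreover have "\<bar>real N * \<zeta> - rs n * \<sigma> * \<zeta>\<bar> \<le> 1"
      proof -
        have "\<bar>real N * \<zeta> - rs n * \<sigma> * \<zeta>\<bar> = \<bar>real N - rs n * \<sigma>\<bar> * \<zeta>"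
          using z by (simp add: left_diff_distrib[symmetric] abs_mult)
        also have "\<dots> \<le> 1 * 1" using N z by (intro mult_mono) auto
        finally show ?thesis by simp
      qed
      moreover have "1 \<le> sqrt (rs n)" using r by simp
      ultimately have "\<bar>real (card {m \<in> {1..N}. grid_mark m \<le> \<zeta>}) - rs n * \<sigma> * \<zeta>\<bar> \<le> sqrt (rs n) * ?B"
      proof -
        have "sqrt (rs n) * ?B = 3 * (sqrt (rs n) * sqrt \<bar>C\<bar>) + 5 * sqrt (rs n)" by (simp add: algebra_simps)
        moreover have "\<bar>real (card {m \<in> {1..N}. grid_mark m \<le> \<zeta>}) - rs n * \<sigma> * \<zeta>\<bar>
            \<le> \<bar>real (card {m \<in> {1..N}. grid_mark m \<le> \<zeta>}) - real N * \<zeta>\<bar> + \<bar>real N * \<zeta> - rs n * \<sigma> * \<zeta>\<bar>"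
          by linarith
        ultimately show ?thesis
          using grid_count[OF z, of N] \<open>sqrt (real N) \<le> sqrt (rs n) * sqrt \<bar>C\<bar>\<close>
            \<open>\<bar>real N * \<zeta> - rs n * \<sigma> * \<zeta>\<bar> \<le> 1\<close> \<open>1 \<le> sqrt (rs n)\<close> by linarith
      qed
      moreover have "rs n = sqrt (rs n) * sqrt (rs n)" using r by simp
      moreover have "real (card {m \<in> {1..N}. grid_mark m \<le> \<zeta>}) / rs n - \<sigma> * \<zeta>
          = (real (card {m \<in> {1..N}. grid_mark m \<le> \<zeta>}) - rs n * \<sigma> * \<zeta>) / rs n"
        using r by (simp add: field_simps)
      ultimately have "\<bar>real (card {m \<in> {1..N}. grid_mark m \<le> \<zeta>}) / rs n - \<sigma> * \<zeta>\<bar> \<le> (sqrt (rs n) * ?B) / (sqrt (rs n) * sqrt (rs n))"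
        using r by (simp add: divide_right_mono)
      also have "\<dots> = ?B / sqrt (rs n)" using r by (intro mult_divide_mult_cancel_left) simp
      finally show ?thesis using elim N_def by simp
    qed
    then show ?case by (auto simp: dist_real_def)
  qed
qed

subsection \<open>Counting paths with prescribed jump times\<close>

definition count_path :: "(nat \<Rightarrow> real) \<Rightarrow> real \<Rightarrow> nat" where
  "count_path T t = card {n. T n \<le> t}"

text \<open>With one jump in every interval \<open>(n + 1, n + 2)\<close> the law of large numbers holds with a bounded
  error, and the jumps can still be perturbed freely within these intervals.\<close>

context
  fixes T :: "nat \<Rightarrow> real" assumes T: "\<And>n. real n + 1 < T n" "\<And>n. T n < real n + 2"
begin

lemma jump_times_strict_mono: "strict_mono T"
proof (rule strict_monoI_Suc)
  fix n show "T n < T (Suc n)" using T(2)[of n] T(1)[of "Suc n"] by simp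
qed

lemma count_path_poisson: "poisson_path (count_path T)"
  unfolding poisson_path_def
proof (intro exI conjI)
  show "0 < T 0" using T(1)[of 0] by simp
  show "strict_mono T" by (rule jump_times_strict_mono)
  show "filterlim T at_top sequentially"
    by (rule filterlim_at_top_mono[OF filterlim_real_sequentially])
       (use less_trans[OF less_add_one T(1)] in \<open>auto intro!: always_eventually less_imp_le\<close>)
  show "\<forall>t\<ge>0. count_path T t = card {n. T n \<le> t}" by (simp add: count_path_def)
qed

lemma count_path_close: assumes "0 \<le> t" shows "\<bar>real (count_path T t) - t\<bar> \<le> 2"
proof -
  have sub: "{n. T n \<le> t} \<subseteq> {..<nat \<lfloor>t\<rfloor>}"
  proof
    fix n assume "n \<in> {n. T n \<le> t}"
    then have "real n + 1 \<le> t" using T(1)[of n] by simp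
    then show "n \<in> {..<nat \<lfloor>t\<rfloor>}" by simp linarith
  qed
  then have "count_path T t \<le> nat \<lfloor>t\<rfloor>"
    unfolding count_path_def using card_mono[of "{..<nat \<lfloor>t\<rfloor>}"] by fastforce
  moreover have "{..<nat \<lfloor>t\<rfloor> - 1} \<subseteq> {n. T n \<le> t}"
  proof
    fix n assume "n \<in> {..<nat \<lfloor>t\<rfloor> - 1}"
    then have "real n + 2 \<le> t" using assms by simp linarith
    then show "n \<in> {n. T n \<le> t}" using T(2)[of n] by simp
  qed
  then have "card {..<nat \<lfloor>t\<rfloor> - 1} \<le> count_path T t"
    unfolding count_path_def using finite_subset[OF sub] by (intro card_mono) auto
  ultimately show ?thesis using assms by simp linarith
qed

lemma count_path_limit:
  assumes rs: "filterlim rs at_top sequentially" "\<And>n. 1 \<le> rs n"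
  shows "uniform_limit {0..C} (\<lambda>n t. real (count_path T (rs n * t)) / rs n) (\<lambda>t. t) sequentially"
proof (rule uniform_limitI)
  fix e :: real assume e: "0 < e"
  have "((\<lambda>n. 2 / rs n) \<longlongrightarrow> 0) sequentially"
    by (intro tendsto_divide_0[OF tendsto_const] filterlim_at_top_imp_at_infinity rs)
  from order_tendstoD(2)[OF this e]
  show "\<forall>\<^sub>F n in sequentially. \<forall>t\<in>{0..C}. dist (real (count_path T (rs n * t)) / rs n) t < e"
  proof eventually_elim
    case (elim n)
    show ?case
    proof
      fix t assume t: "t \<in> {0..C}"
      have r: "0 < rs n" using rs(2)[of n] by simp
      then have "\<bar>real (count_path T (rs n * t)) - rs n * t\<bar> \<le> 2" using t by (intro count_path_close) auto
      moreover have "real (count_path T (rs n * t)) / rs n - t = (real (count_path T (rs n * t)) - rs n * t) / rs n"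
        using r by (simp add: field_simps)
      ultimately have "\<bar>real (count_path T (rs n * t)) / rs n - t\<bar> \<le> 2 / rs n"
        using r by (simp add: divide_right_mono)
      then show "dist (real (count_path T (rs n * t)) / rs n) t < e" using elim by (simp add: dist_real_def)
    qed
  qed
qed

end

subsection \<open>A number that is transcendental over a countable field\<close>

text \<open>The subfield generated by \<open>B\<close>, in stages, which makes it visibly countable.\<close>

primrec field_closure_step :: "real set \<Rightarrow> nat \<Rightarrow> real set" where
  "field_closure_step B 0 = insert 0 (insert 1 B)"
| "field_closure_step B (Suc n) = (\<Union>x\<in>field_closure_step B n. \<Union>y\<in>field_closure_step B n. {x, x + y, x - y, x * y, x / y})"

definition field_closure :: "real set \<Rightarrow> real set" where
  "field_closure B = (\<Union>n. field_closure_step B n)"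

lemma countable_field_closure: "countable B \<Longrightarrow> countable (field_closure B)"
proof -
  assume B: "countable B"
  have "countable (field_closure_step B n)" for n
    by (induction n) (simp_all add: B)
  then show ?thesis by (simp add: field_closure_def)
qed

lemma field_closure_base: "x \<in> B \<Longrightarrow> x \<in> field_closure B" "0 \<in> field_closure B" "1 \<in> field_closure B"
  unfolding field_closure_def by (auto intro!: exI[of _ 0])

lemma field_closure_ops:
  assumes "x \<in> field_closure B" "y \<in> field_closure B"
  shows "x + y \<in> field_closure B" "x - y \<in> field_closure B" "x * y \<in> field_closure B" "x / y \<in> field_closure B"
proof -
  obtain m n where mn: "x \<in> field_closure_step B m" "y \<in> field_closure_step B n"
    using assms by (auto simp: field_closure_def)
  have mono: "field_closure_step B m \<subseteq> field_closure_step B n" if "m \<le> n" for m n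
    using that by (rule lift_Suc_mono_le[rotated]) auto
  have "x \<in> field_closure_step B (max m n)" "y \<in> field_closure_step B (max m n)"
    using mn mono[of m "max m n"] mono[of n "max m n"] by auto
  then have "{x + y, x - y, x * y, x / y} \<subseteq> field_closure_step B (Suc (max m n))" by auto
  then show "x + y \<in> field_closure B" "x - y \<in> field_closure B" "x * y \<in> field_closure B" "x / y \<in> field_closure B"
    unfolding field_closure_def by blast+
qed

text \<open>There are only countably many roots of nonzero polynomials over a countable set.\<close>

lemma transcendental_exists:
  assumes "countable F" "a < b"
  shows "\<exists>\<alpha>::real. a < \<alpha> \<and> \<alpha> < b \<and> (\<forall>p. (\<forall>m. coeff p m \<in> F) \<and> poly p \<alpha> = 0 \<longrightarrow> p = 0)"
proof -
  let ?P = "{p :: real poly. \<forall>m. coeff p m \<in> F}"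
  have "?P \<subseteq> Poly ` lists F"
  proof
    fix p assume "p \<in> ?P"
    then have "coeffs p \<in> lists F" by (auto simp: coeffs_def)
    then show "p \<in> Poly ` lists F" by (metis Poly_coeffs imageI)
  qed
  then have "countable ?P" by (rule countable_subset) (intro countable_image countable_lists assms)
  then have "countable (\<Union>p\<in>?P - {0}. {x. poly p x = 0})"
    by (intro countable_UN countable_Diff) (auto intro: countable_finite poly_roots_finite)
  then have "\<not> {a<..<b} \<subseteq> (\<Union>p\<in>?P - {0}. {x. poly p x = 0})"
    using uncountable_open_interval[of a b] assms(2) countable_subset by blast
  then obtain \<alpha> where "\<alpha> \<in> {a<..<b}" "\<alpha> \<notin> (\<Union>p\<in>?P - {0}. {x. poly p x = 0})" by blast
  then show ?thesis by (intro exI[of _ \<alpha>]) auto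
qed

section \<open>Construction of a path of the finite system\<close>

type_synonym ('i, 's) stream = "('i, 's) config \<times> 'i + 'i"

text \<open>\<open>T e j\<close> is the \<open>j\<close>-th jump of the Poisson path that drives the stream \<open>e\<close>: departures along an edge,
  or arrivals of a customer type. Two events at the same time could empty the same server, which would
  make the state negative. All event times are linear combinations of the jump times already used, with
  coefficients in a field \<open>F\<close> that contains the rates; since the jump times involve distinct powers of a
  number \<open>\<alpha>\<close> that is transcendental over \<open>F\<close>, simultaneous events do not occur.\<close>

locale event_system = grand_model G for G :: "('i::finite, 's::finite) grand_system" +
  fixes r \<alpha> :: real and F :: "real set" and xi :: "'i \<Rightarrow> nat \<Rightarrow> real"
    and Y0 :: "('i, 's) config \<Rightarrow> nat" and code :: "('i, 's) stream \<Rightarrow> nat \<Rightarrow> nat"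
  assumes r_pos: "0 < r" and xi_le: "xi i m \<le> 1"
    and alpha: "0 < \<alpha>" "\<alpha> < 1"
    and F_consts: "0 \<in> F" "1 \<in> F"
    and F_ops: "x \<in> F \<Longrightarrow> y \<in> F \<Longrightarrow> x + y \<in> F" "x \<in> F \<Longrightarrow> y \<in> F \<Longrightarrow> x - y \<in> F"
      "x \<in> F \<Longrightarrow> y \<in> F \<Longrightarrow> x * y \<in> F" "x \<in> F \<Longrightarrow> y \<in> F \<Longrightarrow> x / y \<in> F"
    and transcendental: "(\<And>m. coeff p m \<in> F) \<Longrightarrow> poly p \<alpha> = 0 \<Longrightarrow> p = 0"
    and code_inj: "code e j = code e' j' \<Longrightarrow> e = e' \<and> j = j'" and code_pos: "0 < code e j"
    and rates_in_F: "lam G i * r \<in> F" "mu G i \<in> F"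
    and initial: "real (\<Sum>k\<in>Kbar_of G s. Y0 k) = frac G s * r"
begin

definition T :: "('i, 's) stream \<Rightarrow> nat \<Rightarrow> real" where
  "T e j = real j + 1 + \<alpha> ^ code e j"

lemma T_bounds: "real j + 1 < T e j" "T e j < real j + 2"
  using alpha code_pos[of e j] power_less_one_iff[of \<alpha> "code e j"] by (auto simp: T_def)

lemma T_mono: "strict_mono (T e)"
  by (rule jump_times_strict_mono) (rule T_bounds)+

lemma of_nat_in_F: "of_nat n \<in> F"
  by (induction n) (auto intro: F_ops F_consts)

definition streams :: "('i, 's) stream set" where
  "streams = Inl ` edges G \<union> range Inr"

lemma finite_streams: "finite streams"
  by (simp add: streams_def)

fun rate :: "(('i, 's) config \<Rightarrow> nat) \<Rightarrow> ('i, 's) stream \<Rightarrow> real" where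
  "rate Y (Inl e) = real (Y (fst e)) * real (fst (fst e) (snd e)) * mu G (snd e)"
| "rate Y (Inr i) = lam G i * r"

lemma rate_nonneg: "0 \<le> rate Y e"
  using r_pos lam_pos mu_pos by (cases e) (auto simp: less_imp_le)

lemma rate_in_F: "rate Y e \<in> F"
  by (cases e) (auto intro!: F_ops rates_in_F of_nat_in_F)

text \<open>The configurations that an event makes a server leave and enter; an arrival that is blocked moves
  none.\<close>

fun jump :: "(('i, 's) config \<Rightarrow> nat) \<Rightarrow> ('i, 's) stream \<Rightarrow> nat \<Rightarrow> (('i, 's) config \<times> ('i, 's) config) option" where
  "jump Y (Inl e) m = Some (fst e, del_cust (fst e) (snd e))"
| "jump Y (Inr i) m = (if fit_count G Y i \<ge> 1
     then Some (selected G Y i (xi i m), add_cust (selected G Y i (xi i m)) i) else None)"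

definition react :: "(('i, 's) config \<Rightarrow> nat) \<Rightarrow> ('i, 's) stream \<Rightarrow> nat \<Rightarrow> ('i, 's) config \<Rightarrow> nat" where
  "react Y e m = (case jump Y e m of None \<Rightarrow> Y
     | Some (a, b) \<Rightarrow> (\<lambda>k. Y k - (if k = a then 1 else 0) + (if k = b then 1 else 0)))"

definition active :: "(('i, 's) config \<Rightarrow> nat) \<Rightarrow> ('i, 's) stream set" where
  "active Y = {e \<in> streams. 0 < rate Y e}"

lemma active_finite: "finite (active Y)" and active_nonempty: "active Y \<noteq> {}"
proof -
  have "Inr i \<in> active Y" for i using r_pos lam_pos by (simp add: active_def streams_def)
  then show "active Y \<noteq> {}" by blast
qed (simp add: active_def finite_streams)

lemma jump_valid:
  assumes "e \<in> active Y" "jump Y e m = Some (a, b)"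
  shows "a \<in> Kbar G" "b \<in> Kbar G" "snd a = snd b" "a \<noteq> b" "1 \<le> Y a"
proof -
  have "a \<in> Kbar G \<and> b \<in> Kbar G \<and> snd a = snd b \<and> a \<noteq> b \<and> 1 \<le> Y a"
  proof (cases e)
    case (Inl p)
    obtain k i where ki: "p = (k, i)" by (cases p)
    have edge: "(k, i) \<in> edges G" and pos: "0 < rate Y e"
      using assms(1) by (auto simp: active_def streams_def Inl ki)
    have "Y k \<noteq> 0" using pos by (intro notI) (simp add: Inl ki)
    moreover have "fst k i \<noteq> fst (del_cust k i) i" using edge by (simp add: edges_iff fst_del_cust) linarith
    ultimately show ?thesis using assms(2) edge by (auto simp: Inl ki edges_iff del_in_Kbar)
  next
    case (Inr i)
    with assms(2) have fc: "1 \<le> fit_count G Y i" and ab: "a = selected G Y i (xi i m)" "b = add_cust a i"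
      by (auto split: if_splits)
    have "fst (add_cust a i) i \<noteq> fst a i" by (simp add: fst_add_cust)
    then show ?thesis using selected_fits[OF fc xi_le[of i m]] ab by (auto simp: fitting_iff add_in_KbarD)
  qed
  then show "a \<in> Kbar G" "b \<in> Kbar G" "snd a = snd b" "a \<noteq> b" "1 \<le> Y a" by auto
qed

lemma react_real:
  assumes "e \<in> active Y"
  shows "real (react Y e m k) = real (Y k) + (case jump Y e m of None \<Rightarrow> 0
     | Some (a, b) \<Rightarrow> (if k = b then 1 else 0) - (if k = a then 1 else 0))"
  using jump_valid[OF assms, of m] by (auto simp: react_def of_nat_diff split: option.split)

lemma react_servers:
  assumes "e \<in> active Y"
  shows "real (\<Sum>k\<in>Kbar_of G s. react Y e m k) = real (\<Sum>k\<in>Kbar_of G s. Y k)"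
proof (cases "jump Y e m")
  case (Some ab)
  obtain a b where ab: "ab = (a, b)" by (cases ab)
  have "(\<Sum>k\<in>Kbar_of G s. (if k = b then 1 else 0) - (if k = a then 1 else 0 :: real)) = 0"
    using jump_valid[OF assms Some[unfolded ab]] unfolding sum_subtractf
    by (simp add: Kbar_of_iff)
  then show ?thesis unfolding of_nat_sum react_real[OF assms] Some ab by (simp add: sum.distrib)
qed (simp add: react_def)

subsection \<open>The event chain\<close>

definition wait :: "(('i, 's) stream \<Rightarrow> real) \<Rightarrow> (('i, 's) stream \<Rightarrow> nat) \<Rightarrow> (('i, 's) config \<Rightarrow> nat) \<Rightarrow>
    ('i, 's) stream \<Rightarrow> real" where
  "wait c n Y e = (T e (n e) - c e) / rate Y e"

definition next_stream :: "(('i, 's) stream \<Rightarrow> real) \<Rightarrow> (('i, 's) stream \<Rightarrow> nat) \<Rightarrow> (('i, 's) config \<Rightarrow> nat) \<Rightarrow>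
    ('i, 's) stream" where
  "next_stream c n Y = arg_min_on (wait c n Y) (active Y)"

text \<open>The state after \<open>l\<close> events: the time, the internal clock and the number of events of every
  stream, and the configuration counts.\<close>

primrec chain :: "nat \<Rightarrow> real \<times> (('i, 's) stream \<Rightarrow> real) \<times> (('i, 's) stream \<Rightarrow> nat) \<times> (('i, 's) config \<Rightarrow> nat)" where
  "chain 0 = (0, \<lambda>_. 0, \<lambda>_. 0, Y0)"
| "chain (Suc l) = (case chain l of (t, c, n, Y) \<Rightarrow>
     let e = next_stream c n Y; w = wait c n Y e
     in (t + w, \<lambda>e'. c e' + rate Y e' * w, n(e := n e + 1), react Y e (n e + 1)))"

definition time :: "nat \<Rightarrow> real" where "time l = fst (chain l)"
definition clock :: "nat \<Rightarrow> ('i, 's) stream \<Rightarrow> real" where "clock l = fst (snd (chain l))"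
definition count :: "nat \<Rightarrow> ('i, 's) stream \<Rightarrow> nat" where "count l = fst (snd (snd (chain l)))"
definition state :: "nat \<Rightarrow> ('i, 's) config \<Rightarrow> nat" where "state l = snd (snd (snd (chain l)))"
definition event :: "nat \<Rightarrow> ('i, 's) stream" where "event l = next_stream (clock l) (count l) (state l)"
definition gap_time :: "nat \<Rightarrow> real" where "gap_time l = wait (clock l) (count l) (state l) (event l)"

lemma chain_0: "time 0 = 0" "clock 0 e = 0" "count 0 e = 0" "state 0 = Y0"
  by (simp_all add: time_def clock_def count_def state_def)

lemma chain_Suc:
  "time (Suc l) = time l + gap_time l"
  "clock (Suc l) e = clock l e + rate (state l) e * gap_time l"
  "count (Suc l) e = count l e + (if e = event l then 1 else 0)"
  "state (Suc l) = react (state l) (event l) (count l (event l) + 1)"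
  by (simp_all add: time_def clock_def count_def state_def event_def gap_time_def Let_def split: prod.split)

lemma event_active: "event l \<in> active (state l)"
  unfolding event_def next_stream_def by (rule arg_min_if_finite(1)[OF active_finite active_nonempty])

lemma event_stream: "event l \<in> streams" and event_rate: "0 < rate (state l) (event l)"
  using event_active[of l] by (auto simp: active_def)

lemma event_least: "e \<in> active (state l) \<Longrightarrow> gap_time l \<le> wait (clock l) (count l) (state l) e"
  using arg_min_if_finite(2)[OF active_finite active_nonempty, of "state l" "wait (clock l) (count l) (state l)"]
  unfolding gap_time_def event_def next_stream_def by force

text \<open>An event advances each clock by a multiple, with factor in \<open>F\<close>, of the difference between the jump time
  that it uses and the clock of its stream. So the powers of \<open>\<alpha>\<close> reserved for future jumps cannot enter.\<close>

lemma clock_polynomial: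
  "\<exists>p. (\<forall>m. coeff p m \<in> F) \<and> (\<forall>e' j. count l e' \<le> j \<longrightarrow> coeff p (code e' j) = 0) \<and> poly p \<alpha> = clock l e"
proof (induction l arbitrary: e)
  case 0
  show ?case by (rule exI[of _ 0]) (simp add: chain_0 F_consts)
next
  case (Suc l)
  let ?e = "event l" let ?c = "code ?e (count l ?e)" and ?q = "rate (state l) e / rate (state l) ?e"
  obtain p where p: "\<And>m. coeff p m \<in> F" "\<And>e' j. count l e' \<le> j \<Longrightarrow> coeff p (code e' j) = 0" "poly p \<alpha> = clock l e"
    using Suc[of e] by blast
  obtain p' where p': "\<And>m. coeff p' m \<in> F" "\<And>e' j. count l e' \<le> j \<Longrightarrow> coeff p' (code e' j) = 0" "poly p' \<alpha> = clock l ?e"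
    using Suc[of ?e] by blast
  define P where "P = p + smult ?q (monom 1 ?c + [:of_nat (count l ?e) + 1:] - p')"
  have C: "coeff [:of_nat (count l ?e) + 1 :: real:] m \<in> F" for m
    by (cases m) (auto intro: F_ops F_consts of_nat_in_F)
  have "coeff P m \<in> F" for m
    unfolding P_def by (auto intro!: F_ops p(1) p'(1) C rate_in_F F_consts)
  moreover have "coeff P (code e' j) = 0" if "count (Suc l) e' \<le> j" for e' j
  proof -
    have "count l e' \<le> j" "?c \<noteq> code e' j"
      using that code_inj[of ?e "count l ?e" e' j] by (auto simp: chain_Suc split: if_splits)
    moreover have "coeff [:of_nat (count l ?e) + 1 :: real:] (code e' j) = 0"
      using code_pos[of e' j] by (simp add: coeff_pCons split: nat.split)
    ultimately show ?thesis unfolding P_def by (simp add: p(2) p'(2))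
  qed
  moreover have "poly P \<alpha> = clock (Suc l) e"
    using event_rate[of l] unfolding P_def chain_Suc gap_time_def wait_def
    by (simp add: p(3) p'(3) poly_monom T_def add.commute)
  ultimately show ?case by blast
qed

text \<open>A tie would be a polynomial equation for \<open>\<alpha>\<close> over \<open>F\<close> in which the power reserved for the next jump of
  \<open>e\<close> has a nonzero coefficient, namely the rate of the other stream.\<close>

lemma no_ties:
  assumes e: "e \<in> active (state l)" "e \<noteq> event l"
  shows "gap_time l < wait (clock l) (count l) (state l) e"
proof (rule ccontr)
  let ?e = "event l"
  let ?R = "rate (state l) e" and ?R' = "rate (state l) ?e"
  assume "\<not> ?thesis"
  then have tie: "wait (clock l) (count l) (state l) e = wait (clock l) (count l) (state l) ?e"
    using event_least[OF e(1)] by (simp add: gap_time_def)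
  have R: "0 < ?R" "0 < ?R'" using e(1) event_rate[of l] by (auto simp: active_def)
  then have eq: "?R' * (T e (count l e) - clock l e) = ?R * (T ?e (count l ?e) - clock l ?e)"
    using tie by (simp add: wait_def field_simps)
  obtain p where p: "\<And>m. coeff p m \<in> F" "\<And>e' j. count l e' \<le> j \<Longrightarrow> coeff p (code e' j) = 0" "poly p \<alpha> = clock l e"
    using clock_polynomial[of l e] by blast
  obtain p' where p': "\<And>m. coeff p' m \<in> F" "\<And>e' j. count l e' \<le> j \<Longrightarrow> coeff p' (code e' j) = 0" "poly p' \<alpha> = clock l ?e"
    using clock_polynomial[of l ?e] by blast
  let ?c = "code e (count l e)" and ?c' = "code ?e (count l ?e)"
  define P where "P = smult ?R' (monom 1 ?c + [:of_nat (count l e) + 1:] - p) - smult ?R (monom 1 ?c' + [:of_nat (count l ?e) + 1:] - p')"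
  have C: "coeff [:of_nat n + 1 :: real:] m \<in> F" for m n
    by (cases m) (auto intro: F_ops F_consts of_nat_in_F)
  have "poly P \<alpha> = 0"
    using eq unfolding P_def by (simp add: p(3) p'(3) poly_monom T_def add.commute)
  moreover have "coeff P m \<in> F" for m
    unfolding P_def by (auto intro!: F_ops p(1) p'(1) C rate_in_F F_consts)
  ultimately have "P = 0" by (rule transcendental[rotated])
  moreover have "coeff P ?c = ?R'"
  proof -
    have "?c' \<noteq> ?c" using code_inj[of ?e "count l ?e" e "count l e"] e(2) by auto
    moreover have "coeff [:of_nat n + 1 :: real:] ?c = 0" for n
      using code_pos[of e "count l e"] by (simp add: coeff_pCons split: nat.split)
    ultimately show ?thesis unfolding P_def by (simp add: p(2) p'(2))
  qed
  ultimately show False using R by simp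
qed

text \<open>The strict upper bound is where the absence of ties enters: after an event every other stream is still
  short of its next jump.\<close>

lemma clock_between:
  assumes "e \<in> streams"
  shows "0 \<le> clock l e" "j < count l e \<Longrightarrow> T e j \<le> clock l e" "clock l e < T e (count l e)"
proof -
  have "(0 \<le> clock l e \<and> (\<forall>j<count l e. T e j \<le> clock l e) \<and> clock l e < T e (count l e))" if "e \<in> streams" for e
    using that
  proof (induction l arbitrary: e)
    case 0
    then show ?case using T_bounds(1)[of 0 e] by (simp add: chain_0)
  next
    case (Suc l)
    let ?e = "event l"
    have g: "0 < gap_time l"
      using Suc.IH[OF event_stream] event_rate[of l] by (simp add: gap_time_def wait_def)
    have up: "clock l e \<le> clock (Suc l) e" using rate_nonneg[of "state l" e] g by (simp add: chain_Suc)
    show ?case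
    proof (cases "e = ?e")
      case True
      have "clock (Suc l) e = T e (count l e)"
        using event_rate[of l] unfolding chain_Suc gap_time_def wait_def True by simp
      then show ?thesis
        using up Suc.IH[OF Suc.prems] strict_mono_less_eq[OF T_mono, of e _ "count l e"] strict_monoD[OF T_mono, of "count l e" "Suc (count l e)" e] True
        by (auto simp: chain_Suc(3) less_Suc_eq_le)
    next
      case False
      have "clock (Suc l) e < T e (count l e)"
      proof (cases "e \<in> active (state l)")
        case True
        then have R: "0 < rate (state l) e" by (simp add: active_def)
        have "rate (state l) e * gap_time l < rate (state l) e * wait (clock l) (count l) (state l) e"
          by (intro mult_strict_left_mono no_ties True False R)
        then show ?thesis using R by (simp add: chain_Suc wait_def)
      next
        case False
        then have "rate (state l) e = 0" using Suc.prems rate_nonneg[of "state l" e] by (simp add: active_def)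
        then show ?thesis using Suc.IH[OF Suc.prems] by (simp add: chain_Suc)
      qed
      then show ?thesis using up Suc.IH[OF Suc.prems] False by (auto simp: chain_Suc(3))
    qed
  qed
  from this[OF assms] show "0 \<le> clock l e" "j < count l e \<Longrightarrow> T e j \<le> clock l e" "clock l e < T e (count l e)"
    by auto
qed

lemma gap_time_pos: "0 < gap_time l"
  using clock_between(3)[OF event_stream] event_rate[of l] by (simp add: gap_time_def wait_def)

lemma time_less: "time l < time (Suc l)"
  using gap_time_pos by (simp add: chain_Suc)

lemma time_strict_mono: "strict_mono time"
  by (rule strict_monoI_Suc) (rule time_less)

lemma time_nonneg: "0 \<le> time l"
  using strict_mono_less_eq[OF time_strict_mono, of 0 l] by (simp add: chain_0)

lemma arrival_clock: "clock l (Inr i) = lam G i * r * time l"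
  by (induction l) (simp_all add: chain_0 chain_Suc distrib_left)

lemma count_mono: "l \<le> l' \<Longrightarrow> count l e \<le> count l' e"
  by (rule lift_Suc_mono_le[of "\<lambda>l. count l e"]) (auto simp: chain_Suc)

lemma state_servers: "real (\<Sum>k\<in>Kbar_of G s. state l k) = frac G s * r"
proof (induction l)
  case (Suc l)
  then show ?case unfolding chain_Suc react_servers[OF event_active] .
qed (simp only: chain_0 initial)

subsection \<open>No explosion\<close>

fun rate_max :: "('i, 's) stream \<Rightarrow> real" where
  "rate_max (Inl e) = frac G (snd (fst e)) * r * real (fst (fst e) (snd e)) * mu G (snd e)"
| "rate_max (Inr i) = lam G i * r"

lemma rate_le_max: assumes "e \<in> streams" shows "rate (state l) e \<le> rate_max e"
proof (cases e)
  case (Inl p)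
  obtain k i where ki: "p = (k, i)" by (cases p)
  have k: "k \<in> Kbar_of G (snd k)" using assms by (auto simp: streams_def Inl ki edges_iff Kbar_of_iff)
  have "real (state l k) \<le> real (\<Sum>k\<in>Kbar_of G (snd k). state l k)"
    by (intro of_nat_mono member_le_sum k) auto
  then have "real (state l k) \<le> frac G (snd k) * r" using state_servers by simp
  then show ?thesis using mu_pos[of i] by (simp add: Inl ki mult_right_mono)
qed simp

lemma clock_le: assumes "e \<in> streams" shows "clock l e \<le> rate_max e * time l"
proof (induction l)
  case (Suc l)
  have "rate (state l) e * gap_time l \<le> rate_max e * gap_time l"
    by (intro mult_right_mono rate_le_max[OF assms] less_imp_le[OF gap_time_pos])
  with Suc show ?case by (simp add: chain_Suc distrib_left)
qed (simp add: chain_0)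

lemma count_le_clock: assumes "e \<in> streams" shows "real (count l e) \<le> clock l e"
proof (cases "count l e")
  case 0
  then show ?thesis using clock_between(1)[OF assms] by simp
next
  case (Suc j)
  then have "T e j \<le> clock l e" by (intro clock_between(2)[OF assms]) simp
  then show ?thesis using T_bounds(1)[of j e] Suc by simp
qed

lemma sum_count: "(\<Sum>e\<in>streams. count l e) = l"
proof (induction l)
  case (Suc l)
  have "(\<Sum>e\<in>streams. count (Suc l) e) = (\<Sum>e\<in>streams. count l e) + (\<Sum>e\<in>streams. if e = event l then 1 else 0)"
    unfolding chain_Suc sum.distrib ..
  also have "(\<Sum>e\<in>streams. if e = event l then 1 else 0 :: nat) = 1"
    using event_stream finite_streams by simp
  finally show ?case using Suc by simp
qed (simp add: chain_0)

text \<open>The clocks run at bounded rates and a stream has at most as many events as its clock shows, so the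
  number of events up to a given time is bounded.\<close>

lemma time_unbounded: "\<exists>l. \<tau> < time l"
proof -
  let ?R = "\<Sum>e\<in>streams. rate_max e"
  have le: "real l \<le> ?R * time l" for l
  proof -
    have "real l = (\<Sum>e\<in>streams. real (count l e))" using sum_count[of l] by (metis of_nat_sum)
    also have "\<dots> \<le> (\<Sum>e\<in>streams. rate_max e * time l)"
      by (intro sum_mono order_trans[OF count_le_clock clock_le])
    finally show ?thesis by (simp add: sum_distrib_right)
  qed
  have R0: "0 \<le> ?R"
    using order_trans[OF rate_nonneg rate_le_max] by (intro sum_nonneg) blast
  define l where "l = nat \<lceil>?R * \<bar>\<tau>\<bar>\<rceil> + 1"
  have "?R * \<bar>\<tau>\<bar> < real l" unfolding l_def by linarith
  then have "?R * \<bar>\<tau>\<bar> < ?R * time l" using le[of l] by linarith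
  then have "\<bar>\<tau>\<bar> < time l" using R0 by (simp add: mult_less_cancel_left)
  then show ?thesis by (intro exI[of _ l]) simp
qed

text \<open>The number of events up to time \<open>\<tau>\<close>.\<close>

definition idx :: "real \<Rightarrow> nat" where
  "idx \<tau> = (LEAST l. \<tau> < time (Suc l))"

lemma idx_bounds: assumes "0 \<le> \<tau>" shows "time (idx \<tau>) \<le> \<tau>" "\<tau> < time (Suc (idx \<tau>))"
proof -
  obtain l where "\<tau> < time l" using time_unbounded by blast
  then have "\<tau> < time (Suc l)" using time_less[of l] by simp
  then show "\<tau> < time (Suc (idx \<tau>))" unfolding idx_def by (rule LeastI)
  show "time (idx \<tau>) \<le> \<tau>"
  proof (cases "idx \<tau>")
    case (Suc j)
    then have "j < idx \<tau>" by simp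
    then have "\<not> \<tau> < time (Suc j)" unfolding idx_def by (rule not_less_Least)
    then show ?thesis using Suc by simp
  qed (use assms in \<open>simp add: chain_0\<close>)
qed

lemma idx_eq: assumes "time l \<le> \<tau>" "\<tau> < time (Suc l)" shows "idx \<tau> = l"
proof -
  have "0 \<le> \<tau>" using assms(1) time_nonneg[of l] by linarith
  note b = idx_bounds[OF this]
  have "idx \<tau> < Suc l" "l < Suc (idx \<tau>)"
    using b assms strict_mono_less[OF time_strict_mono] by (metis le_less_trans)+
  then show ?thesis by simp
qed

definition X :: "real \<Rightarrow> ('i, 's) config \<Rightarrow> nat" where
  "X \<tau> = state (idx \<tau>)"

lemma X_eq: "time l \<le> \<tau> \<Longrightarrow> \<tau> < time (Suc l) \<Longrightarrow> X \<tau> = state l"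
  by (simp add: X_def idx_eq)

lemma X_left: "\<forall>\<^sub>F u in at_left (time (Suc l)). X u = state l"
  unfolding eventually_at_left[OF time_less] using X_eq[of l] time_less[of l] by (auto intro!: exI[of _ "time l"])

lemma X_step: "step_path (\<lambda>t. X t k)"
  unfolding step_path_def
proof (intro conjI allI impI)
  fix t :: real assume "0 \<le> t"
  note b = idx_bounds[OF this]
  have "\<forall>\<^sub>F u in at_right t. u < time (Suc (idx t))"
    using b(2) eventually_at_right[OF b(2)] by auto
  moreover have "\<forall>\<^sub>F u in at_right t. t < u" by (rule eventually_at_right_less)
  ultimately show "\<forall>\<^sub>F u in at_right t. X u k = X t k"
  proof eventually_elim
    case (elim u)
    then show ?case using X_eq[of "idx t" u] X_eq[of "idx t" t] b by simp
  qed
next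
  fix t :: real assume t: "0 < t"
  note b = idx_bounds[OF less_imp_le[OF t]]
  show "\<exists>y. \<forall>\<^sub>F u in at_left t. X u k = y"
  proof (cases "t = time (idx t)")
    case True
    then obtain l where "idx t = Suc l" using t by (cases "idx t") (auto simp: chain_0)
    then have "\<forall>\<^sub>F u in at_left t. X u k = state l k"
      using X_left[of l] True by (auto elim: eventually_mono)
    then show ?thesis by (rule exI[where x = "state l k"])
  next
    case False
    with b have lt: "time (idx t) < t" by simp
    then have "\<forall>\<^sub>F u in at_left t. X u k = state (idx t) k"
      unfolding eventually_at_left[OF lt] using b X_eq[of "idx t"] by (auto intro!: exI[of _ "time (idx t)"])
    then show ?thesis by (rule exI[where x = "state (idx t) k"])
  qed
qed

subsection \<open>The clocks are the integrated rates\<close>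

lemma rate_integral_piece:
  assumes "time l \<le> \<tau>" "\<tau> \<le> time (Suc l)"
  shows "((\<lambda>u. rate (X u) e) has_integral rate (state l) e * (\<tau> - time l)) {time l..\<tau>}"
proof (rule has_integral_spike_finite[where S = "{\<tau>}" and f = "\<lambda>_. rate (state l) e"])
  show "((\<lambda>_. rate (state l) e) has_integral rate (state l) e * (\<tau> - time l)) {time l..\<tau>}"
    using has_integral_const_real[of "rate (state l) e" "time l" \<tau>] assms(1) by (simp add: mult.commute)
  show "rate (X u) e = rate (state l) e" if "u \<in> {time l..\<tau>} - {\<tau>}" for u
    using that assms X_eq[of l u] by simp
qed simp

lemma rate_integral_upto:
  assumes "time l \<le> \<tau>" "\<tau> \<le> time (Suc l)"
  shows "((\<lambda>u. rate (X u) e) has_integral clock l e + rate (state l) e * (\<tau> - time l)) {0..\<tau>}"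
proof -
  have "((\<lambda>u. rate (X u) e) has_integral clock l e) {0..time l}"
  proof (induction l)
    case 0
    then show ?case by (simp add: chain_0 has_integral_refl)
  next
    case (Suc l)
    show ?case
      using has_integral_combine[OF time_nonneg less_imp_le[OF time_less] Suc rate_integral_piece[OF less_imp_le[OF time_less] order_refl]]
      by (simp add: chain_Suc)
  qed
  then show ?thesis by (rule has_integral_combine[OF time_nonneg assms(1) _ rate_integral_piece[OF assms]])
qed

lemma jumps_upto:
  assumes "e \<in> streams" "time l \<le> \<tau>" "\<tau> < time (Suc l)"
  shows "count_path (T e) (clock l e + rate (state l) e * (\<tau> - time l)) = count l e"
proof -
  let ?v = "clock l e + rate (state l) e * (\<tau> - time l)"
  have "clock l e \<le> ?v" using rate_nonneg assms by simp
  moreover have "?v < T e (count l e)"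
  proof (cases "0 < rate (state l) e")
    case True
    have "rate (state l) e * (\<tau> - time l) < rate (state l) e * gap_time l"
      using assms(3) True by (simp add: chain_Suc)
    also have "\<dots> \<le> rate (state l) e * wait (clock l) (count l) (state l) e"
      using event_least[of e l] True assms(1) by (intro mult_left_mono) (auto simp: active_def)
    finally show ?thesis using True by (simp add: wait_def)
  next
    case False
    then have "rate (state l) e = 0" using rate_nonneg[of "state l" e] by simp
    then show ?thesis using clock_between(3)[OF assms(1)] by simp
  qed
  ultimately have "T e j \<le> ?v \<longleftrightarrow> j < count l e" for j
    using clock_between(2)[OF assms(1), of j l] strict_mono_less_eq[OF T_mono, of e "count l e" j]
    by (meson leI le_less_trans less_le_not_le order_trans)
  then show ?thesis by (simp add: count_path_def)
qed

definition Pa :: "'i \<Rightarrow> real \<Rightarrow> nat" where "Pa i = count_path (T (Inr i))"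
definition Pd :: "('i, 's) config \<times> 'i \<Rightarrow> real \<Rightarrow> nat" where "Pd e = count_path (T (Inl e))"

lemma Pa_count: assumes "time l \<le> \<tau>" "\<tau> < time (Suc l)" shows "Pa i (lam G i * r * \<tau>) = count l (Inr i)"
proof -
  have "lam G i * r * \<tau> = clock l (Inr i) + rate (state l) (Inr i) * (\<tau> - time l)"
    by (simp add: arrival_clock right_diff_distrib)
  then show ?thesis using jumps_upto[OF _ assms, of "Inr i"] by (simp add: Pa_def streams_def)
qed

subsection \<open>Arrivals\<close>

lemma arrival_time:
  assumes "event l = Inr i"
  shows "event_time (Pa i) (lam G i * r) (Suc (count l (Inr i))) = time (Suc l)"
proof -
  let ?t = "event_time (Pa i) (lam G i * r) (Suc (count l (Inr i)))"
  have pp: "poisson_path (Pa i)" unfolding Pa_def by (rule count_path_poisson) (rule T_bounds)+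
  have c: "0 < lam G i * r" using lam_pos r_pos by simp
  have le: "?t \<le> \<tau> \<longleftrightarrow> Suc (count l (Inr i)) \<le> count (idx \<tau>) (Inr i)" if "0 \<le> \<tau>" for \<tau>
    using poisson_event(2)[OF pp c _ that, of "Suc (count l (Inr i))"] Pa_count[OF idx_bounds[OF that]] by simp
  have "idx (time (Suc l)) = Suc l" using time_less by (intro idx_eq) auto
  then have 1: "?t \<le> time (Suc l)"
    using le[OF time_nonneg, of "Suc l"] assms by (simp add: chain_Suc)
  have t0: "0 \<le> ?t" using poisson_event(1)[OF pp c, of "Suc (count l (Inr i))"] by simp
  have "Suc (count l (Inr i)) \<le> count (idx ?t) (Inr i)" using le[OF t0] by simp
  then have "\<not> idx ?t \<le> l" using count_mono[of "idx ?t" l "Inr i"] by auto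
  then have "Suc l \<le> idx ?t" by simp
  then have "time (Suc l) \<le> time (idx ?t)" by (simp only: strict_mono_less_eq[OF time_strict_mono])
  then show ?thesis using 1 idx_bounds(1)[OF t0] by linarith
qed

lemma state_before_event: "state_before X (time (Suc l)) = state l"
proof
  fix k
  have "\<forall>\<^sub>F u in at_left (time (Suc l)). X u k = state l k"
    using X_left[of l] by (auto elim: eventually_mono)
  then show "state_before X (time (Suc l)) k = state l k"
    unfolding state_before_def by (intro tendsto_Lim tendsto_eventually) auto
qed

definition accepted :: "('i, 's) config \<Rightarrow> 'i \<Rightarrow> nat \<Rightarrow> bool" where
  "accepted k i m \<longleftrightarrow> (let Y = state_before X (event_time (Pa i) (lam G i * r) m)
     in fit_count G Y i \<ge> 1 \<and> selected G Y i (xi i m) = del_cust k i)"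

definition arrived :: "nat \<Rightarrow> ('i, 's) config \<times> 'i \<Rightarrow> nat" where
  "arrived l e = card {m \<in> {1..count l (Inr (snd e))}. accepted (fst e) (snd e) m}"

lemma placed_arrivals_arrived:
  assumes "0 \<le> \<tau>" shows "card (placed_arrivals G r Pa xi X k i \<tau>) = arrived (idx \<tau>) (k, i)"
proof -
  have "placed_arrivals G r Pa xi X k i \<tau> = {m \<in> {1..count (idx \<tau>) (Inr i)}. accepted k i m}"
    unfolding placed_arrivals_def Pa_count[OF idx_bounds[OF assms]] accepted_def by auto
  then show ?thesis by (simp add: arrived_def)
qed

lemma arrived_Suc:
  "arrived (Suc l) e = arrived l e + (if event l = Inr (snd e) \<and> accepted (fst e) (snd e) (Suc (count l (Inr (snd e)))) then 1 else 0)"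
proof (cases "event l = Inr (snd e)")
  case True
  let ?n = "count l (Inr (snd e))"
  have "count (Suc l) (Inr (snd e)) = Suc ?n" using True by (simp add: chain_Suc)
  then have "{m \<in> {1..count (Suc l) (Inr (snd e))}. accepted (fst e) (snd e) m}
      = (if accepted (fst e) (snd e) (Suc ?n) then insert (Suc ?n) else id) {m \<in> {1..?n}. accepted (fst e) (snd e) m}"
    by (auto simp: le_Suc_eq)
  then show ?thesis using True by (simp add: arrived_def)
qed (simp add: arrived_def chain_Suc)

lemma netflow_single:
  assumes "(k0, i0) \<in> edges G"
  shows "netflow (\<lambda>e. if e = (k0, i0) then c else 0) k = (if k = k0 then c else 0) - (if k = del_cust k0 i0 then c else 0)"
proof -
  have "(\<Sum>i | (k, i) \<in> edges G. if (k, i) = (k0, i0) then c else 0) = (if k = k0 then c else 0)"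
    using assms by (auto simp: sum.delta' if_distrib cong: if_cong)
  moreover have "(\<Sum>i | (add_cust k i, i) \<in> edges G. if (add_cust k i, i) = (k0, i0) then c else 0)
      = (if k = del_cust k0 i0 then c else 0)"
  proof -
    have "(add_cust k i, i) = (k0, i0) \<longleftrightarrow> k = del_cust k0 i0 \<and> i = i0" for i
      using assms by (auto simp: edges_iff add_del_cust)
    moreover have "(add_cust (del_cust k0 i0) i0, i0) \<in> edges G"
      using assms by (simp add: edges_iff add_del_cust)
    ultimately show ?thesis by (auto simp: sum.delta')
  qed
  ultimately show ?thesis by (simp add: netflow_def)
qed

text \<open>The \<open>m\<close>-th type-\<open>i\<close> arrival, wherever it occurs in the chain, is assigned on the basis of the state just
  before its event, which is \<open>state_before\<close> at its event time; so the placements counted from the path are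
  those made by the chain.\<close>

lemma chain_balance:
  assumes "k \<in> Kbar G"
  shows "real (state l k) = real (Y0 k) + netflow (\<lambda>e. real (arrived l e) - real (count l (Inl e))) k"
proof (induction l)
  case 0
  then show ?case by (simp add: chain_0 arrived_def netflow_def)
next
  case (Suc l)
  define \<Delta> where "\<Delta> = (\<lambda>e. (if event l = Inr (snd e) \<and> accepted (fst e) (snd e) (Suc (count l (Inr (snd e)))) then 1 else 0)
    - (if event l = Inl e then 1 else 0 :: real))"
  let ?j = "jump (state l) (event l) (count l (event l) + 1)"
  have "(case ?j of None \<Rightarrow> 0 | Some (a, b) \<Rightarrow> (if k = b then 1 else 0) - (if k = a then 1 else 0)) = netflow \<Delta> k"
  proof (cases "event l")
    case (Inl e0)
    obtain k0 i0 where e0: "e0 = (k0, i0)" by (cases e0)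
    have edge: "(k0, i0) \<in> edges G" using event_stream[of l] by (auto simp: streams_def Inl e0)
    have "\<Delta> = (\<lambda>e. if e = (k0, i0) then - 1 else 0)" by (auto simp: \<Delta>_def Inl e0)
    then show ?thesis using netflow_single[OF edge, of "- 1" k] by (auto simp: Inl e0)
  next
    case (Inr i)
    let ?m = "Suc (count l (Inr i))" and ?Y = "state l"
    have acc: "accepted k' i ?m \<longleftrightarrow> fit_count G ?Y i \<ge> 1 \<and> selected G ?Y i (xi i ?m) = del_cust k' i" for k'
      unfolding accepted_def arrival_time[OF Inr] state_before_event Let_def ..
    show ?thesis
    proof (cases "fit_count G ?Y i \<ge> 1")
      case True
      define \<kappa> where "\<kappa> = selected G ?Y i (xi i ?m)"
      have fit: "\<kappa> \<in> fitting G i" unfolding \<kappa>_def by (rule selected_fits(1)[OF True xi_le])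
      have edge: "(add_cust \<kappa> i, i) \<in> edges G" using fit by (simp add: add_edge_iff)
      have "\<Delta> e = (if e = (add_cust \<kappa> i, i) then 1 else 0)" if "e \<in> edges G" for e
      proof -
        obtain k' i' where e: "e = (k', i')" by (cases e)
        have "\<kappa> = del_cust k' i \<longleftrightarrow> k' = add_cust \<kappa> i" if "i' = i"
          using \<open>e \<in> edges G\<close> that by (auto simp: e edges_iff add_del_cust)
        then show ?thesis using acc[of k'] True by (auto simp: \<Delta>_def Inr e \<kappa>_def)
      qed
      then have "netflow \<Delta> k = netflow (\<lambda>e. if e = (add_cust \<kappa> i, i) then 1 else 0) k" by (rule netflow_cong)
      also have "\<dots> = (if k = add_cust \<kappa> i then 1 else 0) - (if k = \<kappa> then 1 else 0)"
        using netflow_single[OF edge, of 1 k] by simp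
      finally show ?thesis using True by (simp add: Inr \<kappa>_def)
    next
      case False
      then have "\<Delta> e = 0" for e using acc[of "fst e"] by (auto simp: \<Delta>_def Inr)
      then have "\<Delta> = (\<lambda>e. 0)" by (rule ext)
      then show ?thesis using False by (simp add: Inr netflow_def)
    qed
  qed
  then have "real (state (Suc l) k) = real (state l k) + netflow \<Delta> k"
    unfolding chain_Suc(4) react_real[OF event_active] by simp
  moreover have "netflow (\<lambda>e. real (arrived (Suc l) e) - real (count (Suc l) (Inl e))) k
      = netflow (\<lambda>e. real (arrived l e) - real (count l (Inl e))) k + netflow \<Delta> k"
  proof -
    have "\<Delta> e = (real (arrived (Suc l) e) - real (count (Suc l) (Inl e))) - (real (arrived l e) - real (count l (Inl e)))" for e
      by (simp add: \<Delta>_def arrived_Suc chain_Suc(3))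
    then have "netflow \<Delta> k = netflow (\<lambda>e. (real (arrived (Suc l) e) - real (count (Suc l) (Inl e)))
        - (real (arrived l e) - real (count l (Inl e)))) k" by (intro netflow_cong)
    then show ?thesis unfolding netflow_diff by simp
  qed
  ultimately show ?case using Suc by simp
qed

text \<open>The processes \<open>D\<close> and \<open>A\<close> are what the state process makes of the primitives; what has to be seen is that
  they count the events of the chain, so that the state balances.\<close>

theorem path_exists: "\<exists>X D A. grand_f_path G r Pd Pa xi X D A \<and> X 0 = Y0"
proof -
  define D where "D = (\<lambda>t e. Pd e (integral {0..t} (\<lambda>u. real (X u (fst e)) * real (fst (fst e) (snd e)) * mu G (snd e))))"
  define A where "A = (\<lambda>t e. card (placed_arrivals G r Pa xi X (fst e) (snd e) t))"
  have D: "D t e = count (idx t) (Inl e)" if "e \<in> edges G" "0 \<le> t" for t e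
  proof -
    have "Inl e \<in> streams" using that by (simp add: streams_def)
    note j = jumps_upto[OF this idx_bounds[OF that(2)]]
    have "integral {0..t} (\<lambda>u. rate (X u) (Inl e)) = clock (idx t) (Inl e) + rate (state (idx t)) (Inl e) * (t - time (idx t))"
      using idx_bounds[OF that(2)] by (intro integral_unique rate_integral_upto) auto
    then show ?thesis using j unfolding D_def Pd_def by (simp del: rate.simps(2))
  qed
  have A: "A t e = arrived (idx t) e" if "0 \<le> t" for t e
    unfolding A_def placed_arrivals_arrived[OF that] by simp
  have "real (X t k) = real (X 0 k) + netflow (\<lambda>e. real (A t e) - real (D t e)) k" if "0 \<le> t" "k \<in> Kbar G" for t k
  proof -
    have "idx 0 = 0" using time_less[of 0] by (intro idx_eq) (auto simp: chain_0)
    then have "X 0 = Y0" by (simp add: X_def chain_0)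
    moreover have "netflow (\<lambda>e. real (A t e) - real (D t e)) k
        = netflow (\<lambda>e. real (arrived (idx t) e) - real (count (idx t) (Inl e))) k"
      using that by (intro netflow_cong) (simp add: A D)
    ultimately show ?thesis using chain_balance[OF that(2), of "idx t"] by (simp add: X_def)
  qed
  note balance = this
  have "grand_f_path G r Pd Pa xi X D A"
    unfolding grand_f_path_def
  proof (intro conjI ballI allI impI)
    show "step_path (\<lambda>t. X t k)" for k by (rule X_step)
    show "real (\<Sum>k\<in>Kbar_of G s. X t k) = frac G s * r" for t s
      unfolding X_def by (rule state_servers)
    show "case e of (k, i) \<Rightarrow> D t (k, i) = Pd (k, i) (integral {0..t} (\<lambda>u. real (X u k) * real (fst k i) * mu G i))" for t e
      by (simp add: D_def split: prod.split)
    show "case e of (k, i) \<Rightarrow> A t (k, i) = card (placed_arrivals G r Pa xi X k i t)" for t e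
      by (simp add: A_def split: prod.split)
    show "real (X t k) = real (X 0 k)
          + (\<Sum>i | (k, i) \<in> edges G. real (A t (k, i)) - real (D t (k, i)))
          - (\<Sum>i | (add_cust k i, i) \<in> edges G. real (A t (add_cust k i, i)) - real (D t (add_cust k i, i)))"
      if "0 \<le> t" "k \<in> Kbar G" for t k
      using balance[OF that] unfolding netflow_def by linarith
  qed
  moreover have "idx 0 = 0" using time_less[of 0] by (intro idx_eq) (auto simp: chain_0)
  then have "X 0 = Y0" by (simp add: X_def chain_0)
  ultimately show ?thesis by blast
qed

end

section \<open>The fluid sample path at the optimal point\<close>

text \<open>Gronwall's inequality for bounded integrable functions: weighting with \<open>exp (- 2 L t)\<close>
  makes the integral term at most half of the supremum.\<close>

lemma gronwall_bounded:
  fixes g :: "real \<Rightarrow> real"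
  assumes L: "0 < L" and d: "0 \<le> d" and int: "\<And>t. t \<in> {0..C} \<Longrightarrow> g integrable_on {0..t}"
    and bd: "\<And>t. t \<in> {0..C} \<Longrightarrow> g t \<le> B" and g0: "\<And>t. t \<in> {0..C} \<Longrightarrow> 0 \<le> g t"
    and le: "\<And>t. t \<in> {0..C} \<Longrightarrow> g t \<le> d + L * integral {0..t} g"
    and t: "t \<in> {0..C}"
  shows "g t \<le> 2 * d * exp (2 * L * t)"
proof -
  let ?h = "\<lambda>t. g t * exp (- (2 * L * t))"
  define m where "m = Sup (?h ` {0..C})"
  have C: "0 \<le> C" using t by simp
  have B0: "0 \<le> B" using bd[of 0] g0[of 0] C by simp
  have hB: "?h u \<le> B" if "u \<in> {0..C}" for u
  proof -
    have "?h u \<le> B * 1" using bd[OF that] g0[OF that] B0 L that by (intro mult_mono) auto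
    then show ?thesis by simp
  qed
  then have above: "bdd_above (?h ` {0..C})" by (auto intro!: bdd_aboveI[of _ B])
  have up: "?h u \<le> m" if "u \<in> {0..C}" for u
    unfolding m_def using that by (intro cSup_upper above) auto
  have m0: "0 \<le> m" using up[of 0] g0[of 0] C by simp
  have "?h u \<le> d + m / 2" if u: "u \<in> {0..C}" for u
  proof -
    have "((\<lambda>v. m * exp (2 * L * v)) has_integral m / (2 * L) * exp (2 * L * u) - m / (2 * L) * exp (2 * L * 0)) {0..u}"
      using u L by (intro fundamental_theorem_of_calculus)
        (auto intro!: derivative_eq_intros simp: has_real_derivative_iff_has_vector_derivative[symmetric])
    moreover have "g v \<le> m * exp (2 * L * v)" if "v \<in> {0..u}" for v
      using up[of v] that u by (simp add: exp_minus field_simps)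
    ultimately have "integral {0..u} g \<le> m / (2 * L) * exp (2 * L * u) - m / (2 * L) * exp (2 * L * 0)"
      using int[OF u] by (intro has_integral_le[OF integrable_integral]) auto
    also have "\<dots> \<le> m / (2 * L) * exp (2 * L * u)" using m0 L by simp
    finally have "L * integral {0..u} g \<le> L * (m / (2 * L) * exp (2 * L * u))" using L by (intro mult_left_mono) auto
    also have "\<dots> = m / 2 * exp (2 * L * u)" using L by simp
    finally have "g u \<le> d + m / 2 * exp (2 * L * u)" using le[OF u] by linarith
    then have "?h u \<le> (d + m / 2 * exp (2 * L * u)) * exp (- (2 * L * u))" by (intro mult_right_mono) auto
    also have "\<dots> = d * exp (- (2 * L * u)) + m / 2" by (simp add: distrib_right exp_add[symmetric])
    also have "d * exp (- (2 * L * u)) \<le> d * 1" using d L u by (intro mult_left_mono) auto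
    finally show ?thesis by simp
  qed
  then have "m \<le> d + m / 2" unfolding m_def[symmetric] using C by (subst m_def) (intro cSup_least, auto)
  then have "g t * exp (- (2 * L * t)) \<le> 2 * d" using up[OF t] by linarith
  then show ?thesis by (simp add: exp_minus field_simps)
qed

lemma uniform_limit_leI:
  fixes f :: "nat \<Rightarrow> 'x \<Rightarrow> real"
  assumes "\<And>\<epsilon>. 0 < \<epsilon> \<Longrightarrow> \<forall>\<^sub>F n in sequentially. \<forall>t\<in>S. \<bar>f n t - l t\<bar> \<le> \<epsilon>"
  shows "uniform_limit S f l sequentially"
proof (rule uniform_limitI)
  fix \<epsilon> :: real assume "0 < \<epsilon>"
  then have "\<forall>\<^sub>F n in sequentially. \<forall>t\<in>S. \<bar>f n t - l t\<bar> \<le> \<epsilon> / 2" by (intro assms) simp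
  then show "\<forall>\<^sub>F n in sequentially. \<forall>t\<in>S. dist (f n t) (l t) < \<epsilon>"
    by eventually_elim (use \<open>0 < \<epsilon>\<close> in \<open>force simp: dist_real_def\<close>)
qed

lemma locally_lipschitz_linear: "locally_lipschitz (\<lambda>t. t * c)"
proof -
  have "\<bar>c\<bar>-lipschitz_on S (\<lambda>t. t * c)" for S
    by (rule lipschitz_onI) (simp_all add: dist_real_def left_diff_distrib[symmetric] abs_mult mult.commute)
  then show ?thesis unfolding locally_lipschitz_def by (intro allI impI exI[of _ 1]) auto
qed

lemma locally_lipschitz_const: "locally_lipschitz (\<lambda>t. c)"
  unfolding locally_lipschitz_def by (intro allI impI exI[of _ 1] conjI exI[of _ 0]) (auto intro: lipschitz_onI)

locale driven_slack_model = slack_model G + driven_model G rs Pd Pa xi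
  for G :: "('i::finite, 's::finite) grand_system" and rs Pd Pa xi
begin

definition deviation :: "(('i, 's) config \<Rightarrow> real) \<Rightarrow> real" where
  "deviation z = (\<Sum>k\<in>Kbar G. \<bar>z k - ystar k\<bar>)"

lemma deviation_nonneg: "0 \<le> deviation z"
  by (simp add: deviation_def sum_nonneg)

lemma deviation_coord: "k \<in> Kbar G \<Longrightarrow> \<bar>z k - ystar k\<bar> \<le> deviation z"
  unfolding deviation_def by (rule member_le_sum) auto

lemma deviation_fitmass: "\<bar>fitmass z i - fitmass ystar i\<bar> \<le> deviation z"
proof -
  have "\<bar>fitmass z i - fitmass ystar i\<bar> \<le> (\<Sum>k\<in>fitting G i. \<bar>z k - ystar k\<bar>)"
    unfolding fitmass_def sum_subtractf[symmetric] by (rule sum_abs)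
  also have "\<dots> \<le> deviation z" unfolding deviation_def by (intro sum_mono2) (auto intro: fitting_Kbar)
  finally show ?thesis .
qed

text \<open>A Lipschitz constant for the rates where \<open>fitmass\<close> is at least \<open>c\<close>, with respect to \<open>deviation\<close>.\<close>

definition rate_slope :: "real \<Rightarrow> real" where
  "rate_slope c = (\<Sum>e\<in>edges G. 2 * lam G (snd e) / c + real (fst (fst e) (snd e)) * mu G (snd e)) + 1"

lemma rate_slope_pos: "0 < c \<Longrightarrow> 0 < rate_slope c"
  unfolding rate_slope_def
  by (intro add_nonneg_pos sum_nonneg add_nonneg_nonneg divide_nonneg_nonneg mult_nonneg_nonneg)
     (auto intro: less_imp_le[OF lam_pos] less_imp_le[OF mu_pos])

lemma rates_lipschitz:
  assumes e: "e \<in> edges G" and z: "server_feasible z" and c: "0 < c" "c \<le> fitmass z (snd e)" "c \<le> fitmass ystar (snd e)"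
  shows "\<bar>arr z e - arr ystar e\<bar> + \<bar>dep z e - dep ystar e\<bar> \<le> rate_slope c * deviation z"
proof -
  obtain k i where ki: "e = (k, i)" by (cases e)
  have K: "k \<in> Kbar G" "del_cust k i \<in> Kbar G" "del_cust k i \<in> fitting G i"
    using e del_fitting by (auto simp: ki edges_iff del_in_Kbar)
  have z0: "0 \<le> z q" if "q \<in> Kbar G" for q using z that by (simp add: server_feasible_def)
  have "\<bar>z (del_cust k i) / fitmass z i - ystar (del_cust k i) / fitmass ystar i\<bar> \<le> 2 * deviation z / c"
  proof (rule ratio_perturbation)
    show "z (del_cust k i) \<le> fitmass z i"
      unfolding fitmass_def using z0 by (intro member_le_sum K) (auto intro: fitting_Kbar)
    show "\<bar>z (del_cust k i) - ystar (del_cust k i)\<bar> \<le> deviation z" by (rule deviation_coord[OF K(2)])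
    show "\<bar>fitmass z i - fitmass ystar i\<bar> \<le> deviation z" by (rule deviation_fitmass)
  qed (use c z0 K in \<open>auto simp: ki\<close>)
  then have "lam G i * \<bar>z (del_cust k i) / fitmass z i - ystar (del_cust k i) / fitmass ystar i\<bar> \<le> lam G i * (2 * deviation z / c)"
    by (intro mult_left_mono less_imp_le[OF lam_pos])
  then have 1: "\<bar>arr z e - arr ystar e\<bar> \<le> 2 * lam G i / c * deviation z"
  proof -
    have "\<bar>arr z e - arr ystar e\<bar> = lam G i * \<bar>z (del_cust k i) / fitmass z i - ystar (del_cust k i) / fitmass ystar i\<bar>"
      using lam_pos[of i] unfolding arr_def ki fst_conv snd_conv right_diff_distrib[symmetric] abs_mult by simp
    moreover have "lam G i * (2 * deviation z / c) = 2 * lam G i / c * deviation z" by simp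
    ultimately show ?thesis
      using \<open>lam G i * \<bar>z (del_cust k i) / fitmass z i - ystar (del_cust k i) / fitmass ystar i\<bar> \<le> lam G i * (2 * deviation z / c)\<close>
      by linarith
  qed
  have "\<bar>dep z e - dep ystar e\<bar> = real (fst k i) * mu G i * \<bar>z k - ystar k\<bar>"
    using mu_pos[of i] unfolding dep_def ki fst_conv snd_conv right_diff_distrib[symmetric] abs_mult by simp
  also have "\<dots> \<le> real (fst k i) * mu G i * deviation z"
    using mu_pos[of i] by (intro mult_left_mono deviation_coord K) auto
  finally have "\<bar>arr z e - arr ystar e\<bar> + \<bar>dep z e - dep ystar e\<bar> \<le> (2 * lam G i / c + real (fst k i) * mu G i) * deviation z"
    using 1 by (simp add: distrib_right)
  also have "\<dots> \<le> rate_slope c * deviation z"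
  proof (intro mult_right_mono deviation_nonneg)
    have "(2 * lam G (snd e) / c + real (fst (fst e) (snd e)) * mu G (snd e))
        \<le> (\<Sum>e\<in>edges G. 2 * lam G (snd e) / c + real (fst (fst e) (snd e)) * mu G (snd e))"
      using c by (intro member_le_sum[OF e] finite_edges add_nonneg_nonneg divide_nonneg_nonneg mult_nonneg_nonneg)
        (auto intro: less_imp_le[OF lam_pos] less_imp_le[OF mu_pos])
    then show "2 * lam G i / c + real (fst k i) * mu G i \<le> rate_slope c" by (simp add: rate_slope_def ki)
  qed
  finally show ?thesis .
qed

lemma fitmass_ystar_lower: obtains c where "0 < c" "\<And>i. 2 * c \<le> fitmass ystar i"
proof
  let ?c = "Min (range (fitmass ystar)) / 2"
  show "0 < ?c" using positive_fitmass[OF ystar_positive] by simp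
  show "2 * ?c \<le> fitmass ystar i" for i by simp
qed

text \<open>As long as there is room for all customer types, the path satisfies the fluid equations up to a small
  error and Gronwall's inequality bounds its deviation from the rest point \<open>ystar\<close>. Conversely, a small
  deviation leaves room for a further time \<open>h\<close>, since the path is almost Lipschitz; so the two statements
  propagate each other in steps of length \<open>h\<close>.\<close>

lemma deviation_limit:
  assumes paths: "\<And>n. path n (X n) (D n) (A n)"
    and init: "\<And>k. k \<in> Kbar G \<Longrightarrow> (\<lambda>n. scaled n (X n) 0 k) \<longlonglongrightarrow> ystar k"
    and c: "0 < c" "\<And>i. 2 * c \<le> fitmass ystar i" and C: "0 < C" and eps: "0 < \<epsilon>"
  shows "\<forall>\<^sub>F n in sequentially. \<forall>t\<in>{0..C}. deviation (scaled n (X n) t) \<le> \<epsilon> \<and> (\<forall>i. c \<le> fitmass (scaled n (X n) t) i)"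
proof -
  define M I \<Lambda> where "M = real (card (Kbar G))" and "I = 2 * real CARD('i)" and "\<Lambda> = rate_slope c"
  have Mpos: "1 \<le> M"
    using zero_in_Kbar card_gt_0_iff[of "Kbar G"] unfolding M_def by (metis One_nat_def Suc_leI empty_iff finite_Kbar of_nat_1 of_nat_mono)
  have Ipos: "0 < I" by (simp add: I_def)
  have Lpos: "0 < \<Lambda>" unfolding \<Lambda>_def by (rule rate_slope_pos[OF c(1)])
  define L where "L = M * I * \<Lambda>"
  have L: "0 < L" using Mpos Ipos Lpos by (simp add: L_def)
  define B where "B = I * rate_bound"
  have B: "0 \<le> B" using Ipos rate_bound_nonneg by (simp add: B_def)
  \<comment> \<open>Gronwall's inequality magnifies the initial error and those of the laws of large numbers by at most \<open>Q\<close>.\<close>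
  define Q where "Q = 2 * (1 + 2 * M * I) * exp (2 * L * C)"
  have Q: "2 \<le> Q"
  proof -
    have "1 * 1 \<le> (1 + 2 * M * I) * exp (2 * L * C)" using Mpos Ipos L C by (intro mult_mono) auto
    then have "2 * (1 * 1) \<le> 2 * ((1 + 2 * M * I) * exp (2 * L * C))" by (rule mult_left_mono) simp
    then show ?thesis by (simp only: Q_def mult.assoc mult_1_right)
  qed
  define e1 where "e1 = min \<epsilon> (c / 4) / Q"
  have e1: "0 < e1" using eps c Q by (simp add: e1_def)
  have Qe: "Q * e1 \<le> \<epsilon>" "Q * e1 \<le> c / 4" using Q by (auto simp: e1_def)
  have "1 * e1 \<le> Q * e1" using Q e1 by (intro mult_right_mono) auto
  with Qe have e1c: "e1 \<le> c / 4" by simp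
  \<comment> \<open>With these choices \<open>fitmass\<close> changes by at most \<open>c / 2\<close> within a time \<open>h\<close>.\<close>
  define e2 where "e2 = c / (4 * M)"
  have e2: "0 < e2" "M * e2 = c / 4" using c Mpos by (auto simp: e2_def)
  define B1 h where "B1 = B + 1" and "h = c / (4 * M * B1)"
  have B1: "0 < B1" "B \<le> B1" using B by (auto simp: B1_def)
  have h: "0 < h" using c Mpos B1 by (simp add: h_def)
  have "M * (B * h) \<le> M * (B1 * h)" using h Mpos B1 by (intro mult_left_mono mult_right_mono) auto
  also have "\<dots> = c / 4" using Mpos B1 by (simp add: h_def)
  finally have Bh: "M * (B * h) \<le> c / 4" .
  have "(\<lambda>n. deviation (scaled n (X n) 0)) \<longlonglongrightarrow> (\<Sum>k\<in>Kbar G. \<bar>ystar k - ystar k\<bar>)"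
    unfolding deviation_def by (intro tendsto_intros init)
  then have "\<forall>\<^sub>F n in sequentially. deviation (scaled n (X n) 0) < e1"
    using e1 by (intro order_tendstoD(2)) auto
  from this arrivals_law[OF c(1) e1 C] departures_limit[OF e1, of C] scaled_oscillation[OF e2(1), of C]
  show ?thesis
  proof eventually_elim
    case (elim n)
    let ?z = "scaled n (X n)" and ?g = "\<lambda>t. deviation (scaled n (X n) t)"
    note p = paths[of n]
    have servers: "server_feasible (?z t)" if "0 \<le> t" for t by (rule path_servers[OF p that])
    have gint: "?g integrable_on {0..t}" for t
      by (rule step_function_integrable[OF scaled_step[OF p]]) (auto simp: deviation_def)
    have gbd: "?g t \<le> (\<Sum>k\<in>Kbar G. frac G (snd k) + ystar k)" if "0 \<le> t" for t
      unfolding deviation_def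
      using scaled_bounds[OF p that] ystar_positive by (intro sum_mono) (fastforce simp: positive_def abs_le_iff)
    have close: "?g t \<le> Q * e1" if t: "t \<in> {0..C}" and room: "\<And>u i. u \<in> {0..t} \<Longrightarrow> c \<le> fitmass (?z u) i" for t
    proof -
      have "?g s \<le> (1 + 2 * M * I) * e1 + L * integral {0..s} ?g" if s: "s \<in> {0..t}" for s
      proof -
        let ?G = "integral {0..s} ?g"
        let ?w = "\<lambda>e. (real (A n s e) - real (D n s e)) / rs n"
        have w: "\<bar>?w e\<bar> \<le> 2 * e1 + \<Lambda> * ?G" if e: "e \<in> edges G" for e
        proof -
          obtain k i where ki: "e = (k, i)" by (cases e)
          have a: "\<bar>real (A n s e) / rs n - integral {0..s} (\<lambda>u. arr (?z u) e)\<bar> \<le> e1"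
            unfolding ki using s t room e by (intro elim(2)[rule_format, OF p]) (auto simp: ki)
          have d: "\<bar>real (D n s e) / rs n - integral {0..s} (\<lambda>u. dep (?z u) e)\<bar> \<le> e1"
            using s t e by (intro elim(3)[rule_format, OF _ p]) auto
          have "norm (integral {0..s} (\<lambda>u. arr (?z u) e - dep (?z u) e)) \<le> integral {0..s} (\<lambda>u. \<Lambda> * ?g u)"
          proof (rule integral_norm_bound_integral)
            show "(\<lambda>u. arr (?z u) e - dep (?z u) e) integrable_on {0..s}"
              by (intro integrable_diff arr_integrable[OF p e] dep_integrable[OF p e]) auto
            show "(\<lambda>u. \<Lambda> * ?g u) integrable_on {0..s}" using gint by (rule integrable_on_mult_right)
            fix u assume u: "u \<in> {0..s}"
            have "c \<le> fitmass ystar (snd e)" using c(2)[of "snd e"] c(1) by linarith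
            then have "\<bar>arr (?z u) e - arr ystar e\<bar> + \<bar>dep (?z u) e - dep ystar e\<bar> \<le> \<Lambda> * ?g u"
              unfolding \<Lambda>_def using u s room by (intro rates_lipschitz e servers c(1)) auto
            then show "norm (arr (?z u) e - dep (?z u) e) \<le> \<Lambda> * ?g u"
              using ystar_balanced[OF e] by simp
          qed
          then have "\<bar>integral {0..s} (\<lambda>u. arr (?z u) e) - integral {0..s} (\<lambda>u. dep (?z u) e)\<bar> \<le> \<Lambda> * ?G"
            using Henstock_Kurzweil_Integration.integral_diff[OF arr_integrable[OF p e order_refl] dep_integrable[OF p e order_refl], of s]
            by simp
          then show ?thesis using a d unfolding diff_divide_distrib by linarith
        qed
        have G0: "0 \<le> ?G" by (intro integral_nonneg gint deviation_nonneg)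
        have "\<bar>?z s k - ystar k\<bar> \<le> \<bar>?z 0 k - ystar k\<bar> + I * (2 * e1 + \<Lambda> * ?G)" if k: "k \<in> Kbar G" for k
        proof -
          have "\<bar>netflow ?w k\<bar> \<le> I * (2 * e1 + \<Lambda> * ?G)"
            unfolding I_def using e1 Lpos G0 by (intro netflow_bound w) auto
          then show ?thesis using path_balance[OF p k, of s] s by simp
        qed
        then have "?g s \<le> (\<Sum>k\<in>Kbar G. \<bar>?z 0 k - ystar k\<bar> + I * (2 * e1 + \<Lambda> * ?G))"
          unfolding deviation_def by (intro sum_mono)
        also have "\<dots> = ?g 0 + M * (I * (2 * e1 + \<Lambda> * ?G))"
          by (simp add: sum.distrib deviation_def M_def)
        also have "\<dots> = ?g 0 + 2 * M * I * e1 + L * ?G"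
          by (simp add: L_def algebra_simps)
        finally show ?thesis using elim(1) by (simp add: distrib_right)
      qed
      then have "?g t \<le> 2 * ((1 + 2 * M * I) * e1) * exp (2 * L * t)"
        using t Mpos Ipos e1 gint gbd deviation_nonneg
        by (intro gronwall_bounded[where C = t and B = "\<Sum>k\<in>Kbar G. frac G (snd k) + ystar k"] L) auto
      also have "\<dots> \<le> 2 * ((1 + 2 * M * I) * e1) * exp (2 * L * C)"
        using t L Mpos Ipos e1 by (intro mult_left_mono) auto
      also have "\<dots> = Q * e1" by (simp add: Q_def)
      finally show ?thesis .
    qed
    have room_step: "c \<le> fitmass (?z t) i"
      if s: "0 \<le> s" "s \<le> t" "t \<le> C" "t - s \<le> h" "?g s \<le> c / 4" for s t i
    proof -
      have "\<bar>?z t k - ?z s k\<bar> \<le> B * h + e2" if k: "k \<in> Kbar G" for k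
      proof -
        have "\<bar>?z t k - ?z s k\<bar> \<le> 2 * real CARD('i) * rate_bound * (t - s) + e2"
          by (rule elim(4)[rule_format, OF p]) (use s k in auto)
        also have "2 * real CARD('i) * rate_bound * (t - s) \<le> B * h"
          unfolding B_def I_def using s rate_bound_nonneg by (intro mult_left_mono) auto
        finally show ?thesis by simp
      qed
      then have "\<bar>fitmass (?z t) i - fitmass (?z s) i\<bar> \<le> (\<Sum>k\<in>fitting G i. B * h + e2)"
        unfolding fitmass_def sum_subtractf[symmetric] by (intro order_trans[OF sum_abs] sum_mono) (auto dest: fitting_Kbar)
      also have "\<dots> \<le> (\<Sum>k\<in>Kbar G. B * h + e2)"
        using B h e2 by (intro sum_mono2) (auto dest: fitting_Kbar)
      also have "\<dots> = M * (B * h) + M * e2" by (simp add: M_def distrib_left)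
      finally have "\<bar>fitmass (?z t) i - fitmass (?z s) i\<bar> \<le> c / 2" using Bh e2(2) by linarith
      then show ?thesis using deviation_fitmass[of "?z s" i] s(5) c(1) c(2)[of i] by linarith
    qed
    have room: "\<forall>t\<in>{0..C}. t \<le> real j * h \<longrightarrow> (\<forall>i. c \<le> fitmass (?z t) i)" for j
    proof (induction j)
      case 0
      have "?g 0 \<le> c / 4" using elim(1) e1c by linarith
      then have "c \<le> fitmass (?z 0) i" for i using h C by (intro room_step[of 0 0]) auto
      moreover have "t = 0" if "t \<in> {0..C}" "t \<le> real 0 * h" for t using that by simp
      ultimately show ?case by blast
    next
      case (Suc j)
      show ?case
      proof (intro ballI impI allI)
        fix t i assume t: "t \<in> {0..C}" "t \<le> real (Suc j) * h"
        show "c \<le> fitmass (?z t) i"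
        proof (cases "t \<le> real j * h")
          case False
          define s where "s = real j * h"
          have s: "0 \<le> s" "s \<le> t" "t - s \<le> h" using False t h by (auto simp: s_def distrib_right)
          have "c \<le> fitmass (?z u) i" if "u \<in> {0..s}" for u i
            using Suc that s t by (auto simp: s_def)
          then have "?g s \<le> Q * e1" using s t by (intro close) auto
          then show ?thesis using s t Qe by (intro room_step[of s t]) auto
        qed (use Suc t in auto)
      qed
    qed
    obtain j :: nat where "C / h < real j" using reals_Archimedean2 by blast
    then have "C \<le> real j * h" using h by (simp add: field_simps)
    then have R: "c \<le> fitmass (?z t) i" if "t \<in> {0..C}" for t i using room[of j] that by auto
    show ?case
    proof
      fix t assume t: "t \<in> {0..C}"
      then have "?g t \<le> Q * e1" using R by (intro close) auto
      then show "?g t \<le> \<epsilon> \<and> (\<forall>i. c \<le> fitmass (?z t) i)" using Qe R[OF t] by auto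
    qed
  qed
qed

text \<open>Since arrivals and departures balance at \<open>ystar\<close>, the limiting paths are constant or linear.\<close>

theorem equilibrium_path:
  assumes paths: "\<And>n. path n (X n) (D n) (A n)"
    and init: "\<And>k. k \<in> Kbar G \<Longrightarrow> (\<lambda>n. scaled n (X n) 0 k) \<longlonglongrightarrow> ystar k"
  shows "fluid_sample_path G rs (\<lambda>_. x_opt G) (\<lambda>t e. t * dep ystar e) (\<lambda>t e. t * arr ystar e)"
proof -
  obtain c where c: "0 < c" "\<And>i. 2 * c \<le> fitmass ystar i" using fitmass_ystar_lower by blast
  have S: "0 < rate_slope c" by (rule rate_slope_pos[OF c(1)])
  have dev: "\<forall>\<^sub>F n in sequentially. \<forall>t\<in>{0..C}. deviation (scaled n (X n) t) \<le> \<epsilon> \<and> (\<forall>i. c \<le> fitmass (scaled n (X n) t) i)"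
    if "0 < C" "0 < \<epsilon>" for C \<epsilon>
    by (rule deviation_limit[OF paths _ c that]) (rule init)
  have Xlim: "uniform_limit {0..C} (\<lambda>n t. real (X n t k) / rs n) (\<lambda>t. x_opt G k) sequentially" if k: "k \<in> K G" for k C
  proof (rule uniform_limit_leI)
    fix \<epsilon> :: real assume e: "0 < \<epsilon>"
    have "0 < max C 1" by simp
    from dev[OF this e]
    show "\<forall>\<^sub>F n in sequentially. \<forall>t\<in>{0..C}. \<bar>real (X n t k) / rs n - x_opt G k\<bar> \<le> \<epsilon>"
    proof eventually_elim
      case (elim n)
      have "k \<in> Kbar G" "ystar k = x_opt G k" using k by (auto simp: K_iff ystar_def bar_K)
      then show ?case
        using elim deviation_coord[of k "scaled n (X n) _"] by (fastforce simp: scaled_def intro: order_trans)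
    qed
  qed
  have rates: "\<forall>\<^sub>F n in sequentially. \<forall>t\<in>{0..C}.
      \<bar>real (D n t e) / rs n - t * dep ystar e\<bar> \<le> \<epsilon> \<and> \<bar>real (A n t e) / rs n - t * arr ystar e\<bar> \<le> \<epsilon>"
    if e: "e \<in> edges G" and eps: "0 < \<epsilon>" for e C \<epsilon>
  proof -
    define C' where "C' = max C 1"
    have C': "0 < C'" "C \<le> C'" by (auto simp: C'_def)
    have half: "0 < \<epsilon> / 2" using eps by simp
    have small: "0 < \<epsilon> / 2 / (rate_slope c * C')" using eps S C' by simp
    from dev[OF C'(1) small] departures_limit[OF half, of C'] arrivals_law[OF c(1) half C'(1)]
    show ?thesis
    proof eventually_elim
      case (elim n)
      let ?z = "scaled n (X n)"
      note p = paths[of n]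
      show ?case
      proof
        fix t assume t: "t \<in> {0..C}"
        then have t': "t \<in> {0..C'}" using C' by auto
        obtain k i where ki: "e = (k, i)" by (cases e)
        have d: "\<bar>real (D n t e) / rs n - integral {0..t} (\<lambda>u. dep (?z u) e)\<bar> \<le> \<epsilon> / 2"
          using t' e by (intro elim(2)[rule_format, OF _ p]) auto
        have a: "\<bar>real (A n t e) / rs n - integral {0..t} (\<lambda>u. arr (?z u) e)\<bar> \<le> \<epsilon> / 2"
          unfolding ki using t' elim(1) e by (intro elim(3)[rule_format, OF p]) (auto simp: ki)
        have lip: "\<bar>arr (?z u) e - arr ystar e\<bar> + \<bar>dep (?z u) e - dep ystar e\<bar> \<le> \<epsilon> / 2 / C'" if u: "u \<in> {0..t}" for u
        proof -
          have "u \<in> {0..C'}" using u t' by auto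
          then have dev: "deviation (?z u) \<le> \<epsilon> / 2 / (rate_slope c * C')" "c \<le> fitmass (?z u) (snd e)" using elim(1) by auto
          have "c \<le> fitmass ystar (snd e)" using c(2)[of "snd e"] c(1) by linarith
          then have "\<bar>arr (?z u) e - arr ystar e\<bar> + \<bar>dep (?z u) e - dep ystar e\<bar> \<le> rate_slope c * deviation (?z u)"
            using u dev(2) by (intro rates_lipschitz e path_servers[OF p] c(1)) auto
          also have "\<dots> \<le> rate_slope c * (\<epsilon> / 2 / (rate_slope c * C'))"
            using S dev(1) by (intro mult_left_mono) auto
          finally show ?thesis using S by simp
        qed
        then have lip: "\<bar>arr (?z u) e - arr ystar e\<bar> \<le> \<epsilon> / 2 / C'" "\<bar>dep (?z u) e - dep ystar e\<bar> \<le> \<epsilon> / 2 / C'"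
          if "u \<in> {0..t}" for u using that by (smt (verit))+
        have scale: "\<epsilon> / 2 / C' * (t - 0) \<le> \<epsilon> / 2"
        proof -
          have "\<epsilon> / 2 / C' * (t - 0) \<le> \<epsilon> / 2 / C' * C'" using t' eps C' by (intro mult_left_mono) auto
          then show ?thesis using C' by simp
        qed
        have "\<bar>integral {0..t} (\<lambda>u. dep (?z u) e) - integral {0..t} (\<lambda>u. dep ystar e)\<bar> \<le> \<epsilon> / 2 / C' * (t - 0)"
          using t by (intro integral_close dep_integrable[OF p e] lip) auto
        moreover have "\<bar>integral {0..t} (\<lambda>u. arr (?z u) e) - integral {0..t} (\<lambda>u. arr ystar e)\<bar> \<le> \<epsilon> / 2 / C' * (t - 0)"
          using t by (intro integral_close arr_integrable[OF p e] lip) auto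
        moreover have "integral {0..t} (\<lambda>u. dep ystar e) = t * dep ystar e" "integral {0..t} (\<lambda>u. arr ystar e) = t * arr ystar e"
          using t by simp_all
        ultimately show "\<bar>real (D n t e) / rs n - t * dep ystar e\<bar> \<le> \<epsilon> \<and> \<bar>real (A n t e) / rs n - t * arr ystar e\<bar> \<le> \<epsilon>"
          using a d scale by linarith
      qed
    qed
  qed
  have "uniform_limit {0..C} (\<lambda>n t. real (D n t e) / rs n) (\<lambda>t. t * dep ystar e) sequentially"
    and "uniform_limit {0..C} (\<lambda>n t. real (A n t e) / rs n) (\<lambda>t. t * arr ystar e) sequentially" if "e \<in> edges G" for e C
    by (rule uniform_limit_leI, rule eventually_mono[OF rates[OF that]], auto)+
  with Xlim paths prim show ?thesis
    unfolding fluid_sample_path_def path_def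
    by (intro conjI ballI locally_lipschitz_const locally_lipschitz_linear
        exI[of _ Pd] exI[of _ Pa] exI[of _ xi] exI[of _ id] exI[of _ X] exI[of _ D] exI[of _ A])
       (auto simp: strict_mono_def)
qed

end

subsection \<open>Existence\<close>

context slack_model
begin

text \<open>Round down the numbers of occupied servers and let the idle servers take up the difference.\<close>

lemma initial_states:
  assumes scal: "scaling_sequence G rs"
  obtains Y0 where "\<And>n s. real (\<Sum>k\<in>Kbar_of G s. Y0 n k) = frac G s * rs n"
    "\<And>k. k \<in> Kbar G \<Longrightarrow> (\<lambda>n. real (Y0 n k) / rs n) \<longlonglongrightarrow> ystar k"
proof -
  have r1: "1 \<le> rs n" and rlim: "filterlim rs at_top sequentially" and nat: "frac G s * rs n \<in> \<nat>" for n s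
    using scal by (auto simp: scaling_sequence_def)
  have r0: "0 < rs n" "rs n \<noteq> 0" for n using r1[of n] by auto
  define N where "N = (\<lambda>n s. nat \<lfloor>frac G s * rs n\<rfloor>)"
  have N: "frac G s * rs n = real (N n s)" for n s
    using nat[of s n] unfolding N_def by (elim Nats_cases) simp
  define f where "f = (\<lambda>n k. nat \<lfloor>rs n * ystar k\<rfloor>)"
  define Y0 where "Y0 = (\<lambda>n k. if k = zero_cfg (snd k) then N n (snd k) - (\<Sum>k'\<in>K_of G (snd k). f n k') else f n k)"
  have y0: "0 < ystar k" if "k \<in> Kbar G" for k using ystar_positive that by (simp add: positive_def)
  have f: "real (f n k) \<le> rs n * ystar k" "rs n * ystar k - 1 \<le> real (f n k)" if "k \<in> Kbar G" for n k
  proof -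
    have "0 \<le> rs n * ystar k" using y0[OF that] r0(1)[of n] by simp
    then show "real (f n k) \<le> rs n * ystar k" "rs n * ystar k - 1 \<le> real (f n k)" unfolding f_def by linarith+
  qed
  have split: "frac G s = ystar (zero_cfg s) + (\<Sum>k\<in>K_of G s. ystar k)" for s
  proof -
    have "(\<Sum>k\<in>Kbar_of G s. ystar k) = frac G s" using ystar_feasible by (simp add: feasible_def server_feasible_def)
    then show ?thesis unfolding Kbar_of_eq by (subst (asm) sum.insert) (auto simp: K_of_iff K_iff)
  qed
  have le: "(\<Sum>k\<in>K_of G s. f n k) \<le> N n s" for n s
  proof -
    have "real (\<Sum>k\<in>K_of G s. f n k) \<le> (\<Sum>k\<in>K_of G s. rs n * ystar k)"
      unfolding of_nat_sum by (intro sum_mono f) (auto simp: K_of_iff K_iff)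
    also have "\<dots> = rs n * (\<Sum>k\<in>K_of G s. ystar k)" by (simp add: sum_distrib_left)
    also have "\<dots> \<le> rs n * frac G s"
      using split[of s] y0[OF zero_in_Kbar, of s] r0(1)[of n] by (intro mult_left_mono) auto
    also have "\<dots> = real (N n s)" using N[of s n] by (simp add: mult.commute)
    finally show ?thesis by (simp only: of_nat_le_iff)
  qed
  have Y0K: "Y0 n k = f n k" if "k \<in> K G" for n k using that by (auto simp: Y0_def K_iff)
  have Y0z: "Y0 n (zero_cfg s) = N n s - (\<Sum>k\<in>K_of G s. f n k)" for n s by (simp add: Y0_def)
  have sum: "(\<Sum>k\<in>Kbar_of G s. Y0 n k) = N n s" for n s
  proof -
    have "(\<Sum>k\<in>K_of G s. Y0 n k) = (\<Sum>k\<in>K_of G s. f n k)"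
      by (rule sum.cong) (auto simp: Y0K K_of_iff)
    then show ?thesis unfolding Kbar_of_eq using le[of n s] by (subst sum.insert) (auto simp: Y0z K_of_iff K_iff)
  qed
  have limf: "(\<lambda>n. real (f n k) / rs n) \<longlonglongrightarrow> ystar k" if k: "k \<in> Kbar G" for k
  proof (rule tendsto_sandwich)
    have "(\<lambda>n. ystar k - 1 / rs n) \<longlonglongrightarrow> ystar k - 0"
      by (intro tendsto_intros tendsto_divide_0[OF tendsto_const] filterlim_at_top_imp_at_infinity rlim)
    then show "(\<lambda>n. ystar k - 1 / rs n) \<longlonglongrightarrow> ystar k" by simp
    show "\<forall>\<^sub>F n in sequentially. ystar k - 1 / rs n \<le> real (f n k) / rs n"
    proof (intro always_eventually allI)
      fix n show "ystar k - 1 / rs n \<le> real (f n k) / rs n"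
        using divide_right_mono[OF f(2)[OF k, of n] less_imp_le[OF r0(1)[of n]]] r0(2)[of n]
        by (simp add: diff_divide_distrib)
    qed
    show "\<forall>\<^sub>F n in sequentially. real (f n k) / rs n \<le> ystar k"
    proof (intro always_eventually allI)
      fix n show "real (f n k) / rs n \<le> ystar k"
        using f(1)[OF k, of n] r0(1)[of n] by (simp add: field_simps)
    qed
  qed (rule tendsto_const)
  have lim: "(\<lambda>n. real (Y0 n k) / rs n) \<longlonglongrightarrow> ystar k" if k: "k \<in> Kbar G" for k
  proof (cases "k \<in> K G")
    case True
    then show ?thesis using limf[OF k] by (simp add: Y0K)
  next
    case False
    then obtain s where s: "k = zero_cfg s" using Kbar_cases[OF k] by blast
    have "real (Y0 n k) / rs n = frac G s - (\<Sum>k\<in>K_of G s. real (f n k) / rs n)" for n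
    proof -
      have "real (Y0 n k) = frac G s * rs n - (\<Sum>k\<in>K_of G s. real (f n k))"
        unfolding s Y0z N using le[of n s] by (simp add: of_nat_diff)
      then show ?thesis using r0(2)[of n] by (simp add: diff_divide_distrib sum_divide_distrib)
    qed
    moreover have "(\<lambda>n. frac G s - (\<Sum>k\<in>K_of G s. real (f n k) / rs n)) \<longlonglongrightarrow> frac G s - (\<Sum>k\<in>K_of G s. ystar k)"
      by (intro tendsto_intros limf) (auto simp: K_of_iff K_iff)
    ultimately show ?thesis using split[of s] by (simp add: s)
  qed
  show thesis by (rule that[of Y0]) (use sum N lim in auto)
qed

text \<open>The field \<open>F\<close> contains the rates of the systems for all \<open>r\<close> in the sequence, so that the same realization of
  the primitives drives all of them without simultaneous events.\<close>

theorem equilibrium_fluid_sample_path: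
  assumes scal: "scaling_sequence G rs"
  shows "fluid_sample_path G rs (\<lambda>_. x_opt G) (\<lambda>t e. t * dep ystar e) (\<lambda>t e. t * arr ystar e)"
proof -
  have r1: "1 \<le> rs n" and rlim: "filterlim rs at_top sequentially" for n
    using scal by (auto simp: scaling_sequence_def)
  obtain Y0 where Y0: "\<And>n s. real (\<Sum>k\<in>Kbar_of G s. Y0 n k) = frac G s * rs n"
    "\<And>k. k \<in> Kbar G \<Longrightarrow> (\<lambda>n. real (Y0 n k) / rs n) \<longlonglongrightarrow> ystar k"
    using initial_states[OF scal] by blast
  define F where "F = field_closure (range (lam G) \<union> range (mu G) \<union> range rs)"
  have "countable F" unfolding F_def by (intro countable_field_closure) simp
  from transcendental_exists[OF this zero_less_one]
  obtain \<alpha> where alpha: "0 < \<alpha>" "\<alpha> < 1" and trans: "\<And>p. (\<forall>m. coeff p m \<in> F) \<Longrightarrow> poly p \<alpha> = 0 \<Longrightarrow> p = 0"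
    by blast
  define code :: "('a, 'b) stream \<Rightarrow> nat \<Rightarrow> nat" where "code = (\<lambda>e j. Suc (prod_encode (to_nat e, j)))"
  have sys: "event_system G (rs n) \<alpha> F (\<lambda>_. grid_mark) (Y0 n) code" for n
  proof unfold_locales
    show "0 < rs n" using r1[of n] by simp
    show "grid_mark m \<le> 1" for m using grid_mark_unit[of m] by simp
    show "lam G i * rs n \<in> F" "mu G i \<in> F" for i
      unfolding F_def by (rule field_closure_ops(3)[OF field_closure_base(1) field_closure_base(1)], simp, simp)
        (rule field_closure_base(1), simp)
    show "code e j = code e' j' \<Longrightarrow> e = e' \<and> j = j'" for e j e' j' by (simp add: code_def)
  qed (use alpha trans Y0(1) field_closure_ops field_closure_base(2,3) in \<open>auto simp: F_def code_def\<close>)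
  define T where "T = (\<lambda>e j. real j + 1 + \<alpha> ^ code e j)"
  define Pa where "Pa = (\<lambda>i. count_path (T (Inr i)))"
  define Pd where "Pd = (\<lambda>e. count_path (T (Inl e)))"
  have T: "real j + 1 < T e j" "T e j < real j + 2" for e j
    using event_system.T_bounds[OF sys[of 0]] by (simp_all add: event_system.T_def[OF sys[of 0]] T_def)
  have prim: "primitives_ok G rs Pd Pa (\<lambda>_. grid_mark)"
    unfolding primitives_ok_def Pd_def Pa_def
    by (intro conjI ballI allI grid_mark_unit grid_marks_limit[OF rlim r1]
        count_path_poisson[OF T] count_path_limit[OF T rlim r1])
  interpret driven_slack_model G rs Pd Pa "\<lambda>_. grid_mark"
    using scal prim by unfold_locales
  have "\<exists>X D A. path n X D A \<and> X 0 = Y0 n" for n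
  proof -
    have "event_system.T \<alpha> code = T"
      by (intro ext) (simp add: event_system.T_def[OF sys[of n]] T_def)
    then have "event_system.Pa \<alpha> code = Pa" "event_system.Pd \<alpha> code = Pd"
      by (intro ext; simp add: event_system.Pa_def[OF sys[of n]] event_system.Pd_def[OF sys[of n]] Pa_def Pd_def)+
    then show ?thesis using event_system.path_exists[OF sys[of n]] by (simp add: path_def)
  qed
  then obtain X D A where paths: "\<And>n. path n (X n) (D n) (A n)" and X0: "\<And>n. X n 0 = Y0 n" by metis
  show ?thesis
    by (rule equilibrium_path[OF paths]) (simp add: scaled_def X0 Y0(2))
qed

end

section \<open>Stability and uniqueness of the optimal point\<close>

theorem lemma15:
  fixes G :: "('i::finite, 's::finite) grand_system" and rs :: "nat \<Rightarrow> real"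
  assumes "grand_system_ok G"
    and "scaling_sequence G rs"
    and "\<exists>x\<in>X_diamond G. idle_positive G x"
  shows "(\<exists>\<epsilon>>0. \<forall>\<delta>>0. \<exists>T\<ge>0. \<forall>x d a.
            fluid_sample_path G rs x d a \<and> x 0 \<in> X_diamond G \<and> distK G (x 0) (x_opt G) \<le> \<epsilon> \<longrightarrow>
            (\<forall>t\<ge>T. distK G (x t) (x_opt G) < \<delta>)) \<and>
         idle_positive G (x_opt G) \<and>
         (\<exists>d a. fluid_sample_path G rs (\<lambda>_. x_opt G) d a \<and>
            (\<forall>x' d' a'.
               fluid_sample_path G rs x' d' a' \<and> invariant_path G x' \<and> idle_positive G (x' 0) \<longrightarrow>
               (\<forall>t\<ge>0. (\<forall>k\<in>K G. x' t k = x_opt G k) \<and>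
                       (\<forall>e\<in>edges G. d' t e = d t e \<and> a' t e = a t e))))"
proof -
  interpret slack_model G using assms by unfold_locales
  have gap: "gap (bar G z) = distK G z (x_opt G)" for z
    unfolding gap_def distK_def ystar_def by (rule L2_set_cong) (simp_all add: bar_K)
  note fsp = fluid_sample_path_equations[OF _ assms(2)]
  have stable: "\<exists>\<epsilon>>0. \<forall>\<delta>>0. \<exists>T\<ge>0. \<forall>x d a.
            fluid_sample_path G rs x d a \<and> x 0 \<in> X_diamond G \<and> distK G (x 0) (x_opt G) \<le> \<epsilon> \<longrightarrow>
            (\<forall>t\<ge>T. distK G (x t) (x_opt G) < \<delta>)"
  proof -
    obtain \<epsilon> where eps: "0 < \<epsilon>" "\<And>\<delta>. 0 < \<delta> \<Longrightarrow> \<exists>T\<ge>0. \<forall>y. fluid_solution y \<and> feasible (y 0) \<and> gap (y 0) \<le> \<epsilon> \<longrightarrow> (\<forall>t\<ge>T. gap (y t) < \<delta>)"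
      using fluid_stability by blast
    show ?thesis
    proof (rule exI[of _ \<epsilon>], intro conjI allI impI eps(1))
      fix \<delta> :: real assume "0 < \<delta>"
      from eps(2)[OF this] obtain T where T: "0 \<le> T"
        "\<forall>y. fluid_solution y \<and> feasible (y 0) \<and> gap (y 0) \<le> \<epsilon> \<longrightarrow> (\<forall>t\<ge>T. gap (y t) < \<delta>)" by (elim exE conjE)
      show "\<exists>T\<ge>0. \<forall>x d a.
            fluid_sample_path G rs x d a \<and> x 0 \<in> X_diamond G \<and> distK G (x 0) (x_opt G) \<le> \<epsilon> \<longrightarrow>
            (\<forall>t\<ge>T. distK G (x t) (x_opt G) < \<delta>)"
      proof (rule exI[of _ T], intro conjI allI impI T(1))
        fix x d a t
        assume "fluid_sample_path G rs x d a \<and> x 0 \<in> X_diamond G \<and> distK G (x 0) (x_opt G) \<le> \<epsilon>" and t: "T \<le> t"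
        then have "fluid_solution (\<lambda>t. bar G (x t)) \<and> feasible (bar G (x 0)) \<and> gap (bar G (x 0)) \<le> \<epsilon>"
          using fsp(1)[of x d a] by (simp add: feasible_bar_iff gap)
        from T(2)[rule_format, of "\<lambda>t. bar G (x t)", OF this t]
        have "gap (bar G (x t)) < \<delta>" .
        then show "distK G (x t) (x_opt G) < \<delta>" by (simp add: gap)
      qed
    qed
  qed
  have idle: "idle_positive G (x_opt G)"
    using ystar_positive zero_in_Kbar by (auto simp: idle_positive_def positive_def ystar_def)
  have unique: "(\<forall>k\<in>K G. x' t k = x_opt G k) \<and> (\<forall>e\<in>edges G. d' t e = t * dep ystar e \<and> a' t e = t * arr ystar e)"
    if h: "fluid_sample_path G rs x' d' a'" "invariant_path G x'" "idle_positive G (x' 0)" and t: "0 \<le> t" for x' d' a' t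
  proof -
    have inv: "x' u k = x' 0 k" if "0 \<le> u" "k \<in> K G" for u k
      using h(2)[unfolded invariant_path_def, rule_format, OF that] .
    have bar_const: "bar G (x' u) k = bar G (x' 0) k" if u: "0 \<le> u" and k: "k \<in> Kbar G" for u k
    proof -
      have "(\<Sum>k'\<in>K_of G (snd k). x' u k') = (\<Sum>k'\<in>K_of G (snd k). x' 0 k')"
        by (intro sum.cong refl inv u) (simp add: K_of_iff)
      moreover have "k = zero_cfg (snd k) \<or> x' u k = x' 0 k"
        using inv[OF u, of k] k by (cases "k \<in> K G") (simp_all add: K_iff)
      ultimately show ?thesis unfolding bar_def by (elim disjE) simp_all
    qed
    have at0: "bar G (x' 0) k = ystar k" if "k \<in> Kbar G" for k
    proof (rule invariant_solution_unique[OF fsp(1)[OF h(1)] _ _ that])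
      show "\<And>u k. 0 \<le> u \<Longrightarrow> k \<in> Kbar G \<Longrightarrow> bar G (x' u) k = bar G (x' 0) k" by (rule bar_const)
      show "0 < bar G (x' 0) (zero_cfg s)" for s using h(3) by (simp add: idle_positive_def)
    qed
    have eq: "bar G (x' u) k = ystar k" if "0 \<le> u" "k \<in> Kbar G" for u k
      using bar_const[OF that] at0[OF that(2)] by simp
    have "x' t k = x_opt G k" if "k \<in> K G" for k
      using eq[OF t, of k] that by (simp add: K_iff ystar_def bar_K)
    moreover have "d' t e = t * dep ystar e \<and> a' t e = t * arr ystar e" if e: "e \<in> edges G" for e
    proof -
      obtain k i where ki: "e = (k, i)" by (cases e)
      have K: "k \<in> Kbar G" "del_cust k i \<in> Kbar G" using e by (auto simp: ki edges_iff del_in_Kbar)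
      have fm: "fitmass (bar G (x' u)) j = fitmass ystar j" if "0 \<le> u" for u j
        unfolding fitmass_def using eq[OF that] by (intro sum.cong) (auto dest: fitting_Kbar)
      have rates: "dep (bar G (x' u)) e = dep ystar e" "arr (bar G (x' u)) e = arr ystar e" if "0 \<le> u" for u
        using eq[OF that] fm[OF that] K by (auto simp: dep_def arr_def ki)
      have "d' t e = integral {0..t} (\<lambda>u. dep (bar G (x' u)) e)" by (rule fsp(2)[OF h(1) e t])
      also have "\<dots> = integral {0..t} (\<lambda>u. dep ystar e)"
        by (rule Henstock_Kurzweil_Integration.integral_cong) (simp add: rates)
      finally have "d' t e = t * dep ystar e" using t by simp
      moreover have "a' t e = integral {0..t} (\<lambda>u. arr (bar G (x' u)) e)"
        unfolding ki using e t fm positive_fitmass[OF ystar_positive] by (intro fsp(3)[OF h(1)]) (auto simp: ki)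
      moreover have "integral {0..t} (\<lambda>u. arr (bar G (x' u)) e) = integral {0..t} (\<lambda>u. arr ystar e)"
        by (rule Henstock_Kurzweil_Integration.integral_cong) (simp add: rates)
      ultimately show ?thesis using t by simp
    qed
    ultimately show ?thesis by blast
  qed
  show ?thesis
    using stable idle equilibrium_fluid_sample_path[OF assms(2)] unique
    by (intro conjI exI[of _ "\<lambda>t e. t * dep ystar e"] exI[of _ "\<lambda>t e. t * arr ystar e"]) blast+
qed

end
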